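(* Let $R>0$, let $B_R\subset\mathbb{R}^2$ be the ball of radius $R$ centered at the origin, let $\mu_2(y)=\frac{1}{\pi(1+|y|^2)^2}$ for $y\in\mathbb{R}^2$, write $\mathrm{d}\mu_2=\mu_2(x)\,\mathrm{d}x$, and set $\theta_R:=\int_{B_R}\mu_2(y)\,\mathrm{d}y=\frac{R^2}{1+R^2}$. Consider the functionals $$I_R(u)=\frac{1}{16\pi}\int_{B_R}|\nabla u(x)|^2\,\mathrm{d}x+\int_{B_R}u(x)\,\mathrm{d}\mu_2(x)\quad\text{for } u\in H^1_0(B_R),$$ and $$J_R(\rho)=\frac{2}{\sqrt{\pi}}\int_{B_R}\sqrt{\rho(y)}\,\mathrm{d}y-\int_{B_R}|y|^2\rho(y)\,\mathrm{d}y\quad\text{for } \rho\in\mathcal{P}(\mathbb{R}^2).$$ Then $$\sup\left\{J_R(\rho)-J_R(\mu_2):\ \rho\in\mathcal{P}(\mathbb{R}^2),\ \int_{B_R}\rho\,\mathrm{d}y=\theta_R\right\}=\inf\left\{I_R(u):\ u\in H^1_0(B_R),\ \int_{B_R}e^u\,\mathrm{d}\mu_2=\theta_R\right\}.$$ Moreover, the supremum on the left-hand side is attained at $\rho_{\max}=\mu_2$, the infimum on the right-hand side is attained at $u_{\min}=0$, and the common value of both sides is $0$.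
   Context: $\mathcal{P}(\mathbb{R}^2)$ denotes the set of probability densities on $\mathbb{R}^2$ (nonnegative measurable functions with integral $1$ with respect to Lebesgue measure). $H^1_0(B_R)$ is the usual Sobolev space of real-valued functions with zero trace on $\partial B_R$. *)

theory Defs
  imports "HOL-Analysis.Analysis"
begin

definition partial :: "'n \<Rightarrow> (real ^ 'n \<Rightarrow> real) \<Rightarrow> real ^ 'n \<Rightarrow> real"
  where "partial i f x = frechet_derivative f (at x) (axis i 1)"

fun C_k :: "nat \<Rightarrow> (real ^ 'n \<Rightarrow> real) \<Rightarrow> bool"
  where
    "C_k 0 f \<longleftrightarrow> continuous_on UNIV f"
  | "C_k (Suc k) f \<longleftrightarrow> (\<forall>x. f differentiable (at x)) \<and> (\<forall>i. C_k k (partial i f))"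

definition test_functions :: "(real ^ 'n) set \<Rightarrow> (real ^ 'n \<Rightarrow> real) set"
  where "test_functions \<Omega> =
    {\<phi>. (\<forall>k. C_k k \<phi>) \<and> compact (closure {x. \<phi> x \<noteq> 0}) \<and> closure {x. \<phi> x \<noteq> 0} \<subseteq> \<Omega>}"

definition locally_integrable_on :: "(real ^ 'n) set \<Rightarrow> (real ^ 'n \<Rightarrow> real) \<Rightarrow> bool"
  where "locally_integrable_on \<Omega> f \<longleftrightarrow>
    (\<forall>K. compact K \<and> K \<subseteq> \<Omega> \<longrightarrow> set_integrable lebesgue K f)"

definition has_weak_gradient ::
    "(real ^ 'n) set \<Rightarrow> (real ^ 'n \<Rightarrow> real) \<Rightarrow> (real ^ 'n \<Rightarrow> real ^ 'n) \<Rightarrow> bool"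
  where "has_weak_gradient \<Omega> u g \<longleftrightarrow>
    locally_integrable_on \<Omega> u \<and>
    (\<forall>i. locally_integrable_on \<Omega> (\<lambda>x. g x $ i)) \<and>
    (\<forall>i. \<forall>\<phi>\<in>test_functions \<Omega>.
      (LINT x:\<Omega>|lebesgue. u x * partial i \<phi> x) = - (LINT x:\<Omega>|lebesgue. g x $ i * \<phi> x))"

text \<open>A weak gradient on an open set is unique up to a null set, so the choice below does not
  affect any integral formed from it.\<close>

definition weak_gradient ::
    "(real ^ 'n) set \<Rightarrow> (real ^ 'n \<Rightarrow> real) \<Rightarrow> real ^ 'n \<Rightarrow> real ^ 'n"
  where "weak_gradient \<Omega> u = (SOME g. has_weak_gradient \<Omega> u g)"

definition L2_space :: "(real ^ 'n) set \<Rightarrow> (real ^ 'n \<Rightarrow> real) set"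
  where "L2_space \<Omega> =
    {f. set_borel_measurable lebesgue \<Omega> f \<and> set_integrable lebesgue \<Omega> (\<lambda>x. (f x)\<^sup>2)}"

text \<open>Elements are functions rather than classes modulo null sets, defined on the whole space;
  their values outside \<open>\<Omega>\<close> are irrelevant.\<close>

definition H1 :: "(real ^ 'n) set \<Rightarrow> (real ^ 'n \<Rightarrow> real) set"
  where "H1 \<Omega> =
    {u \<in> L2_space \<Omega>. \<exists>g. has_weak_gradient \<Omega> u g \<and> (\<forall>i. (\<lambda>x. g x $ i) \<in> L2_space \<Omega>)}"

definition H1_norm :: "(real ^ 'n) set \<Rightarrow> (real ^ 'n \<Rightarrow> real) \<Rightarrow> real"
  where "H1_norm \<Omega> u =
    sqrt ((LINT x:\<Omega>|lebesgue. (u x)\<^sup>2) + (LINT x:\<Omega>|lebesgue. (norm (weak_gradient \<Omega> u x))\<^sup>2))"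

text \<open>Zero trace is expressed in the usual way: \<open>H\<^sup>1\<^sub>0\<close> is the closure of the test functions in
  the \<open>H\<^sup>1\<close> norm.\<close>

definition H1_0 :: "(real ^ 'n) set \<Rightarrow> (real ^ 'n \<Rightarrow> real) set"
  where "H1_0 \<Omega> =
    {u \<in> H1 \<Omega>. \<exists>\<phi>. (\<forall>k. \<phi> k \<in> test_functions \<Omega>) \<and>
      (\<lambda>k::nat. H1_norm \<Omega> (\<lambda>x. \<phi> k x - u x)) \<longlonglongrightarrow> 0}"

definition prob_densities :: "(real ^ 2 \<Rightarrow> real) set"
  where "prob_densities =
    {\<rho> \<in> borel_measurable lebesgue. (\<forall>x. 0 \<le> \<rho> x) \<and> integrable lebesgue \<rho> \<and>
      (LINT x|lebesgue. \<rho> x) = 1}"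

definition mu2 :: "real ^ 2 \<Rightarrow> real"
  where "mu2 y = 1 / (pi * (1 + (norm y)\<^sup>2)\<^sup>2)"

definition mu2_measure :: "(real ^ 2) measure"
  where "mu2_measure = density lebesgue (\<lambda>x. ennreal (mu2 x))"

definition theta :: "real \<Rightarrow> real"
  where "theta R = (LINT y:ball 0 R|lebesgue. mu2 y)"

definition I_fun :: "real \<Rightarrow> (real ^ 2 \<Rightarrow> real) \<Rightarrow> real"
  where "I_fun R u =
    1 / (16 * pi) * (LINT x:ball 0 R|lebesgue. (norm (weak_gradient (ball 0 R) u x))\<^sup>2)
    + (LINT x:ball 0 R|mu2_measure. u x)"

definition J_fun :: "real \<Rightarrow> (real ^ 2 \<Rightarrow> real) \<Rightarrow> real"
  where "J_fun R \<rho> =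
    2 / sqrt pi * (LINT y:ball 0 R|lebesgue. sqrt (\<rho> y))
    - (LINT y:ball 0 R|lebesgue. (norm y)\<^sup>2 * \<rho> y)"

definition J_admissible :: "real \<Rightarrow> (real ^ 2 \<Rightarrow> real) set"
  where "J_admissible R =
    {\<rho> \<in> prob_densities. (LINT y:ball 0 R|lebesgue. \<rho> y) = theta R}"

text \<open>Integrability of \<open>exp \<circ> u\<close> is part of the constraint, so that it cannot be met through
  the convention that a non-integrable function has integral 0.\<close>

definition I_admissible :: "real \<Rightarrow> (real ^ 2 \<Rightarrow> real) set"
  where "I_admissible R =
    {u \<in> H1_0 (ball 0 R). set_integrable mu2_measure (ball 0 R) (\<lambda>x. exp (u x)) \<and>
      (LINT x:ball 0 R|mu2_measure. exp (u x)) = theta R}"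

end

theory Submission
  imports Defs "HOL-Real_Asymp.Real_Asymp"
begin

text \<open>That \<open>\<mu>\<^sub>2\<close> maximises \<open>J\<close> is the concavity of the square root. That \<open>I\<close> is
  nonnegative is a sharp Onofri inequality, obtained by mass transport. Extend a test function \<open>h\<close>
  by zero to the square \<open>Q = [-R, R]\<^sup>2\<close> and let \<open>T\<close> be the Knothe map from \<open>e\<^sup>h \<mu>\<^sub>2\<close> to (a multiple
  of) \<open>\<mu>\<^sub>2\<close> on \<open>Q\<close>: it is triangular with positive diagonal derivative, so
  \<open>(det DT)\<^bsup>1/2\<^esup> \<le> (div T) / 2\<close>, and it has the same normal component as the identity on the boundary
  of \<open>Q\<close>. Change variables in the integral of \<open>\<mu>\<^sub>2\<^bsup>1/2\<^esup>\<close>, integrate by parts, and apply Young's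
  inequality to the cross term; every term except \<open>I(h)\<close> is then explicit and cancels. Because \<open>T\<close> is
  triangular, only one-dimensional transports are needed. For \<open>u\<close> in \<open>H\<^sup>1\<^sub>0\<close> the inequality is applied
  to bounded truncations of the approximating test functions, for which the exponential integrals
  converge without a Moser--Trudinger bound.\<close>

section \<open>Transport on a square\<close>

text \<open>The square is preferred to the disc because all its fibres have the same two end points,
  which every one-dimensional transport fixes; the fibres of a disc vary with the first coordinate
  and shrink to points. The power 1/2 of the density is 1/n in dimension n = 2, the exponent for
  which the change of variables leaves exactly the geometric mean of the diagonal derivatives.
  Approximating test functions do not satisfy the exponential constraint, so the transport is set up
  for an arbitrary mass ratio c between the source and \<open>mu2\<close>. The price is a defect A
  (sqrt c - 1) - M (c - 1) on the smaller side of the inequality. It is continuous and vanishes at c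
  = 1, so the constraint has to hold only in the limit.\<close>

lemma antiderivative_UNIV:
  fixes p :: "real \<Rightarrow> real"
  assumes "continuous_on UNIV p"
  obtains P where "\<And>x. (P has_real_derivative p x) (at x)" "P a = 0"
proof -
  have "\<exists>F. \<forall>x::real. - \<infinity> < ereal x \<longrightarrow> ereal x < \<infinity> \<longrightarrow> (F has_vector_derivative p x) (at x)"
    using assms by (intro einterval_antiderivative) (auto simp: continuous_on_eq_continuous_at)
  then obtain F where F: "\<And>x. (F has_real_derivative p x) (at x)"
    by (auto simp: has_real_derivative_iff_has_vector_derivative)
  show ?thesis
    by (rule that[of "\<lambda>x. F x - F a"]) (auto intro!: derivative_eq_intros F)
qed

lemma integral_of_deriv:
  fixes P :: "real \<Rightarrow> real"
  assumes "a \<le> b" "\<And>x. x \<in> {a..b} \<Longrightarrow> (P has_real_derivative p x) (at x within {a..b})"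
  shows "(p has_integral (P b - P a)) {a..b}"
  using assms by (intro fundamental_theorem_of_calculus) (auto simp: has_real_derivative_iff_has_vector_derivative)

lemma integral_antideriv:
  fixes P :: "real \<Rightarrow> real"
  assumes "a \<le> b" "\<And>x. (P has_real_derivative p x) (at x)"
  shows "integral {a..b} p = P b - P a"
  by (rule integral_unique, rule integral_of_deriv, rule assms(1), rule has_field_derivative_at_within, rule assms(2))

lemma integral_pos:
  fixes g :: "real \<Rightarrow> real"
  assumes "a < b" "continuous_on UNIV g" "\<And>x. g x > 0"
  shows "integral {a..b} g > 0"
proof -
  obtain G where G: "\<And>x. (G has_real_derivative g x) (at x)"
    using antiderivative_UNIV[OF assms(2)] by blast
  have "integral {a..b} g = G b - G a"
    using assms(1) by (intro integral_antideriv G) auto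
  moreover have "G a < G b"
    by (rule DERIV_pos_imp_increasing[OF assms(1)]) (use G assms(3) in blast)
  ultimately show ?thesis by simp
qed

text \<open>The map is \<open>inv Q \<circ> P\<close> for the primitives normalised at
  \<open>a\<close>; equal mass makes it fix \<open>b\<close> as well. Since \<open>q\<close> is
  positive on the whole line, \<open>Q\<close> is also invertible beyond the end points, and the
  derivative is two-sided there.\<close>

lemma monotone_transport:
  fixes p q :: "real \<Rightarrow> real"
  assumes "a \<le> b" and p: "continuous_on UNIV p" "\<And>x. p x > 0" and q: "continuous_on UNIV q" "\<And>x. q x > 0"
    and mass: "integral {a..b} p = integral {a..b} q"
  obtains T where "T a = a" "T b = b" "\<And>x. x \<in> {a..b} \<Longrightarrow> T x \<in> {a..b}"
    "\<And>x. x \<in> {a..b} \<Longrightarrow> (T has_real_derivative p x / q (T x)) (at x)"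
proof -
  obtain P where P: "\<And>x. (P has_real_derivative p x) (at x)" "P a = 0"
    using antiderivative_UNIV[OF p(1)] by blast
  obtain Q where Q: "\<And>x. (Q has_real_derivative q x) (at x)" "Q a = 0"
    using antiderivative_UNIV[OF q(1)] by blast
  have "integral {a..b} p = P b - P a" "integral {a..b} q = Q b - Q a"
    by (rule integral_antideriv, rule \<open>a \<le> b\<close>, rule P Q)+
  with mass P(2) Q(2) have PQb: "P b = Q b" by simp
  have Pmono: "P x \<le> P y" if "x \<le> y" for x y
    using that P p by (intro DERIV_nonneg_imp_nondecreasing[OF that]) (meson less_imp_le)
  have Qsmono: "Q x < Q y" if "x < y" for x y
    using that Q q by (intro DERIV_pos_imp_increasing[OF that]) meson
  have Qinj: "inj Q"
    by (rule linorder_injI) (use Qsmono in force)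
  have Qcont: "continuous_on A Q" for A
    using Q(1) by (meson DERIV_isCont continuous_at_imp_continuous_on)
  define T where "T = (\<lambda>x. inv Q (P x))"
  have invQ: "inv Q (Q y) = y" for y using Qinj by simp
  have ex: "\<exists>y\<in>{a..b}. Q y = P x" if "x \<in> {a..b}" for x
  proof -
    have "Q a \<le> P x" "P x \<le> Q b" using Pmono[of a x] Pmono[of x b] that P(2) Q(2) PQb by auto
    then show ?thesis using IVT'[of Q a "P x" b] Qcont \<open>a \<le> b\<close> by fastforce
  qed
  have T: "T x \<in> {a..b}" "Q (T x) = P x" if "x \<in> {a..b}" for x
    using ex[OF that] invQ unfolding T_def by metis+
  show ?thesis
  proof (rule that[of T])
    show "T a = a" using invQ[of a] P(2) Q(2) by (simp add: T_def)
    show "T b = b" using invQ[of b] PQb by (simp add: T_def)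
    show "T x \<in> {a..b}" if "x \<in> {a..b}" for x using T that by blast
    show "(T has_real_derivative p x / q (T x)) (at x)" if x: "x \<in> {a..b}" for x
    proof -
      have "(inv Q has_derivative (\<lambda>h. h / q (T x))) (at (Q (T x)))"
      proof (rule has_derivative_inverse_strong[where S=UNIV and f=Q and x="T x" and f'="(*) (q (T x))"])
        show "(Q has_derivative (*) (q (T x))) (at (T x))"
          using Q(1) unfolding has_field_derivative_def .
        show "(*) (q (T x)) \<circ> (\<lambda>h. h / q (T x)) = id"
          using q(2)[of "T x"] by (auto simp: fun_eq_iff)
      qed (use Qcont invQ in auto)
      moreover have "(\<lambda>h. h / q (T x)) = (*) (1 / q (T x))" by auto
      ultimately have "(inv Q has_real_derivative (1 / q (T x))) (at (P x))"
        using T(2)[OF x] unfolding has_field_derivative_def by (simp only:)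
      from DERIV_chain2[OF this P(1)] show ?thesis unfolding T_def by simp
    qed
  qed
qed

text \<open>Differentiate \<open>G \<circ> T\<close> for a primitive \<open>G\<close> of
  \<open>F\<close> and apply the fundamental theorem for the gauge integral, which asks for no
  continuity of \<open>T'\<close>. Fixed ends remove \<open>T\<close> from the value.\<close>

lemma has_integral_substitution_fixed_ends:
  fixes F T :: "real \<Rightarrow> real"
  assumes "a \<le> b" "continuous_on UNIV F" "T a = a" "T b = b"
    "\<And>x. x \<in> {a..b} \<Longrightarrow> (T has_real_derivative T' x) (at x)"
  shows "((\<lambda>x. F (T x) * T' x) has_integral integral {a..b} F) {a..b}"
proof -
  obtain G where G: "\<And>x. (G has_real_derivative F x) (at x)"
    using antiderivative_UNIV[OF assms(2)] by blast
  have 1: "integral {a..b} F = G b - G a"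
    by (rule integral_antideriv[OF assms(1) G])
  have "((\<lambda>x. F (T x) * T' x) has_integral (G (T b) - G (T a))) {a..b}"
    by (rule integral_of_deriv[where P="\<lambda>x. G (T x)", OF assms(1)], rule has_field_derivative_at_within)
       (rule DERIV_chain2[OF G assms(5)])
  then show ?thesis using assms 1 by simp
qed

text \<open>Arithmetic-geometric mean for the diagonal entries \<open>k\<close> and \<open>t\<close>
  of the Jacobian of the Knothe map. The equation is its change of variables formula with
  determinant \<open>k * t\<close>, and it makes the left side equal to
  \<open>f * sqrt (k * t)\<close>.\<close>

lemma jacobian_amgm:
  fixes c k t f s :: real
  assumes "c > 0" "k > 0" "t \<ge> 0" "f > 0" "s > 0" "c * k * t * s\<^sup>2 = f\<^sup>2"
  shows "sqrt c * k * s * t \<le> f * (k + t) / 2"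
proof -
  have "(sqrt c * k * s * t)\<^sup>2 = (c * k * t * s\<^sup>2) * (k * t)"
    using assms by (simp add: power_mult_distrib power2_eq_square algebra_simps)
  also have "\<dots> = f\<^sup>2 * (k * t)" using assms by simp
  also have "\<dots> \<le> f\<^sup>2 * ((k + t) / 2)\<^sup>2"
    using sum_squares_bound[of k t] by (intro mult_left_mono) (auto simp: power2_eq_square field_simps)
  also have "\<dots> = (f * (k + t) / 2)\<^sup>2" by (simp add: power_mult_distrib power_divide)
  finally show ?thesis using assms by (rule_tac power2_le_imp_le) auto
qed

text \<open>In \<open>knothe_fibre\<close> this weight makes the inequality an equality at the identity map.\<close>

lemma young_weighted:
  fixes r v b :: real
  assumes "r > 0"
  shows "- v * b / 2 \<le> v\<^sup>2 / (8 * r) + r / 2 * b\<^sup>2"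
proof -
  have "0 \<le> (v + 2 * r * b)\<^sup>2 / (8 * r)" using assms by simp
  also have "\<dots> = v\<^sup>2 / (8 * r) + r / 2 * b\<^sup>2 + v * b / 2"
    using assms by (simp add: power2_eq_square field_simps)
  finally show ?thesis by simp
qed

text \<open>One fibre of the planar argument, at a fixed first coordinate: \<open>k\<close> stands
  for the derivative of the first component there, and \<open>s\<close> for the square root of the
  target density on the image fibre. The part of the divergence due to the second component is
  integrated by parts here; the other part, \<open>k\<close> times the integral of \<open>f\<close>,
  is left for the outer integration.\<close>

lemma knothe_fibre:
  fixes f v s :: "real \<Rightarrow> real"
  assumes R: "R > 0" and pos: "c > 0" "k > 0" "r > 0"
    and f: "\<And>x. f x > 0" "\<And>x. (f has_real_derivative f x * v x) (at x)"
    and v: "continuous_on UNIV v"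
    and s: "\<And>x. s x > 0" "continuous_on UNIV s"
    and mass: "integral {-R..R} (\<lambda>x. (f x)\<^sup>2) = c * k * integral {-R..R} (\<lambda>x. (s x)\<^sup>2)"
  shows "sqrt c * k * integral {-R..R} s \<le> k * integral {-R..R} f / 2 + R * (f R + f (-R)) / 2
    + integral {-R..R} (\<lambda>x. (v x)\<^sup>2) / (8 * r) + r / 2 * c * k * integral {-R..R} (\<lambda>x. x\<^sup>2 * (s x)\<^sup>2)"
proof -
  have fc: "continuous_on A f" for A
    using f(2) by (meson DERIV_isCont continuous_at_imp_continuous_on)
  have vc: "continuous_on A v" for A using v continuous_on_subset by blast
  have sc: "continuous_on A s" for A using s(2) continuous_on_subset by blast
  define p where "p x = (f x)\<^sup>2" for x
  define q where "q x = c * k * (s x)\<^sup>2" for x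
  have "integral {-R..R} p = integral {-R..R} q"
    using mass by (simp add: p_def[abs_def] q_def[abs_def])
  moreover have "continuous_on UNIV p" "continuous_on UNIV q"
    unfolding p_def[abs_def] q_def[abs_def] by (intro continuous_intros fc sc)+
  moreover have "p x > 0" "q x > 0" for x using f(1)[of x] s(1)[of x] pos by (auto simp: p_def q_def)
  ultimately obtain T where T: "T (-R) = -R" "T R = R" "\<And>x. x \<in> {-R..R} \<Longrightarrow> T x \<in> {-R..R}"
    "\<And>x. x \<in> {-R..R} \<Longrightarrow> (T has_real_derivative p x / q (T x)) (at x)"
    using monotone_transport[of "-R" R p q] R by auto
  define T' where "T' x = p x / q (T x)" for x
  have T'pos: "T' x > 0" for x
    unfolding T'_def using \<open>\<And>x. p x > 0\<close> \<open>\<And>x. q x > 0\<close> by simp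
  have T'eq: "c * k * T' x * (s (T x))\<^sup>2 = (f x)\<^sup>2" for x
    using pos s(1)[of "T x"] by (auto simp: T'_def p_def q_def)
  note sub = has_integral_substitution_fixed_ends[where a="-R" and b=R and T=T and T'=T', OF _ _ T(1,2) T(4)[folded T'_def]]
  have i1: "((\<lambda>x. sqrt c * k * (s (T x) * T' x)) has_integral sqrt c * k * integral {-R..R} s) {-R..R}"
    using R by (intro has_integral_mult_right sub sc) auto
  \<comment> \<open>In the bound \<open>f (k + T') / 2\<close> the summand \<open>f T'\<close> is
    completed to the exact derivative of \<open>f T\<close>; the compensating
    \<open>- v f T / 2\<close> is what Young's inequality absorbs into the last two terms.\<close>
  have i2: "((\<lambda>x. k / 2 * f x + (f x * T' x + f x * v x * T x) / 2 + (v x)\<^sup>2 / (8 * r)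
       + r / 2 * c * k * ((T x)\<^sup>2 * (s (T x))\<^sup>2 * T' x)) has_integral
     (k / 2 * integral {-R..R} f + R * (f R + f (-R)) / 2
    + integral {-R..R} (\<lambda>x. (v x)\<^sup>2) / (8 * r) + r / 2 * c * k * integral {-R..R} (\<lambda>x. x\<^sup>2 * (s x)\<^sup>2))) {-R..R}"
  proof (intro has_integral_add has_integral_mult_right has_integral_divide)
    show "(f has_integral integral {-R..R} f) {-R..R}"
      by (intro integrable_integral integrable_continuous_interval fc)
    show "((\<lambda>x. (v x)\<^sup>2) has_integral integral {-R..R} (\<lambda>x. (v x)\<^sup>2)) {-R..R}"
      by (intro integrable_integral integrable_continuous_interval continuous_intros vc)
    show "((\<lambda>x. (T x)\<^sup>2 * (s (T x))\<^sup>2 * T' x) has_integral integral {-R..R} (\<lambda>x. x\<^sup>2 * (s x)\<^sup>2)) {-R..R}"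
      using R by (intro sub continuous_intros sc) auto
    have "((\<lambda>x. f x * T' x + f x * v x * T x) has_integral f R * T R - f (-R) * T (-R)) {-R..R}"
      using R by (intro integral_of_deriv)
       (auto intro!: derivative_eq_intros has_field_derivative_at_within[OF T(4)] has_field_derivative_at_within[OF f(2)] simp: T'_def)
    then show "((\<lambda>x. f x * T' x + f x * v x * T x) has_integral R * (f R + f (-R))) {-R..R}"
      by (simp add: T algebra_simps)
  qed
  have "sqrt c * k * integral {-R..R} s \<le> k / 2 * integral {-R..R} f + R * (f R + f (-R)) / 2
    + integral {-R..R} (\<lambda>x. (v x)\<^sup>2) / (8 * r) + r / 2 * c * k * integral {-R..R} (\<lambda>x. x\<^sup>2 * (s x)\<^sup>2)"
  proof (rule has_integral_le[OF i1 i2])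
    fix x assume "x \<in> {-R..R}"
    have "sqrt c * k * s (T x) * T' x \<le> f x * (k + T' x) / 2"
      using jacobian_amgm[of c k "T' x" "f x" "s (T x)"] pos f(1) s(1) T'eq T'pos[of x] by (simp add: less_imp_le)
    moreover have "(f x * T x)\<^sup>2 = c * k * ((T x)\<^sup>2 * (s (T x))\<^sup>2 * T' x)"
      using T'eq[of x, symmetric] by (simp add: power_mult_distrib)
    then have "- v x * (f x * T x) / 2 \<le> (v x)\<^sup>2 / (8 * r) + r / 2 * (c * k * ((T x)\<^sup>2 * (s (T x))\<^sup>2 * T' x))"
      using young_weighted[OF pos(3), of "v x" "f x * T x"] by simp
    ultimately show "sqrt c * k * (s (T x) * T' x) \<le> k / 2 * f x + (f x * T' x + f x * v x * T x) / 2 + (v x)\<^sup>2 / (8 * r)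
       + r / 2 * c * k * ((T x)\<^sup>2 * (s (T x))\<^sup>2 * T' x)"
      by (simp add: algebra_simps add_divide_distrib)
  qed
  then show ?thesis by (simp add: field_simps)
qed

section \<open>Fibre integrals of continuous functions on rectangles\<close>

lemma continuous_fibre:
  fixes F :: "real \<Rightarrow> real \<Rightarrow> real"
  assumes "continuous_on UNIV (\<lambda>z. F (fst z) (snd z))"
  shows "continuous_on A (F x)" "continuous_on A (\<lambda>x. F x y)"
proof -
  have "continuous_on UNIV (\<lambda>y. F (fst (x, y)) (snd (x, y)))" "continuous_on UNIV (\<lambda>x. F (fst (x, y)) (snd (x, y)))"
    by (rule continuous_on_compose2[OF assms]; auto intro!: continuous_intros)+
  then show "continuous_on A (F x)" "continuous_on A (\<lambda>x. F x y)"
    by (auto intro: continuous_on_subset)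
qed

lemma continuous_marginal:
  fixes F :: "real \<Rightarrow> real \<Rightarrow> real"
  assumes "continuous_on UNIV (\<lambda>z. F (fst z) (snd z))"
  shows "continuous_on A (\<lambda>x. integral {a..b} (F x))"
proof -
  have "continuous_on (UNIV \<times> cbox a b) (\<lambda>(x, y). F x y)"
    unfolding split_beta by (rule continuous_on_subset[OF assms]) auto
  from integral_continuous_on_param[OF this] show ?thesis
    by (auto intro: continuous_on_subset)
qed

lemma integrable_fibre:
  fixes F :: "real \<Rightarrow> real \<Rightarrow> real"
  assumes "continuous_on UNIV (\<lambda>z. F (fst z) (snd z))"
  shows "F x integrable_on {a..b}" "(\<lambda>x. F x y) integrable_on {a..b}" "(\<lambda>x. integral {c..d} (F x)) integrable_on {a..b}"
  by (intro integrable_continuous_interval continuous_fibre[OF assms] continuous_marginal[OF assms])+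

lemma integral_add2:
  fixes F G :: "real \<Rightarrow> real \<Rightarrow> real"
  assumes "continuous_on UNIV (\<lambda>z. F (fst z) (snd z))" "continuous_on UNIV (\<lambda>z. G (fst z) (snd z))"
  shows "integral {a..b} (\<lambda>x. integral {c..d} (\<lambda>y. F x y + G x y)) =
    integral {a..b} (\<lambda>x. integral {c..d} (F x)) + integral {a..b} (\<lambda>x. integral {c..d} (G x))"
  by (subst integral_add[symmetric]; (intro integrable_fibre assms)?)
     (rule integral_cong, rule integral_add; intro integrable_fibre assms)

lemma integral_swap2:
  fixes F :: "real \<Rightarrow> real \<Rightarrow> real"
  assumes "continuous_on UNIV (\<lambda>z. F (fst z) (snd z))"
  shows "integral {a..b} (\<lambda>x. integral {c..d} (F x)) = integral {c..d} (\<lambda>y. integral {a..b} (\<lambda>x. F x y))"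
proof -
  have "continuous_on (cbox (a,c) (b,d)) (\<lambda>(x,y). F x y)"
    unfolding split_beta by (rule continuous_on_subset[OF assms]) auto
  from integral_swap_continuous[OF this] show ?thesis by simp
qed

text \<open>Determinant and divergence of a triangular map see only its diagonal derivatives. The
  second component is therefore never differentiated in \<open>x\<close>, and
  \<open>knothe_fibre\<close> has already integrated it out, so no regularity of the fibre
  transports in \<open>x\<close>, not even measurability, has to be shown.\<close>

lemma transport_inequality:
  fixes f v1 v2 s :: "real \<Rightarrow> real \<Rightarrow> real"
  assumes R: "R > 0" and r: "r > 0" and c: "c > 0"
    and f: "\<And>x y. f x y > 0"
      "\<And>x y. ((\<lambda>x. f x y) has_real_derivative f x y * v1 x y) (at x)"
      "\<And>x y. (f x has_real_derivative f x y * v2 x y) (at y)"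
    and s: "\<And>x y. s x y > 0"
    and fc: "continuous_on UNIV (\<lambda>z. f (fst z) (snd z))"
    and v1c: "continuous_on UNIV (\<lambda>z. v1 (fst z) (snd z))"
    and v2c: "continuous_on UNIV (\<lambda>z. v2 (fst z) (snd z))"
    and sc: "continuous_on UNIV (\<lambda>z. s (fst z) (snd z))"
    and mass: "integral {-R..R} (\<lambda>x. integral {-R..R} (\<lambda>y. (f x y)\<^sup>2)) =
      c * integral {-R..R} (\<lambda>x. integral {-R..R} (\<lambda>y. (s x y)\<^sup>2))"
  shows "sqrt c * integral {-R..R} (\<lambda>x. integral {-R..R} (s x)) \<le>
    R / 2 * integral {-R..R} (\<lambda>y. f R y + f (-R) y) + R / 2 * integral {-R..R} (\<lambda>x. f x R + f x (-R))
    + integral {-R..R} (\<lambda>x. integral {-R..R} (\<lambda>y. (v1 x y)\<^sup>2 + (v2 x y)\<^sup>2)) / (8 * r)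
    + r / 2 * c * integral {-R..R} (\<lambda>x. integral {-R..R} (\<lambda>y. (x\<^sup>2 + y\<^sup>2) * (s x y)\<^sup>2))"
proof -
  have f2c: "continuous_on UNIV (\<lambda>z. (f (fst z) (snd z))\<^sup>2)" by (intro continuous_intros fc)
  have s2c: "continuous_on UNIV (\<lambda>z. (s (fst z) (snd z))\<^sup>2)" by (intro continuous_intros sc)
  have ysc: "continuous_on UNIV (\<lambda>z. (snd z)\<^sup>2 * (s (fst z) (snd z))\<^sup>2)" by (intro continuous_intros sc)
  have xsc: "continuous_on UNIV (\<lambda>z. (fst z)\<^sup>2 * (s (fst z) (snd z))\<^sup>2)" by (intro continuous_intros sc)
  have v12c: "continuous_on UNIV (\<lambda>z. (v1 (fst z) (snd z))\<^sup>2)" by (intro continuous_intros v1c)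
  have v22c: "continuous_on UNIV (\<lambda>z. (v2 (fst z) (snd z))\<^sup>2)" by (intro continuous_intros v2c)
  have fvc: "continuous_on UNIV (\<lambda>z. f (fst z) (snd z) * v1 (fst z) (snd z))" by (intro continuous_intros fc v1c)
  define m where "m x = integral {-R..R} (\<lambda>y. (s x y)\<^sup>2)" for x
  \<comment> \<open>Dividing by \<open>c\<close> gives the two marginals equal mass, as
    \<open>monotone_transport\<close> demands; the factor returns in each fibre through
    \<open>c * k x\<close>.\<close>
  define n where "n x = integral {-R..R} (\<lambda>y. (f x y)\<^sup>2) / c" for x
  have mc: "continuous_on A m" for A unfolding m_def[abs_def] by (rule continuous_marginal[OF s2c])
  have nc: "continuous_on A n" for A
    unfolding n_def[abs_def] using c by (intro continuous_intros continuous_marginal[OF f2c]) auto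
  have mpos: "m x > 0" for x
    unfolding m_def using s R by (intro integral_pos continuous_fibre[OF s2c] zero_less_power) auto
  have npos: "n x > 0" for x
    unfolding n_def using f(1) c R by (intro divide_pos_pos integral_pos continuous_fibre[OF f2c] zero_less_power) auto
  have "integral {-R..R} n = integral {-R..R} m"
    using mass c by (simp add: m_def[abs_def] n_def[abs_def])
  then obtain T where T: "T (-R) = -R" "T R = R" "\<And>x. x \<in> {-R..R} \<Longrightarrow> T x \<in> {-R..R}"
    "\<And>x. x \<in> {-R..R} \<Longrightarrow> (T has_real_derivative n x / m (T x)) (at x)"
    using monotone_transport[of "-R" R n m] R npos mpos nc mc by auto
  define k where "k x = n x / m (T x)" for x
  have kpos: "k x > 0" for x using npos mpos by (simp add: k_def)
  have km: "k x * m (T x) = n x" for x using mpos[of "T x"] by (simp add: k_def)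
  note sub = has_integral_substitution_fixed_ends[where a="-R" and b=R and T=T and T'=k, OF _ _ T(1,2) T(4)[folded k_def]]
  define F where "F x = integral {-R..R} (f x)" for x
  define F' where "F' x = integral {-R..R} (\<lambda>y. f x y * v1 x y)" for x
  define V1 where "V1 x = integral {-R..R} (\<lambda>y. (v1 x y)\<^sup>2)" for x
  define V2 where "V2 x = integral {-R..R} (\<lambda>y. (v2 x y)\<^sup>2)" for x
  define S where "S x = integral {-R..R} (s x)" for x
  define N where "N x = integral {-R..R} (\<lambda>y. y\<^sup>2 * (s x y)\<^sup>2)" for x
  define b where "b x = f x R + f x (-R)" for x
  have Sc: "continuous_on UNIV S" unfolding S_def[abs_def] by (rule continuous_marginal[OF sc])
  have Nc: "continuous_on UNIV N" unfolding N_def[abs_def] by (rule continuous_marginal[OF ysc])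
  \<comment> \<open>The first component is constant along each fibre, so its integration by parts
    can be done for the product \<open>F * T\<close> of functions of \<open>x\<close> alone.\<close>
  have Fd: "(F has_real_derivative F' x) (at x)" for x
  proof -
    have "((\<lambda>x. integral (cbox (-R) R) (f x)) has_real_derivative integral (cbox (-R) R) (\<lambda>y. f x y * v1 x y)) (at x within UNIV)"
    proof (rule leibniz_rule_field_derivative)
      show "continuous_on (UNIV \<times> cbox (-R) R) (\<lambda>(x, y). f x y * v1 x y)"
        unfolding split_beta by (rule continuous_on_subset[OF fvc]) auto
    qed (use f(2) integrable_fibre[OF fc] in auto)
    then show ?thesis by (simp add: F_def[abs_def] F'_def)
  qed
  \<comment> \<open>Young's inequality for the first component, integrated over the fibre. The mass
    balance \<open>k x * m (T x) = n x\<close> then puts the second moment into a form to which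
    substitution applies.\<close>
  have young: "- F' x * T x / 2 \<le> V1 x / (8 * r) + r / 2 * c * ((T x)\<^sup>2 * m (T x) * k x)" for x
  proof -
    have "((\<lambda>y. (- T x / 2) * (f x y * v1 x y)) has_integral (- T x / 2) * F' x) {-R..R}"
      unfolding F'_def by (intro has_integral_mult_right integrable_integral integrable_fibre[OF fvc])
    moreover have "((\<lambda>y. (v1 x y)\<^sup>2 / (8 * r) + r / 2 * (T x)\<^sup>2 * (f x y)\<^sup>2) has_integral
        V1 x / (8 * r) + r / 2 * (T x)\<^sup>2 * integral {-R..R} (\<lambda>y. (f x y)\<^sup>2)) {-R..R}"
      unfolding V1_def
      by (intro has_integral_add has_integral_mult_right has_integral_divide integrable_integral integrable_fibre[OF f2c] integrable_fibre[OF v12c])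
    ultimately have "(- T x / 2) * F' x \<le> V1 x / (8 * r) + r / 2 * (T x)\<^sup>2 * integral {-R..R} (\<lambda>y. (f x y)\<^sup>2)"
    proof (rule has_integral_le)
      fix y
      show "(- T x / 2) * (f x y * v1 x y) \<le> (v1 x y)\<^sup>2 / (8 * r) + r / 2 * (T x)\<^sup>2 * (f x y)\<^sup>2"
        using young_weighted[OF r, of "v1 x y" "f x y * T x"] by (simp add: power_mult_distrib algebra_simps)
    qed
    moreover have "integral {-R..R} (\<lambda>y. (f x y)\<^sup>2) = c * (m (T x) * k x)"
      using c km[of x] by (simp add: n_def mult.commute)
    ultimately show ?thesis by (simp add: algebra_simps)
  qed
  have fibre: "sqrt c * k x * S (T x) \<le> k x * F x / 2 + R * b x / 2 + V2 x / (8 * r) + r / 2 * c * k x * N (T x)" for x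
    unfolding S_def N_def F_def V2_def b_def
  proof (rule knothe_fibre[OF R c kpos r f(1) f(3) continuous_fibre(1)[OF v2c] s continuous_fibre(1)[OF sc]])
    show "integral {-R..R} (\<lambda>y. (f x y)\<^sup>2) = c * k x * integral {-R..R} (\<lambda>y. (s (T x) y)\<^sup>2)"
      using c km[of x] by (simp add: n_def m_def mult.assoc)
  qed
  have i1: "((\<lambda>x. sqrt c * (S (T x) * k x)) has_integral sqrt c * integral {-R..R} S) {-R..R}"
    using R by (intro has_integral_mult_right sub Sc) auto
  \<comment> \<open>As in \<open>knothe_fibre\<close>: \<open>F * k\<close> is completed to the
    derivative of \<open>F * T\<close>, and \<open>young\<close> pays for the difference.\<close>
  have i2: "((\<lambda>x. (F x * k x + F' x * T x) / 2 + R / 2 * b x + (V1 x + V2 x) / (8 * r)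
      + r / 2 * c * ((T x)\<^sup>2 * m (T x) * k x + N (T x) * k x)) has_integral
      R * (F R + F (-R)) / 2 + R / 2 * integral {-R..R} b + (integral {-R..R} V1 + integral {-R..R} V2) / (8 * r)
      + r / 2 * c * (integral {-R..R} (\<lambda>x. x\<^sup>2 * m x) + integral {-R..R} N)) {-R..R}"
  proof (intro has_integral_add has_integral_mult_right has_integral_divide)
    show "(b has_integral integral {-R..R} b) {-R..R}" unfolding b_def[abs_def]
      by (intro integrable_integral integrable_add integrable_fibre[OF fc])
    show "(V1 has_integral integral {-R..R} V1) {-R..R}" "(V2 has_integral integral {-R..R} V2) {-R..R}"
      unfolding V1_def[abs_def] V2_def[abs_def]
      by (intro integrable_integral integrable_fibre[OF v12c] integrable_fibre[OF v22c])+
    show "((\<lambda>x. (T x)\<^sup>2 * m (T x) * k x) has_integral integral {-R..R} (\<lambda>x. x\<^sup>2 * m x)) {-R..R}"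
      using R by (intro sub continuous_intros mc) auto
    show "((\<lambda>x. N (T x) * k x) has_integral integral {-R..R} N) {-R..R}"
      using R by (intro sub Nc) auto
    have "((\<lambda>x. F x * k x + F' x * T x) has_integral F R * T R - F (-R) * T (-R)) {-R..R}"
      using R by (intro integral_of_deriv)
       (auto intro!: derivative_eq_intros has_field_derivative_at_within[OF T(4)] has_field_derivative_at_within[OF Fd] simp: k_def)
    then show "((\<lambda>x. F x * k x + F' x * T x) has_integral R * (F R + F (-R))) {-R..R}"
      by (simp add: T algebra_simps)
  qed
  have "sqrt c * integral {-R..R} S \<le> R * (F R + F (-R)) / 2 + R / 2 * integral {-R..R} b + (integral {-R..R} V1 + integral {-R..R} V2) / (8 * r)
      + r / 2 * c * (integral {-R..R} (\<lambda>x. x\<^sup>2 * m x) + integral {-R..R} N)"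
  proof (rule has_integral_le[OF i1 i2])
    fix x
    show "sqrt c * (S (T x) * k x) \<le> (F x * k x + F' x * T x) / 2 + R / 2 * b x + (V1 x + V2 x) / (8 * r)
      + r / 2 * c * ((T x)\<^sup>2 * m (T x) * k x + N (T x) * k x)"
      using fibre[of x] young[of x] by (simp add: algebra_simps add_divide_distrib)
  qed
  moreover have "F R + F (-R) = integral {-R..R} (\<lambda>y. f R y + f (-R) y)"
    unfolding F_def by (intro integral_add[symmetric] integrable_fibre[OF fc])
  moreover have "integral {-R..R} V1 + integral {-R..R} V2 = integral {-R..R} (\<lambda>x. integral {-R..R} (\<lambda>y. (v1 x y)\<^sup>2 + (v2 x y)\<^sup>2))"
    unfolding V1_def[abs_def] V2_def[abs_def] by (rule integral_add2[symmetric, OF v12c v22c])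
  moreover have "integral {-R..R} (\<lambda>x. x\<^sup>2 * m x) + integral {-R..R} N = integral {-R..R} (\<lambda>x. integral {-R..R} (\<lambda>y. (x\<^sup>2 + y\<^sup>2) * (s x y)\<^sup>2))"
    using integral_add2[OF xsc ysc, of "-R" R "-R" R] unfolding N_def[abs_def] m_def by (simp add: algebra_simps)
  ultimately show ?thesis by (simp add: S_def[abs_def] b_def[abs_def])
qed

lemma integral_lin2:
  fixes F G :: "real \<Rightarrow> real \<Rightarrow> real"
  assumes "continuous_on UNIV (\<lambda>z. F (fst z) (snd z))" "continuous_on UNIV (\<lambda>z. G (fst z) (snd z))"
  shows "integral {a..b} (\<lambda>x. integral {c..d} (\<lambda>y. \<alpha> * F x y + \<beta> * G x y)) =
    \<alpha> * integral {a..b} (\<lambda>x. integral {c..d} (F x)) + \<beta> * integral {a..b} (\<lambda>x. integral {c..d} (G x))"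
  by (subst integral_add2) (auto intro!: continuous_intros assms)

lemma integral_partial_fst:
  fixes G :: "real \<Rightarrow> real \<Rightarrow> real"
  assumes "a \<le> b" "\<And>x y. ((\<lambda>x. G x y) has_real_derivative G' x y) (at x)"
    "continuous_on UNIV (\<lambda>z. G' (fst z) (snd z))"
  shows "integral {a..b} (\<lambda>x. integral {c..d} (G' x)) = integral {c..d} (\<lambda>y. G b y - G a y)"
  unfolding integral_swap2[OF assms(3)]
  by (intro integral_cong integral_antideriv assms)

lemma integral_partial_snd:
  fixes G :: "real \<Rightarrow> real \<Rightarrow> real"
  assumes "c \<le> d" "\<And>x y. (G x has_real_derivative G' x y) (at y)"
  shows "integral {a..b} (\<lambda>x. integral {c..d} (G' x)) = integral {a..b} (\<lambda>x. G x d - G x c)"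
  by (intro integral_cong integral_antideriv assms)

text \<open>The left side is the cost of a mass ratio \<open>c\<close> different from 1. It vanishes
  at \<open>c = 1\<close> because every estimate in the transport argument is an equality when
  \<open>H = 0\<close>.\<close>

lemma onofri_square:
  fixes H H1 H2 :: "real \<Rightarrow> real \<Rightarrow> real" and R :: real
  defines "q \<equiv> \<lambda>x y. 1 + x\<^sup>2 + y\<^sup>2"
  defines "I \<equiv> \<lambda>F. integral {-R..R} (\<lambda>x. integral {-R..R} (F x))"
  defines "A \<equiv> I (\<lambda>x y. 1 / (sqrt pi * q x y))"
  defines "M \<equiv> I (\<lambda>x y. (x\<^sup>2 + y\<^sup>2) * (1 / (sqrt pi * q x y))\<^sup>2)"
  assumes R: "R > 0"
    and H: "\<And>x y. ((\<lambda>x. H x y) has_real_derivative H1 x y) (at x)"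
      "\<And>x y. (H x has_real_derivative H2 x y) (at y)"
    and Hc: "continuous_on UNIV (\<lambda>z. H (fst z) (snd z))"
    and H1c: "continuous_on UNIV (\<lambda>z. H1 (fst z) (snd z))"
    and H2c: "continuous_on UNIV (\<lambda>z. H2 (fst z) (snd z))"
    and bdry: "\<And>y. H R y = 0" "\<And>y. H (-R) y = 0" "\<And>x. H x R = 0" "\<And>x. H x (-R) = 0"
    and c: "c > 0" "I (\<lambda>x y. exp (H x y) * (1 / (sqrt pi * q x y))\<^sup>2) = c * I (\<lambda>x y. (1 / (sqrt pi * q x y))\<^sup>2)"
  shows "(sqrt c - 1) * A - (c - 1) * (sqrt pi / 2) * M \<le>
    sqrt pi / 2 * (1 / (16 * pi) * I (\<lambda>x y. (H1 x y)\<^sup>2 + (H2 x y)\<^sup>2) + I (\<lambda>x y. H x y * (1 / (sqrt pi * q x y))\<^sup>2))"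
proof -
  \<comment> \<open>\<open>r\<close> normalises \<open>s\<close> and is also the weight in Young's
    inequality: for \<open>H = 0\<close> the logarithmic gradient of \<open>s\<close> is
    \<open>-2 (x, y) / q = -2 r s (x, y)\<close>, the equality case.\<close>
  define r where "r = sqrt pi"
  have r: "r > 0" "r\<^sup>2 = pi" by (auto simp: r_def)
  have qpos: "q x y > 0" for x y unfolding q_def by (smt (verit) zero_le_power2)
  have qne: "q x y \<noteq> 0" "1 + x\<^sup>2 + y\<^sup>2 \<noteq> 0" "1 + x\<^sup>2 + y\<^sup>2 > 0" for x y using qpos[of x y] by (auto simp: q_def)
  define s where "s x y = 1 / (r * q x y)" for x y
  have spos: "s x y > 0" for x y using qpos r by (simp add: s_def)
  have qc: "continuous_on UNIV (\<lambda>z. q (fst z) (snd z))"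
    unfolding q_def by (intro continuous_intros)
  have sc: "continuous_on UNIV (\<lambda>z. s (fst z) (snd z))"
    unfolding s_def using qne r by (intro continuous_intros qc) auto
  define f where "f x y = exp (H x y / 2) * s x y" for x y
  define v1 where "v1 x y = H1 x y / 2 - 2 * x / q x y" for x y
  define v2 where "v2 x y = H2 x y / 2 - 2 * y / q x y" for x y
  have f2: "(f x y)\<^sup>2 = exp (H x y) * (s x y)\<^sup>2" for x y
    by (simp add: f_def power_mult_distrib power2_eq_square[of "exp _"] flip: exp_add)
  have q1: "((\<lambda>x. q x y) has_real_derivative 2 * x) (at x)" for x y
    unfolding q_def by (auto intro!: derivative_eq_intros)
  have q2: "((\<lambda>y. q x y) has_real_derivative 2 * y) (at y)" for x y
    unfolding q_def by (auto intro!: derivative_eq_intros)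
  have s1: "((\<lambda>x. s x y) has_real_derivative s x y * (- 2 * x / q x y)) (at x)" for x y
    unfolding s_def using qne(1)[of x y] r(1)
    by (auto intro!: derivative_eq_intros q1 simp: field_simps power2_eq_square)
  have s2: "(s x has_real_derivative s x y * (- 2 * y / q x y)) (at y)" for x y
    unfolding s_def[abs_def] using qne(1)[of x y] r(1)
    by (auto intro!: derivative_eq_intros q2 simp: field_simps power2_eq_square)
  have f1d: "((\<lambda>x. f x y) has_real_derivative f x y * v1 x y) (at x)" for x y
    unfolding f_def v1_def
    by (rule derivative_eq_intros H s1 refl | simp)+ (simp add: field_simps)
  have f2d: "(f x has_real_derivative f x y * v2 x y) (at y)" for x y
    unfolding f_def[abs_def] v2_def
    by (rule derivative_eq_intros H s2 refl | simp)+ (simp add: field_simps)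
  have fc: "continuous_on UNIV (\<lambda>z. f (fst z) (snd z))"
    unfolding f_def by (intro continuous_intros Hc sc) auto
  have v1c: "continuous_on UNIV (\<lambda>z. v1 (fst z) (snd z))"
    unfolding v1_def using qne by (intro continuous_intros H1c qc) auto
  have v2c: "continuous_on UNIV (\<lambda>z. v2 (fst z) (snd z))"
    unfolding v2_def using qne by (intro continuous_intros H2c qc) auto
  have fb: "f R y = s R y" "f (-R) y = s (-R) y" "f x R = s x R" "f x (-R) = s x (-R)" for x y
    by (simp_all add: f_def bdry)
  define K where "K = I (\<lambda>x y. (x\<^sup>2 + y\<^sup>2) / (q x y)\<^sup>2)"
  define D where "D = I (\<lambda>x y. (H1 x y)\<^sup>2 + (H2 x y)\<^sup>2)"
  define E where "E = I (\<lambda>x y. H x y / (q x y)\<^sup>2)"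
  define C where "C = I (\<lambda>x y. H1 x y * (x / q x y) + H2 x y * (y / q x y))"
  define B where "B = integral {-R..R} (\<lambda>y. R * (s R y + s (-R) y)) + integral {-R..R} (\<lambda>x. R * (s x R + s x (-R)))"
  have Kc: "continuous_on UNIV (\<lambda>z. ((fst z)\<^sup>2 + (snd z)\<^sup>2) / (q (fst z) (snd z))\<^sup>2)"
    using qne by (intro continuous_intros qc) auto
  have Dc: "continuous_on UNIV (\<lambda>z. (H1 (fst z) (snd z))\<^sup>2 + (H2 (fst z) (snd z))\<^sup>2)"
    by (intro continuous_intros H1c H2c)
  have Ec: "continuous_on UNIV (\<lambda>z. H (fst z) (snd z) / (q (fst z) (snd z))\<^sup>2)"
    using qne by (intro continuous_intros qc Hc) auto
  have Cc: "continuous_on UNIV (\<lambda>z. H1 (fst z) (snd z) * (fst z / q (fst z) (snd z)) + H2 (fst z) (snd z) * (snd z / q (fst z) (snd z)))"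
    using qne by (intro continuous_intros qc H1c H2c) auto
  have DCc: "continuous_on UNIV (\<lambda>z. 1 / 4 * ((H1 (fst z) (snd z))\<^sup>2 + (H2 (fst z) (snd z))\<^sup>2) +
     (-2) * (H1 (fst z) (snd z) * (fst z / q (fst z) (snd z)) + H2 (fst z) (snd z) * (snd z / q (fst z) (snd z))))"
    by (intro continuous_on_add continuous_on_mult continuous_on_const Dc Cc)
  have main: "sqrt c * A \<le> B / 2 + I (\<lambda>x y. (v1 x y)\<^sup>2 + (v2 x y)\<^sup>2) / (8 * r) + r / 2 * c * M"
  proof -
    have "sqrt c * integral {-R..R} (\<lambda>x. integral {-R..R} (s x)) \<le>
      R / 2 * integral {-R..R} (\<lambda>y. f R y + f (-R) y) + R / 2 * integral {-R..R} (\<lambda>x. f x R + f x (-R))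
      + integral {-R..R} (\<lambda>x. integral {-R..R} (\<lambda>y. (v1 x y)\<^sup>2 + (v2 x y)\<^sup>2)) / (8 * r)
      + r / 2 * c * integral {-R..R} (\<lambda>x. integral {-R..R} (\<lambda>y. (x\<^sup>2 + y\<^sup>2) * (s x y)\<^sup>2))"
    proof (rule transport_inequality[OF R r(1) c(1) _ f1d f2d spos fc v1c v2c sc])
      show "f x y > 0" for x y by (simp add: f_def spos)
      show "integral {-R..R} (\<lambda>x. integral {-R..R} (\<lambda>y. (f x y)\<^sup>2)) =
        c * integral {-R..R} (\<lambda>x. integral {-R..R} (\<lambda>y. (s x y)\<^sup>2))"
        using c(2) by (simp add: f2 I_def s_def r_def)
    qed
    then show ?thesis by (simp add: fb A_def M_def I_def B_def s_def[abs_def] r_def add_divide_distrib)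
  qed
  \<comment> \<open>Expanding the square separates the Dirichlet term, the cross term with the field
    \<open>(x, y) / q\<close>, and a term free of \<open>H\<close>.\<close>
  have V: "I (\<lambda>x y. (v1 x y)\<^sup>2 + (v2 x y)\<^sup>2) = D / 4 - 2 * C + 4 * K"
  proof -
    have "(v1 x y)\<^sup>2 + (v2 x y)\<^sup>2 = 1 * (1 / 4 * ((H1 x y)\<^sup>2 + (H2 x y)\<^sup>2) + (-2) * (H1 x y * (x / q x y) + H2 x y * (y / q x y)))
       + 4 * ((x\<^sup>2 + y\<^sup>2) / (q x y)\<^sup>2)" for x y
      unfolding v1_def v2_def by (simp add: power2_diff power_divide power_mult_distrib add_divide_distrib algebra_simps)
    then have "I (\<lambda>x y. (v1 x y)\<^sup>2 + (v2 x y)\<^sup>2) = I (\<lambda>x y. 1 * (1 / 4 * ((H1 x y)\<^sup>2 + (H2 x y)\<^sup>2) + (-2) * (H1 x y * (x / q x y) + H2 x y * (y / q x y)))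
       + 4 * ((x\<^sup>2 + y\<^sup>2) / (q x y)\<^sup>2))" by (simp only:)
    also have "\<dots> = 1 * I (\<lambda>x y. 1 / 4 * ((H1 x y)\<^sup>2 + (H2 x y)\<^sup>2) + (-2) * (H1 x y * (x / q x y) + H2 x y * (y / q x y))) + 4 * K"
      unfolding K_def I_def by (rule integral_lin2[OF DCc Kc])
    also have "I (\<lambda>x y. 1 / 4 * ((H1 x y)\<^sup>2 + (H2 x y)\<^sup>2) + (-2) * (H1 x y * (x / q x y) + H2 x y * (y / q x y))) = 1 / 4 * D + (-2) * C"
      unfolding D_def C_def I_def by (rule integral_lin2[OF Dc Cc])
    finally show ?thesis by simp
  qed
  \<comment> \<open>The divergence of \<open>(x, y) / q\<close> is \<open>2 / q\<^sup>2\<close>, a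
    multiple of the density \<open>mu2\<close>. As \<open>H\<close> vanishes on the sides,
    integrating by parts turns the cross term into the linear term of \<open>I_fun\<close>.\<close>
  have C: "C = - 2 * E"
  proof -
    define G1 where "G1 x y = H1 x y * (x / q x y) + H x y * (1 / q x y - 2 * x\<^sup>2 / (q x y)\<^sup>2)" for x y
    define G2 where "G2 x y = H2 x y * (y / q x y) + H x y * (1 / q x y - 2 * y\<^sup>2 / (q x y)\<^sup>2)" for x y
    have c1: "continuous_on UNIV (\<lambda>z. G1 (fst z) (snd z))"
      unfolding G1_def using qne by (intro continuous_intros qc H1c Hc) auto
    have c2: "continuous_on UNIV (\<lambda>z. G2 (fst z) (snd z))"
      unfolding G2_def using qne by (intro continuous_intros qc H2c Hc) auto
    have d1: "((\<lambda>x. x / q x y) has_real_derivative 1 / q x y - 2 * x\<^sup>2 / (q x y)\<^sup>2) (at x)" for x y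
      using qne(1)[of x y] by (auto intro!: derivative_eq_intros q1 simp: field_simps power2_eq_square)
    have d2: "((\<lambda>y. y / q x y) has_real_derivative 1 / q x y - 2 * y\<^sup>2 / (q x y)\<^sup>2) (at y)" for x y
      using qne(1)[of x y] by (auto intro!: derivative_eq_intros q2 simp: field_simps power2_eq_square)
    have e1: "((\<lambda>x. H x y * (x / q x y)) has_real_derivative G1 x y) (at x)" for x y
      using DERIV_mult[OF H(1)[where x=x and y=y] d1[where x=x and y=y]] by (simp add: G1_def algebra_simps)
    have e2: "((\<lambda>y. H x y * (y / q x y)) has_real_derivative G2 x y) (at y)" for x y
      using DERIV_mult[OF H(2)[where x=x and y=y] d2[where x=x and y=y]] by (simp add: G2_def algebra_simps)
    have "I G1 = 0" unfolding I_def
      using R integral_partial_fst[OF _ e1 c1, of "-R" R "-R" R] by (simp add: bdry)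
    moreover have "I G2 = 0" unfolding I_def
      using R integral_partial_snd[OF _ e2, of "-R" R "-R" R] by (simp add: bdry)
    ultimately have "I (\<lambda>x y. 1 * G1 x y + 1 * G2 x y) = 0"
      unfolding I_def integral_lin2[OF c1 c2] by simp
    moreover have "1 * G1 x y + 1 * G2 x y = 1 * (H1 x y * (x / q x y) + H2 x y * (y / q x y)) + 2 * (H x y / (q x y)\<^sup>2)" for x y
    proof -
      have "1 / q x y - 2 * x\<^sup>2 / (q x y)\<^sup>2 + (1 / q x y - 2 * y\<^sup>2 / (q x y)\<^sup>2) = 2 / (q x y)\<^sup>2"
        using qne(1)[of x y] by (simp add: field_simps power2_eq_square) (simp add: q_def field_simps power2_eq_square)
      then have "H x y * (1 / q x y - 2 * x\<^sup>2 / (q x y)\<^sup>2) + H x y * (1 / q x y - 2 * y\<^sup>2 / (q x y)\<^sup>2) = 2 * (H x y / (q x y)\<^sup>2)"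
        by (simp add: distrib_left[symmetric])
      then show ?thesis by (simp add: G1_def G2_def)
    qed
    ultimately have "I (\<lambda>x y. 1 * (H1 x y * (x / q x y) + H2 x y * (y / q x y)) + 2 * (H x y / (q x y)\<^sup>2)) = 0"
      by (simp only:)
    then show ?thesis
      unfolding I_def integral_lin2[OF Cc Ec] by (simp add: C_def E_def I_def)
  qed
  \<comment> \<open>\<open>B\<close> is the flux of \<open>s\<close> times the position field
    through the sides. The divergence of that field is
    \<open>2 s - 2 (x\<^sup>2 + y\<^sup>2) s / q\<close>, which makes the boundary term
    explicit.\<close>
  have B: "B / 2 = A - K / r"
  proof -
    define G1 where "G1 x y = s x y - 2 * x\<^sup>2 * s x y / q x y" for x y
    define G2 where "G2 x y = s x y - 2 * y\<^sup>2 * s x y / q x y" for x y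
    have c1: "continuous_on UNIV (\<lambda>z. G1 (fst z) (snd z))"
      unfolding G1_def using qne by (intro continuous_intros qc sc) auto
    have c2: "continuous_on UNIV (\<lambda>z. G2 (fst z) (snd z))"
      unfolding G2_def using qne by (intro continuous_intros qc sc) auto
    have e1: "((\<lambda>x. x * s x y) has_real_derivative G1 x y) (at x)" for x y
      using DERIV_mult[OF DERIV_ident s1[where x=x and y=y]] by (simp add: G1_def algebra_simps power2_eq_square)
    have e2: "((\<lambda>y. y * s x y) has_real_derivative G2 x y) (at y)" for x y
      using DERIV_mult[OF DERIV_ident s2[where x=x and y=y]] by (simp add: G2_def algebra_simps power2_eq_square)
    have "I G1 = integral {-R..R} (\<lambda>y. R * (s R y + s (-R) y))" unfolding I_def
      using R integral_partial_fst[OF _ e1 c1, of "-R" R "-R" R] by (simp add: distrib_left)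
    moreover have "I G2 = integral {-R..R} (\<lambda>x. R * (s x R + s x (-R)))" unfolding I_def
      using R integral_partial_snd[OF _ e2, of "-R" R "-R" R] by (simp add: distrib_left)
    ultimately have "I (\<lambda>x y. 1 * G1 x y + 1 * G2 x y) = B"
      unfolding I_def integral_lin2[OF c1 c2] by (simp add: B_def)
    moreover have "1 * G1 x y + 1 * G2 x y = 2 * s x y + (-2 / r) * ((x\<^sup>2 + y\<^sup>2) / (q x y)\<^sup>2)" for x y
      unfolding G1_def G2_def s_def using qne(1)[of x y] r by (simp add: field_simps power2_eq_square)
    ultimately have "B = I (\<lambda>x y. 2 * s x y + (-2 / r) * ((x\<^sup>2 + y\<^sup>2) / (q x y)\<^sup>2))" by (simp only:)
    also have "\<dots> = 2 * A + (-2 / r) * K"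
      unfolding I_def integral_lin2[OF sc Kc] by (simp add: A_def K_def I_def s_def[abs_def] r_def)
    finally show ?thesis by simp
  qed
  have M: "M = K / r\<^sup>2" "I (\<lambda>x y. H x y * (1 / (sqrt pi * q x y))\<^sup>2) = E / r\<^sup>2"
    unfolding M_def K_def I_def E_def by (simp_all add: power_divide power_mult_distrib r mult.commute flip: integral_divide r_def)
  \<comment> \<open>Origin of \<open>1 / (16 * pi)\<close>: half the gradient of \<open>H\<close>
    gives \<open>D / 4\<close>, Young's inequality divides it by \<open>8 * r\<close>, and the final
    division by \<open>r / 2\<close> leaves \<open>16 * r\<^sup>2\<close>.\<close>
  have 1: "(D / 4 - 2 * (- 2 * E) + 4 * K) / (8 * r) = D / (32 * r) + E / (2 * r) + K / (2 * r)"
    using r(1) by (simp add: field_simps)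
  have 2: "(c - 1) * (r / 2) * (K / r\<^sup>2) = c * (K / (2 * r)) - K / (2 * r)" "r / 2 * c * (K / r\<^sup>2) = c * (K / (2 * r))"
    "K / r = 2 * (K / (2 * r))" "r / 2 * (1 / (16 * r\<^sup>2) * D + E / r\<^sup>2) = D / (32 * r) + E / (2 * r)"
    using r(1) by (simp_all add: field_simps power2_eq_square)
  have "sqrt c * A \<le> A - K / r + (D / (32 * r) + E / (2 * r) + K / (2 * r)) + c * (K / (2 * r))"
    using main unfolding V C B M(1) 1 2(2) .
  then have "(sqrt c - 1) * A - (c - 1) * (r / 2) * (K / r\<^sup>2) \<le> r / 2 * (1 / (16 * r\<^sup>2) * D + E / r\<^sup>2)"
    unfolding 2(1,3,4) by (simp add: left_diff_distrib)
  then show ?thesis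
    unfolding M D_def[symmetric] by (simp add: r(2) flip: r_def)
qed

section \<open>Test functions and weak gradients\<close>

lemma partialI: "(f has_derivative f') (at x) \<Longrightarrow> partial i f x = f' (axis i 1)"
  unfolding partial_def by (metis frechet_derivative_at)

lemma partial_has_derivative:
  assumes "f differentiable (at x)"
  shows "(f has_derivative frechet_derivative f (at x)) (at x)" "partial i f x = frechet_derivative f (at x) (axis i 1)"
  using assms by (auto simp: frechet_derivative_works partial_def)

lemma partial_const: "partial i (\<lambda>_. c) = (\<lambda>_. 0)"
  by (rule ext) (auto intro!: partialI[THEN trans] derivative_eq_intros)

lemma partial_nth: "partial i (\<lambda>x::real ^ 'n. x $ j) = (\<lambda>_. if i = j then 1 else 0)"
proof
  fix x :: "real ^ 'n"
  have "((\<lambda>x. x $ j) has_derivative (\<lambda>h. h $ j)) (at x)"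
    using bounded_linear_vec_nth by (rule bounded_linear_imp_has_derivative)
  from partialI[OF this] show "partial i (\<lambda>x. x $ j) x = (if i = j then 1 else 0)"
    by (auto simp: axis_def)
qed

lemma partial_add:
  assumes "f differentiable (at x)" "g differentiable (at x)"
  shows "partial i (\<lambda>x. f x + g x) x = partial i f x + partial i g x"
  using partialI[OF has_derivative_add[OF partial_has_derivative(1)[OF assms(1)] partial_has_derivative(1)[OF assms(2)]]]
  by (simp add: partial_def)

lemma partial_mult:
  assumes "f differentiable (at x)" "g differentiable (at x)"
  shows "partial i (\<lambda>x. f x * g x) x = f x * partial i g x + partial i f x * g x"
  using partialI[OF has_derivative_mult[OF partial_has_derivative(1)[OF assms(1)] partial_has_derivative(1)[OF assms(2)]]]
  by (simp add: partial_def)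

lemma partial_comp:
  assumes "(g has_real_derivative d) (at (f x))" "f differentiable (at x)"
  shows "partial i (\<lambda>x. g (f x)) x = d * partial i f x" "(\<lambda>x. g (f x)) differentiable (at x)"
proof -
  have *: "((\<lambda>x. g (f x)) has_derivative (\<lambda>h. d * frechet_derivative f (at x) h)) (at x)"
    using has_derivative_compose[OF partial_has_derivative(1)[OF assms(2)] assms(1)[unfolded has_field_derivative_def]] .
  from partialI[OF this] show "partial i (\<lambda>x. g (f x)) x = d * partial i f x"
    by (simp add: partial_def)
  show "(\<lambda>x. g (f x)) differentiable (at x)" using * by (rule differentiableI)
qed

lemma C_k_continuous: "C_k k f \<Longrightarrow> continuous_on UNIV f"
  by (cases k) (auto intro!: continuous_at_imp_continuous_on differentiable_imp_continuous_within)

lemma C_k_Suc: "C_k (Suc k) f \<Longrightarrow> C_k k f"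
proof (induction k arbitrary: f)
  case 0
  then show ?case using C_k_continuous by (metis C_k.simps(1))
next
  case (Suc k)
  then show ?case by (metis C_k.simps(2))
qed

lemma C_k_const: "C_k k (\<lambda>_. c)"
  by (induction k arbitrary: c) (auto simp: partial_const)

lemma C_k_nth: "C_k k (\<lambda>x::real ^ 'n. x $ j)"
proof (cases k)
  case (Suc k)
  have "(\<lambda>x. x $ j) differentiable (at x)" for x :: "real ^ 'n"
    using bounded_linear_vec_nth by (rule bounded_linear_imp_differentiable)
  then show ?thesis by (simp add: Suc partial_nth C_k_const)
qed (auto intro!: continuous_intros)

lemma C_k_add: "C_k k f \<Longrightarrow> C_k k g \<Longrightarrow> C_k k (\<lambda>x. f x + g x)"
proof (induction k arbitrary: f g)
  case (Suc k)
  then have d: "f differentiable (at x)" "g differentiable (at x)" for x by auto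
  have "partial i (\<lambda>x. f x + g x) = (\<lambda>x. partial i f x + partial i g x)" for i
    by (intro ext partial_add d)
  then show ?case using Suc d by (auto intro!: derivative_intros)
qed (auto intro!: continuous_intros)

lemma C_k_mult: "C_k k f \<Longrightarrow> C_k k g \<Longrightarrow> C_k k (\<lambda>x. f x * g x)"
proof (induction k arbitrary: f g)
  case (Suc k)
  then have d: "f differentiable (at x)" "g differentiable (at x)" for x by auto
  have "partial i (\<lambda>x. f x * g x) = (\<lambda>x. f x * partial i g x + partial i f x * g x)" for i
    by (intro ext partial_mult d)
  moreover have "C_k k f" "C_k k g" using Suc.prems C_k_Suc by auto
  ultimately show ?case using Suc d by (auto intro!: derivative_intros C_k_add)
qed (auto intro!: continuous_intros)

lemma C_k_prod:
  assumes "finite I" "\<And>j. j \<in> I \<Longrightarrow> C_k k (f j)"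
  shows "C_k k (\<lambda>x. \<Prod>j\<in>I. f j x)"
  using assms by (induction I rule: finite_induct) (auto intro: C_k_const C_k_mult)

text \<open>The functions \<open>t\<^sup>-\<^sup>n e\<^bsup>-1/t\<^esup>\<close> span a space closed under differentiation, which makes
  smoothness at the origin a plain induction.\<close>

definition bump :: "nat \<Rightarrow> real \<Rightarrow> real"
  where "bump n t = (if t > 0 then exp (- inverse t) * inverse t ^ n else 0)"

lemma bump_has_derivative:
  "(bump n has_real_derivative bump (n + 2) t - real n * bump (n + 1) t) (at t)"
proof -
  consider "t > 0" | "t < 0" | "t = 0" by linarith
  then show ?thesis
  proof cases
    case 1
    have "((\<lambda>t. exp (- inverse t) * inverse t ^ n) has_real_derivative bump (n + 2) t - real n * bump (n + 1) t) (at t)"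
    proof -
      have inv: "(inverse has_real_derivative - (inverse t)\<^sup>2) (at t)"
        using DERIV_inverse[of t UNIV] 1 by (simp add: power2_eq_square)
      have "((\<lambda>t. exp (- inverse t) * inverse t ^ n) has_real_derivative
        exp (- inverse t) * - (- (inverse t)\<^sup>2) * inverse t ^ n + real n * (- (inverse t)\<^sup>2 * inverse t ^ (n - Suc 0)) * exp (- inverse t)) (at t)"
        by (rule DERIV_mult[OF DERIV_fun_exp[OF DERIV_minus[OF inv]] DERIV_power[OF inv, unfolded of_nat_id]])
      then show ?thesis
        using 1 by (cases n) (simp_all add: bump_def power2_eq_square algebra_simps)
    qed
    then show ?thesis
      by (rule DERIV_cong_ev[THEN iffD1, rotated -1])
        (use 1 in \<open>auto simp: bump_def intro!: eventually_mono[OF eventually_gt_at_top] eventually_nhds_in_open[of "{0<..}", THEN eventually_mono]\<close>)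
  next
    case 2
    have "((\<lambda>t. 0) has_real_derivative bump (n + 2) t - real n * bump (n + 1) t) (at t)"
      using 2 by (simp add: bump_def)
    then show ?thesis
      by (rule DERIV_cong_ev[THEN iffD1, rotated -1])
        (use 2 in \<open>auto simp: bump_def intro!: eventually_nhds_in_open[of "{..<0}", THEN eventually_mono]\<close>)
  next
    case 3
    \<comment> \<open>At the origin the difference quotient of \<open>bump n\<close> is
      \<open>bump (Suc n)\<close> itself, so only the decay of the exponential against powers from
      the right is needed.\<close>
    have lim: "((\<lambda>h. bump (Suc n) h) \<longlongrightarrow> 0) (at 0)"
    proof (rule filterlim_split_at)
      have "((\<lambda>h::real. inverse h ^ Suc n / exp (inverse h)) \<longlongrightarrow> 0) (at_right 0)"
        by (rule filterlim_compose[OF tendsto_power_div_exp_0 filterlim_inverse_at_top_right])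
      then show "(bump (Suc n) \<longlongrightarrow> 0) (at_right 0)"
        by (rule Lim_transform_eventually)
          (auto simp: bump_def exp_minus field_simps eventually_at_right_field intro!: exI[of _ 1])
      show "(bump (Suc n) \<longlongrightarrow> 0) (at_left 0)"
        by (rule tendsto_eventually) (auto simp: bump_def eventually_at_left_field intro!: exI[of _ "-1"])
    qed
    have "(bump n has_real_derivative 0) (at 0)"
      unfolding DERIV_def
    proof (rule Lim_transform_eventually[OF lim])
      show "\<forall>\<^sub>F h in at 0. bump (Suc n) h = (bump n (0 + h) - bump n 0) / h"
        by (auto simp: bump_def field_simps eventually_at intro!: exI[of _ 1])
    qed
    then show ?thesis using 3 by (simp add: bump_def)
  qed
qed

lemma C_k_bump: "C_k k f \<Longrightarrow> C_k k (\<lambda>x. bump n (f x))"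
proof (induction k arbitrary: n)
  case 0
  have "continuous_on UNIV (bump n)"
    by (meson DERIV_isCont bump_has_derivative continuous_at_imp_continuous_on)
  with 0 show ?case by (auto intro: continuous_on_compose2)
next
  case (Suc k)
  then have d: "f differentiable (at x)" for x by auto
  have "partial i (\<lambda>x. bump n (f x)) = (\<lambda>x. (bump (n + 2) (f x) + (- real n) * bump (n + 1) (f x)) * partial i f x)" for i
    using partial_comp(1)[OF bump_has_derivative d] by (auto simp: algebra_simps)
  moreover have "C_k k (\<lambda>x. (bump (n + 2) (f x) + (- real n) * bump (n + 1) (f x)) * partial i f x)" for i
    using Suc.prems by (intro C_k_mult C_k_add C_k_const Suc.IH C_k_Suc[OF Suc.prems]) auto
  ultimately show ?case using partial_comp(2)[OF bump_has_derivative d] by simp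
qed

text \<open>Scaling the arguments by \<open>Suc N\<close> keeps the set of nonzero values fixed and
  drives each exponential factor to 1 inside it. These functions therefore approximate the indicator
  of one open box from below without leaving it.\<close>

definition box_bump :: "real ^ 'n \<Rightarrow> real ^ 'n \<Rightarrow> nat \<Rightarrow> real ^ 'n \<Rightarrow> real"
  where "box_bump a b N x =
    (\<Prod>i\<in>UNIV. bump 0 (real (Suc N) * (x $ i - a $ i)) * bump 0 (real (Suc N) * (b $ i - x $ i)))"

lemma bump0: "0 \<le> bump 0 t" "bump 0 t \<le> 1" "bump 0 t \<noteq> 0 \<longleftrightarrow> t > 0"
  by (auto simp: bump_def)

lemma box_bump_bounds: "0 \<le> box_bump a b N x" "box_bump a b N x \<le> 1"
  unfolding box_bump_def by (auto intro!: prod_nonneg prod_le_1 mult_nonneg_nonneg mult_le_one bump0)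

lemma box_bump_support: "{x. box_bump a b N x \<noteq> 0} = box a b"
  unfolding box_bump_def by (auto simp: mem_box_cart bump0(3) zero_less_mult_iff)

lemma box_bump_tendsto: "(\<lambda>N. box_bump a b N x) \<longlonglongrightarrow> indicator (box a b) x"
proof -
  have *: "(\<lambda>N. bump 0 (real (Suc N) * t)) \<longlonglongrightarrow> (if t > 0 then 1 else 0)" for t
  proof (cases "t > 0")
    case True
    have "(\<lambda>N. exp (- (inverse (real (Suc N)) * inverse t))) \<longlonglongrightarrow> exp (- (0 * inverse t))"
      by (intro tendsto_intros LIMSEQ_inverse_real_of_nat)
    then show ?thesis using True by (simp add: bump_def)
  next
    case False
    then show ?thesis by (simp add: bump_def zero_less_mult_iff)
  qed
  have "(\<lambda>N. box_bump a b N x) \<longlonglongrightarrow> (\<Prod>i\<in>UNIV. (if x $ i - a $ i > 0 then 1 else 0) * (if b $ i - x $ i > 0 then 1 else 0))"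
    unfolding box_bump_def by (intro tendsto_intros *)
  also have "(\<Prod>i\<in>UNIV. (if x $ i - a $ i > 0 then 1 else 0) * (if b $ i - x $ i > 0 then 1 else 0)) = (indicator (box a b) x :: real)"
    by (cases "x \<in> box a b") (auto simp: mem_box_cart)
  finally show ?thesis .
qed

lemma box_bump_test:
  assumes "cbox a b \<subseteq> \<Omega>"
  shows "box_bump a b N \<in> test_functions \<Omega>"
proof -
  have "C_k k (\<lambda>x. bump 0 (real (Suc N) * (x $ i + (- a $ i))) * bump 0 (real (Suc N) * (b $ i + (-1) * x $ i)))" for k i
    by (intro C_k_mult C_k_bump C_k_add C_k_const C_k_nth)
  then have "C_k k (box_bump a b N)" for k
    unfolding box_bump_def[abs_def] by (intro C_k_prod) (auto simp: algebra_simps)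
  moreover have "closure (box a b) \<subseteq> cbox a b"
    by (intro closure_minimal box_subset_cbox closed_cbox)
  ultimately show ?thesis
    using assms bounded_box[of a b] by (auto simp: test_functions_def box_bump_support)
qed

text \<open>Open boxes are an intersection-stable generator of the Borel sets, so a function whose
  integral vanishes on them has vanishing integral on every Borel set.\<close>

lemma integrable_AE_zero_of_boxes:
  fixes w :: "real ^ 'n \<Rightarrow> real"
  assumes w: "integrable lebesgue w" and supp: "\<And>x. x \<notin> box a b \<Longrightarrow> w x = 0"
    and zero: "\<And>c d. box c d \<subseteq> box a b \<Longrightarrow> (LINT x|lebesgue. indicator (box c d) x * w x) = 0"
  shows "AE x in lebesgue. w x = 0"
proof -
  \<comment> \<open>Boxes generate only the Borel sets while \<open>w\<close> is Lebesgue
    measurable, so the induction runs on a Borel representative.\<close>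
  have "w \<in> borel_measurable (completion lborel)" using w by simp
  then obtain g where g: "g \<in> borel_measurable lborel" "AE x in lborel. w x = g x"
    using completion_ex_borel_measurable_real by blast
  have wg: "AE x in lebesgue. w x = g x" using g(2) by (rule AE_completion)
  have gm: "g \<in> borel_measurable lebesgue" using g(1) by (rule measurable_completion)
  have "integrable lebesgue g"
    using integrable_cong_AE[OF _ gm wg] w by auto
  then have gi: "integrable lborel g"
    using integrable_completion g(1) by blast
  have eq: "(LINT x:A|lborel. g x) = (LINT x|lebesgue. indicator A x * w x)" if "A \<in> sets borel" for A
  proof -
    have "(LINT x:A|lborel. g x) = (LINT x|lebesgue. indicator A x * g x)"
      unfolding set_lebesgue_integral_def real_scaleR_def
      by (rule integral_completion[symmetric]) (use g(1) that in measurable)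
    also have "\<dots> = (LINT x|lebesgue. indicator A x * w x)"
    proof (rule integral_cong_AE)
      show "AE x in lebesgue. indicator A x * g x = indicator A x * w x"
        using wg by eventually_elim simp
      have "A \<in> sets lebesgue" using that by auto
      then show "(\<lambda>x. indicator A x * g x) \<in> borel_measurable lebesgue" "(\<lambda>x. indicator A x * w x) \<in> borel_measurable lebesgue"
        using gm w by measurable
    qed
    finally show ?thesis .
  qed
  have boxes: "(LINT x:box c d|lborel. g x) = 0" for c d
  proof -
    obtain c' d' where cd: "box c d \<inter> box a b = box c' d'" using box_Int_box by blast
    have "(LINT x:box c d|lborel. g x) = (LINT x|lebesgue. indicator (box c d) x * w x)" by (rule eq) auto
    also have "\<dots> = (LINT x|lebesgue. indicator (box c' d') x * w x)"
      unfolding cd[symmetric] using supp by (intro Bochner_Integration.integral_cong) (auto simp: indicator_def)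
    also have "\<dots> = 0" using cd by (intro zero) auto
    finally show ?thesis .
  qed
  \<comment> \<open>Needed for complements in the induction. The whole space counts as the box
    \<open>box a b\<close>, outside which \<open>w\<close> is zero.\<close>
  have total: "(LINT x|lborel. g x) = 0"
  proof -
    have "(LINT x|lborel. g x) = (LINT x:UNIV|lborel. g x)" by (simp add: set_lebesgue_integral_def)
    also have "\<dots> = (LINT x|lebesgue. indicator UNIV x * w x)" by (rule eq) auto
    also have "\<dots> = (LINT x|lebesgue. indicator (box a b) x * w x)"
      using supp by (intro Bochner_Integration.integral_cong) (auto simp: indicator_def)
    also have "\<dots> = 0" by (rule zero) auto
    finally show ?thesis .
  qed
  have stable: "Int_stable (range (\<lambda>(c, d). box c d :: (real ^ 'n) set))"
    by (auto simp: Int_stable_def box_Int_box)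
  have Pow_top: "range (\<lambda>(c, d). box c d :: (real ^ 'n) set) \<subseteq> Pow UNIV" by simp
  have "(LINT x:A|lborel. g x) = 0" if A: "A \<in> sigma_sets UNIV (range (\<lambda>(c, d). box c d))" for A
    using stable Pow_top A
  proof (induction rule: sigma_sets_induct_disjoint)
    case (basic A)
    then show ?case using boxes by auto
  next
    case empty
    then show ?case by (simp add: set_lebesgue_integral_def)
  next
    case (compl A)
    have m: "A \<in> sets lborel"
      using compl(1) by (simp add: borel_eq_box)
    have i: "set_integrable lborel B g" if "B \<in> sets lborel" for B
      using gi that unfolding set_integrable_def by (intro integrable_mult_indicator)
    have "(LINT x:A \<union> (UNIV - A)|lborel. g x) = (LINT x:A|lborel. g x) + (LINT x:UNIV - A|lborel. g x)"
      by (rule set_integral_Un) (use i m in \<open>auto simp: Compl_eq_Diff_UNIV[symmetric]\<close>)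
    then show ?case using compl total by (simp add: set_lebesgue_integral_def)
  next
    case (union A)
    have m: "A i \<in> sets lborel" for i
      using union(2) by (auto simp: borel_eq_box)
    have "(LINT x:(\<Union>i. A i)|lborel. g x) = (\<Sum>i. LINT x:A i|lborel. g x)"
    proof (rule lebesgue_integral_countable_add)
      show "set_integrable lborel (\<Union>i. A i) g"
        using gi m unfolding set_integrable_def by (intro integrable_mult_indicator) auto
    qed (use union(1) m in \<open>auto simp: disjoint_family_on_def\<close>)
    then show ?case using union(3) by simp
  qed
  then have "AE x in lborel. g x = 0"
    using gi by (intro density_unique_real) (auto simp: borel_eq_box)
  then have "AE x in lebesgue. g x = 0" by (rule AE_completion)
  with wg show ?thesis by eventually_elim simp
qed

lemma locally_integrable_on_mult:
  assumes "locally_integrable_on \<Omega> v" "compact K" "K \<subseteq> \<Omega>" "\<phi> \<in> borel_measurable lebesgue"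
    "\<And>x. \<bar>\<phi> x\<bar> \<le> C" "\<And>x. x \<notin> K \<Longrightarrow> \<phi> x = 0"
  shows "integrable lebesgue (\<lambda>x. v x * \<phi> x)"
proof -
  have v: "integrable lebesgue (\<lambda>x. indicator K x * v x)"
    using assms(1-3) unfolding locally_integrable_on_def set_integrable_def by auto
  have "integrable lebesgue (\<lambda>x. (indicator K x * v x) * \<phi> x)"
  proof (rule Bochner_Integration.integrable_bound[OF integrable_mult_right[OF v, of C]])
    show "(\<lambda>x. (indicator K x * v x) * \<phi> x) \<in> borel_measurable lebesgue"
      using assms(4) borel_measurable_integrable[OF v] by measurable
    show "AE x in lebesgue. norm ((indicator K x * v x) * \<phi> x) \<le> norm (C * (indicator K x * v x))"
    proof (rule AE_I2)
      fix x
      have "\<bar>\<phi> x\<bar> \<le> \<bar>C\<bar>" using assms(5)[of x] by linarith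
      then have "\<bar>\<phi> x\<bar> * \<bar>indicator K x * v x\<bar> \<le> \<bar>C\<bar> * \<bar>indicator K x * v x\<bar>"
        by (intro mult_right_mono) auto
      then show "norm ((indicator K x * v x) * \<phi> x) \<le> norm (C * (indicator K x * v x))"
        by (simp add: abs_mult mult_ac)
    qed
  qed
  moreover have "(indicator K x * v x) * \<phi> x = v x * \<phi> x" for x
    using assms(6) by (auto simp: indicator_def)
  ultimately show ?thesis by simp
qed

text \<open>Inside a closed box in \<Omega>, dominated convergence along \<open>box_bump\<close>
  passes from test functions to indicators of open boxes. Countably many closed boxes exhaust
  \<Omega>, so the null sets may be joined.\<close>

lemma fundamental_lemma:
  fixes v :: "real ^ 'n \<Rightarrow> real"
  assumes \<Omega>: "open \<Omega>" and v: "locally_integrable_on \<Omega> v"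
    and zero: "\<And>\<phi>. \<phi> \<in> test_functions \<Omega> \<Longrightarrow> (LINT x:\<Omega>|lebesgue. v x * \<phi> x) = 0"
  shows "AE x in lebesgue. x \<in> \<Omega> \<longrightarrow> v x = 0"
proof -
  have box_zero: "AE x in lebesgue. x \<in> cbox a b \<longrightarrow> v x = 0" if ab: "cbox a b \<subseteq> \<Omega>" for a b
  proof -
    have bm: "(indicator (box c d) :: real ^ 'n \<Rightarrow> real) \<in> borel_measurable lebesgue" for c d :: "real ^ 'n"
      by (intro borel_measurable_indicator) auto
    have i: "integrable lebesgue (\<lambda>x. v x * indicator (box a b) x)"
      by (rule locally_integrable_on_mult[OF v compact_cbox ab bm, where C=1])
        (use box_subset_cbox[of a b] in \<open>auto simp: indicator_def\<close>)
    have "AE x in lebesgue. v x * indicator (box a b) x = 0"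
    proof (rule integrable_AE_zero_of_boxes[OF i, of a b])
      fix c d :: "real ^ 'n" assume cd: "box c d \<subseteq> box a b"
      \<comment> \<open>Nonemptiness matters: an empty open box can have a nonempty degenerate
        \<open>cbox c d\<close>, which need not lie in \<Omega>.\<close>
      have cab: "cbox c d \<subseteq> \<Omega>" if "box c d \<noteq> {}"
        using closure_mono[OF cd] closure_box[OF that] ab
        by (metis box_subset_cbox closed_cbox closure_minimal order_trans)
      show "(LINT x|lebesgue. indicator (box c d) x * (v x * indicator (box a b) x)) = 0"
      proof (cases "box c d = {}")
        case False
        have "(\<lambda>N. LINT x|lebesgue. v x * box_bump c d N x) \<longlonglongrightarrow> (LINT x|lebesgue. v x * indicator (box c d) x)"
        proof (rule integral_dominated_convergence)
          show dom: "integrable lebesgue (\<lambda>x. \<bar>v x * indicator (box c d) x\<bar>)"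
            by (intro integrable_abs locally_integrable_on_mult[OF v compact_cbox cab[OF False] bm, where C=1])
              (use box_subset_cbox[of c d] in \<open>auto simp: indicator_def\<close>)
          show "AE x in lebesgue. (\<lambda>N. v x * box_bump c d N x) \<longlonglongrightarrow> v x * indicator (box c d) x"
            by (intro AE_I2 tendsto_intros box_bump_tendsto)
          show "(\<lambda>x. v x * indicator (box c d) x) \<in> borel_measurable lebesgue"
            by (rule borel_measurable_integrable, intro locally_integrable_on_mult[OF v compact_cbox cab[OF False] bm, where C=1])
              (use box_subset_cbox[of c d] in \<open>auto simp: indicator_def\<close>)
          fix N
          have "box_bump c d N \<in> borel_measurable borel"
            using box_bump_test[OF cab[OF False], of N] C_k_continuous
            by (auto simp: test_functions_def intro!: borel_measurable_continuous_onI)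
          then have bb: "box_bump c d N \<in> borel_measurable lebesgue"
            by (simp add: measurable_completion)
          have z: "box_bump c d N x = 0" if "x \<notin> box c d" for x
            using box_bump_support[of c d N] that by auto
          show "(\<lambda>x. v x * box_bump c d N x) \<in> borel_measurable lebesgue"
            by (rule borel_measurable_integrable, rule locally_integrable_on_mult[OF v compact_cbox cab[OF False] bb, where C=1])
              (use z box_subset_cbox[of c d] box_bump_bounds[of c d N] in \<open>auto simp: abs_of_nonneg\<close>)
          show "AE x in lebesgue. norm (v x * box_bump c d N x) \<le> \<bar>v x * indicator (box c d) x\<bar>"
          proof (rule AE_I2)
            fix x show "norm (v x * box_bump c d N x) \<le> \<bar>v x * indicator (box c d) x\<bar>"
              using z[of x] box_bump_bounds[of c d N x] mult_right_le_one_le[of "\<bar>v x\<bar>" "box_bump c d N x"]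
              by (cases "x \<in> box c d") (auto simp: abs_mult)
          qed
        qed
        moreover have "(LINT x|lebesgue. v x * box_bump c d N x) = 0" for N
        proof -
          have "(LINT x|lebesgue. v x * box_bump c d N x) = (LINT x:\<Omega>|lebesgue. v x * box_bump c d N x)"
            unfolding set_lebesgue_integral_def
            using box_bump_support[of c d N] box_subset_cbox[of c d] cab[OF False]
            by (intro Bochner_Integration.integral_cong) (auto simp: indicator_def)
          then show ?thesis using zero[OF box_bump_test[OF cab[OF False]]] by simp
        qed
        ultimately have "(LINT x|lebesgue. v x * indicator (box c d) x) = 0"
          by (simp add: LIMSEQ_const_iff)
        moreover have "indicator (box c d) x * (v x * indicator (box a b) x) = v x * indicator (box c d) x" for x
          using cd by (auto simp: indicator_def)
        ultimately show ?thesis by (simp only:)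
      qed simp
    qed auto
    \<comment> \<open>The test functions only reach the open box; the faces of the closed one form a
      null set.\<close>
    moreover have "AE x in lebesgue. x \<notin> cbox a b - box a b"
      using negligible_frontier_interval[of a b] by (intro AE_not_in) (simp only: negligible_iff_null_sets)
    ultimately show ?thesis by eventually_elim (auto simp: indicator_def split: if_splits)
  qed
  obtain \<D> where D: "countable \<D>" "\<And>X. X \<in> \<D> \<Longrightarrow> X \<subseteq> \<Omega>" "\<And>X. X \<in> \<D> \<Longrightarrow> \<exists>a b. X = cbox a b" "\<Union>\<D> = \<Omega>"
    by (rule open_countable_Union_open_cbox[OF \<Omega>]) blast
  have "AE x in lebesgue. \<forall>X\<in>\<D>. x \<in> X \<longrightarrow> v x = 0"
    unfolding AE_ball_countable[OF D(1)]
  proof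
    fix X assume "X \<in> \<D>"
    then obtain a b where "X = cbox a b" "cbox a b \<subseteq> \<Omega>" using D(2,3) by blast
    then show "AE x in lebesgue. x \<in> X \<longrightarrow> v x = 0" using box_zero by simp
  qed
  then show ?thesis unfolding D(4)[symmetric] by eventually_elim auto
qed

section \<open>Calculus of test functions and weak gradients\<close>

lemma test_functionsD:
  assumes "\<phi> \<in> test_functions \<Omega>"
  shows "C_k k \<phi>" "continuous_on A \<phi>" "\<phi> differentiable (at x)" "continuous_on A (partial i \<phi>)"
    "x \<notin> \<Omega> \<Longrightarrow> \<phi> x = 0" "x \<notin> \<Omega> \<Longrightarrow> partial i \<phi> x = 0"
proof -
  have C: "C_k k \<phi>" for k using assms by (simp add: test_functions_def)
  show "C_k k \<phi>" by (rule C)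
  show "continuous_on A \<phi>" by (rule continuous_on_subset[OF C_k_continuous[OF C[of 0]]]) auto
  show "\<phi> differentiable (at x)" using C[of "Suc 0"] by simp
  show "continuous_on A (partial i \<phi>)" by (rule continuous_on_subset[of UNIV]) (use C[of "Suc 0"] in auto)
  assume x: "x \<notin> \<Omega>"
  have cl: "closure {x. \<phi> x \<noteq> 0} \<subseteq> \<Omega>" using assms by (simp add: test_functions_def)
  then show "\<phi> x = 0" using x closure_subset[of "{x. \<phi> x \<noteq> 0}"] by auto
  \<comment> \<open>The complement of the closed support is open, so \<open>\<phi>\<close> is zero
    on a neighbourhood of \<open>x\<close>; the value \<open>\<phi> x = 0\<close> alone would say
    nothing about the derivative.\<close>
  have "(\<phi> has_derivative (\<lambda>_. 0)) (at x)"
  proof (rule has_derivative_transform_within_open)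
    show "((\<lambda>_. 0) has_derivative (\<lambda>_. 0)) (at x)" by simp
    show "open (- closure {x. \<phi> x \<noteq> 0})" by (rule open_Compl) simp
    show "x \<in> - closure {x. \<phi> x \<noteq> 0}" using x cl by blast
    show "\<And>y. y \<in> - closure {x. \<phi> x \<noteq> 0} \<Longrightarrow> 0 = \<phi> y" using closure_subset[of "{x. \<phi> x \<noteq> 0}"] by auto
  qed
  from partialI[OF this] show "partial i \<phi> x = 0" by simp
qed

lemma test_functions_mult:
  assumes "\<phi> \<in> test_functions \<Omega>" "\<And>k. C_k k g"
  shows "(\<lambda>x. \<phi> x * g x) \<in> test_functions \<Omega>"
proof -
  have sub: "closure {x. \<phi> x * g x \<noteq> 0} \<subseteq> closure {x. \<phi> x \<noteq> 0}" by (intro closure_mono) auto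
  have \<phi>: "compact (closure {x. \<phi> x \<noteq> 0})" "closure {x. \<phi> x \<noteq> 0} \<subseteq> \<Omega>"
    using assms by (auto simp: test_functions_def)
  have "compact (closure {x. \<phi> x * g x \<noteq> 0})"
    using \<phi>(1) sub bounded_subset unfolding compact_eq_bounded_closed by blast
  moreover have "closure {x. \<phi> x * g x \<noteq> 0} \<subseteq> \<Omega>" using sub \<phi>(2) by blast
  moreover have "C_k k (\<lambda>x. \<phi> x * g x)" for k
    by (intro C_k_mult test_functionsD(1)[OF assms(1)] assms(2))
  ultimately show ?thesis
    by (simp add: test_functions_def)
qed

lemma test_functions_integrable:
  assumes "locally_integrable_on \<Omega> v" "\<phi> \<in> test_functions \<Omega>"
  shows "set_integrable lebesgue \<Omega> (\<lambda>x. v x * \<phi> x)"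
proof -
  define K where "K = closure {x. \<phi> x \<noteq> 0}"
  have K: "compact K" "K \<subseteq> \<Omega>" using assms(2) by (auto simp: test_functions_def K_def)
  have "bounded (\<phi> ` K)"
    by (intro compact_imp_bounded compact_continuous_image test_functionsD(2)[OF assms(2)] K(1))
  then obtain C where C: "C > 0" "\<And>x. x \<in> K \<Longrightarrow> \<bar>\<phi> x\<bar> \<le> C"
    unfolding bounded_pos by auto
  have z: "\<phi> x = 0" if "x \<notin> K" for x using that closure_subset[of "{x. \<phi> x \<noteq> 0}"] unfolding K_def by auto
  have "\<phi> \<in> borel_measurable borel"
    by (intro borel_measurable_continuous_onI test_functionsD[OF assms(2)])
  then have m: "\<phi> \<in> borel_measurable lebesgue" by (simp add: measurable_completion)
  have bd: "\<bar>\<phi> x\<bar> \<le> C" for x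
  proof (cases "x \<in> K")
    case True
    then show ?thesis by (rule C(2))
  next
    case False
    then show ?thesis using z C(1) by simp
  qed
  have i: "integrable lebesgue (\<lambda>x. v x * \<phi> x)"
    by (rule locally_integrable_on_mult[OF assms(1) K m bd z])
  have "indicator \<Omega> x *\<^sub>R (v x * \<phi> x) = v x * \<phi> x" for x
    using z[of x] K(2) by (cases "x \<in> \<Omega>") auto
  then show ?thesis using i by (simp only: set_integrable_def)
qed

lemma has_weak_gradient_unique:
  assumes "open \<Omega>" "has_weak_gradient \<Omega> u g" "has_weak_gradient \<Omega> u h"
  shows "AE x in lebesgue. x \<in> \<Omega> \<longrightarrow> g x = h x"
proof -
  have "AE x in lebesgue. x \<in> \<Omega> \<longrightarrow> g x $ i - h x $ i = 0" for i
  proof (rule fundamental_lemma[OF assms(1)])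
    have l: "locally_integrable_on \<Omega> (\<lambda>x. g x $ i)" "locally_integrable_on \<Omega> (\<lambda>x. h x $ i)"
      using assms unfolding has_weak_gradient_def by auto
    then show "locally_integrable_on \<Omega> (\<lambda>x. g x $ i - h x $ i)"
      unfolding locally_integrable_on_def by (auto intro: set_integral_diff)
    fix \<phi> assume \<phi>: "\<phi> \<in> test_functions \<Omega>"
    have "(LINT x:\<Omega>|lebesgue. g x $ i * \<phi> x - h x $ i * \<phi> x) =
      (LINT x:\<Omega>|lebesgue. g x $ i * \<phi> x) - (LINT x:\<Omega>|lebesgue. h x $ i * \<phi> x)"
      by (rule set_integral_diff(2)[OF test_functions_integrable[OF l(1) \<phi>] test_functions_integrable[OF l(2) \<phi>]])
    also have "\<dots> = 0"
    proof -
      have "(LINT x:\<Omega>|lebesgue. u x * partial i \<phi> x) = - (LINT x:\<Omega>|lebesgue. g x $ i * \<phi> x)"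
        "(LINT x:\<Omega>|lebesgue. u x * partial i \<phi> x) = - (LINT x:\<Omega>|lebesgue. h x $ i * \<phi> x)"
        using assms(2,3) \<phi> unfolding has_weak_gradient_def by blast+
      then show ?thesis by linarith
    qed
    finally show "(LINT x:\<Omega>|lebesgue. (g x $ i - h x $ i) * \<phi> x) = 0" by (simp add: left_diff_distrib)
  qed
  then have "AE x in lebesgue. \<forall>i. x \<in> \<Omega> \<longrightarrow> g x $ i - h x $ i = 0"
    unfolding AE_all_countable by blast
  then show ?thesis by eventually_elim (auto simp: vec_eq_iff)
qed

text \<open>This makes the \<open>SOME\<close> in the definition computable: any known weak gradient
  may replace the chosen one under an integral.\<close>

lemma weak_gradient_AE:
  assumes "open \<Omega>" "has_weak_gradient \<Omega> u g"
  shows "AE x in lebesgue. x \<in> \<Omega> \<longrightarrow> weak_gradient \<Omega> u x = g x"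
proof -
  have "has_weak_gradient \<Omega> u (weak_gradient \<Omega> u)"
    unfolding weak_gradient_def by (rule someI[of "has_weak_gradient \<Omega> u"], rule assms(2))
  then show ?thesis using has_weak_gradient_unique[OF assms(1)] assms(2) by blast
qed

lemma has_weak_gradient_diff:
  assumes "has_weak_gradient \<Omega> u g" "has_weak_gradient \<Omega> w h"
  shows "has_weak_gradient \<Omega> (\<lambda>x. u x - w x) (\<lambda>x. g x - h x)"
proof -
  have l: "locally_integrable_on \<Omega> u" "locally_integrable_on \<Omega> w" "\<And>i. locally_integrable_on \<Omega> (\<lambda>x. g x $ i)" "\<And>i. locally_integrable_on \<Omega> (\<lambda>x. h x $ i)"
    using assms unfolding has_weak_gradient_def by auto
  have ld: "locally_integrable_on \<Omega> (\<lambda>x. f1 x - f2 x)" if "locally_integrable_on \<Omega> f1" "locally_integrable_on \<Omega> f2" for f1 f2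
    using that unfolding locally_integrable_on_def by (auto intro: set_integral_diff)
  \<comment> \<open>Splitting the integral of a difference requires
    \<open>u * partial i \<phi>\<close> to be integrable, which
    \<open>test_functions_integrable\<close> yields once the derivative is itself a test
    function.\<close>
  have C: "partial i \<phi> \<in> test_functions \<Omega>" if "\<phi> \<in> test_functions \<Omega>" for i \<phi>
  proof -
    have "C_k (Suc k) \<phi>" for k using test_functionsD(1)[OF that] .
    then have "C_k k (partial i \<phi>)" for k by simp
    moreover have "closure {x. partial i \<phi> x \<noteq> 0} \<subseteq> closure {x. \<phi> x \<noteq> 0}"
    proof (rule closure_minimal)
      \<comment> \<open>A test function of \<Omega> is also one of its own closed support. The
        vanishing of derivatives off the domain then controls the support of the derivative.\<close>
      have "\<phi> \<in> test_functions (closure {x. \<phi> x \<noteq> 0})" using that by (simp add: test_functions_def)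
      from test_functionsD(6)[OF this] show "{x. partial i \<phi> x \<noteq> 0} \<subseteq> closure {x. \<phi> x \<noteq> 0}" by auto
    qed auto
    ultimately show ?thesis using that
      by (auto simp: test_functions_def compact_eq_bounded_closed intro: bounded_subset[of "closure {x. \<phi> x \<noteq> 0}"])
  qed
  show ?thesis
    unfolding has_weak_gradient_def
  proof (intro conjI allI ballI)
    show "locally_integrable_on \<Omega> (\<lambda>x. u x - w x)" "locally_integrable_on \<Omega> (\<lambda>x. (g x - h x) $ i)" for i
      using ld[OF l(1,2)] ld[OF l(3,4)] by auto
    fix i \<phi> assume \<phi>: "\<phi> \<in> test_functions \<Omega>"
    have 1: "(LINT x:\<Omega>|lebesgue. u x * partial i \<phi> x) = - (LINT x:\<Omega>|lebesgue. g x $ i * \<phi> x)"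
      "(LINT x:\<Omega>|lebesgue. w x * partial i \<phi> x) = - (LINT x:\<Omega>|lebesgue. h x $ i * \<phi> x)"
      using assms \<phi> unfolding has_weak_gradient_def by blast+
    show "(LINT x:\<Omega>|lebesgue. (u x - w x) * partial i \<phi> x) = - (LINT x:\<Omega>|lebesgue. (g x - h x) $ i * \<phi> x)"
      using 1
        set_integral_diff(2)[OF test_functions_integrable[OF l(1) C[OF \<phi>, of i]] test_functions_integrable[OF l(2) C[OF \<phi>, of i]]]
        set_integral_diff(2)[OF test_functions_integrable[OF l(3)[of i] \<phi>] test_functions_integrable[OF l(4)[of i] \<phi>]]
      unfolding vector_minus_component left_diff_distrib by linarith
  qed
qed

section \<open>Iterated integration in the plane\<close>

definition vec2 :: "real \<Rightarrow> real \<Rightarrow> real ^ 2"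
  where "vec2 x y = x *\<^sub>R axis 1 1 + y *\<^sub>R axis 2 1"

lemma vec2_nth [simp]: "vec2 x y $ 1 = x" "vec2 x y $ 2 = y"
  by (simp_all add: vec2_def axis_def)

lemma norm2_power2: "(norm (z :: real ^ 2))\<^sup>2 = (z $ 1)\<^sup>2 + (z $ 2)\<^sup>2"
  by (simp add: norm_eq_sqrt_inner inner_vec_def sum_2 power2_eq_square)

lemma norm_vec2: "(norm (vec2 x y))\<^sup>2 = x\<^sup>2 + y\<^sup>2"
  by (simp add: norm2_power2)

lemma vec2_has_derivative:
  "((\<lambda>x. vec2 x y) has_derivative (\<lambda>h. h *\<^sub>R axis 1 1)) (at x)"
  "(vec2 x has_derivative (\<lambda>h. h *\<^sub>R axis 2 1)) (at y)"
  unfolding vec2_def[abs_def] by (auto intro!: derivative_eq_intros)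

lemma continuous_on_vec2 [continuous_intros]:
  "continuous_on A f \<Longrightarrow> continuous_on A g \<Longrightarrow> continuous_on A (\<lambda>z. vec2 (f z) (g z))"
  unfolding vec2_def by (intro continuous_intros)

lemma Basis_real2: "(Basis :: (real ^ 2) set) = {axis 1 1, axis 2 1}"
  by (auto simp: Basis_vec_def UNIV_2)

text \<open>Lebesgue measure is determined by its values on boxes, and \<open>vec2\<close> pulls a
  box back to one with the same side lengths. This transfers integrals over \<open>real ^ 2\<close>
  to \<open>real \<times> real\<close>, where they can be iterated.\<close>

lemma lborel_vec2: "(lborel :: (real ^ 2) measure) = distr lborel borel (\<lambda>z. vec2 (fst z) (snd z))"
proof (rule lborel_eqI)
  have m: "(\<lambda>z::real \<times> real. vec2 (fst z) (snd z)) \<in> borel_measurable borel"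
    by (intro borel_measurable_continuous_onI continuous_intros)
  fix l u :: "real ^ 2" assume lu: "\<And>b. b \<in> Basis \<Longrightarrow> l \<bullet> b \<le> u \<bullet> b"
  have le: "l $ 1 \<le> u $ 1" "l $ 2 \<le> u $ 2"
    using lu[of "axis 1 1"] lu[of "axis 2 1"] by (auto simp: Basis_real2 inner_axis)
  have "(\<lambda>z. vec2 (fst z) (snd z)) -` box l u = box (l $ 1, l $ 2) (u $ 1, u $ 2)"
    by (auto simp: mem_box_cart forall_2 mem_box Basis_prod_def)
  then have "emeasure (distr lborel borel (\<lambda>z. vec2 (fst z) (snd z))) (box l u) = emeasure lborel (box (l $ 1, l $ 2) (u $ 1, u $ 2))"
    using m by (simp add: emeasure_distr)
  also have "\<dots> = (\<Prod>b\<in>Basis. ((u $ 1, u $ 2) - (l $ 1, l $ 2)) \<bullet> b)"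
    using le by (intro emeasure_lborel_box) (auto simp: Basis_prod_def)
  also have "\<dots> = (u $ 1 - l $ 1) * (u $ 2 - l $ 2)"
    by (simp add: Basis_prod_def mult.commute)
  also have "\<dots> = (\<Prod>b\<in>Basis. (u - l) \<bullet> b)"
    by (simp add: Basis_real2 inner_axis axis_eq_axis)
  finally show "emeasure (distr lborel borel (\<lambda>z. vec2 (fst z) (snd z))) (box l u) = (\<Prod>b\<in>Basis. (u - l) \<bullet> b)" .
qed simp

lemma set_integrable_continuous:
  fixes F :: "real ^ 'n \<Rightarrow> real"
  assumes "continuous_on UNIV F" "S \<in> sets borel" "bounded S"
  shows "set_integrable lebesgue S F"
proof -
  obtain a where a: "S \<subseteq> cball 0 a" using assms(3) unfolding bounded_iff by (auto simp: subset_iff)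
  have "set_integrable lborel (cball 0 a) F"
    unfolding set_integrable_def
    by (rule borel_integrable_compact[OF compact_cball]) (auto intro: continuous_on_subset[OF assms(1)])
  then have "set_integrable lborel S F"
    by (rule set_integrable_subset) (use assms(2) a in auto)
  then show ?thesis
    unfolding set_integrable_def by (subst integrable_completion) auto
qed

text \<open>A continuous function that is zero off the disc is already its own extension by zero to
  the square, so the disc may be traded for a domain on which iterated integrals have constant
  limits.\<close>

lemma integral_ball_iterated:
  fixes F :: "real ^ 2 \<Rightarrow> real"
  assumes F: "continuous_on UNIV F" "\<And>x. x \<notin> ball 0 R \<Longrightarrow> F x = 0"
  shows "(LINT x:ball 0 R|lebesgue. F x) = integral {-R..R} (\<lambda>x. integral {-R..R} (\<lambda>y. F (vec2 x y)))"
proof -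
  have m: "(\<lambda>z::real \<times> real. vec2 (fst z) (snd z)) \<in> borel_measurable borel"
    by (intro borel_measurable_continuous_onI continuous_intros)
  have Fm: "F \<in> borel_measurable borel" by (intro borel_measurable_continuous_onI F)
  have c: "continuous_on A (\<lambda>z. F (vec2 (fst z) (snd z)))" for A
    by (intro continuous_on_compose2[OF F(1)] continuous_intros) auto
  have "(LINT x:ball 0 R|lebesgue. F x) = (LINT x|lebesgue. F x)"
    unfolding set_lebesgue_integral_def using F(2) by (intro Bochner_Integration.integral_cong) (auto simp: indicator_def)
  also have "\<dots> = (LINT x|lborel. F x)" using Fm by (intro integral_completion) auto
  also have "\<dots> = (LINT z|lborel. F (vec2 (fst z) (snd z)))"
    by (subst lborel_vec2, subst integral_distr) (use m Fm in auto)
  also have "\<dots> = (LINT z:cbox (-R,-R) (R,R)|lborel. F (vec2 (fst z) (snd z)))"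
    unfolding set_lebesgue_integral_def
  proof (intro Bochner_Integration.integral_cong refl)
    fix z :: "real \<times> real"
    have "F (vec2 (fst z) (snd z)) = 0" if "z \<notin> cbox (-R,-R) (R,R)"
    proof (rule F(2))
      have "\<bar>fst z\<bar> > R \<or> \<bar>snd z\<bar> > R" using that by (cases z) (auto simp: cbox_Pair_eq)
      then show "vec2 (fst z) (snd z) \<notin> ball 0 R"
        using component_le_norm_cart[of "vec2 (fst z) (snd z)" 1] component_le_norm_cart[of "vec2 (fst z) (snd z)" 2] by auto
    qed
    then show "F (vec2 (fst z) (snd z)) = indicator (cbox (-R,-R) (R,R)) z *\<^sub>R F (vec2 (fst z) (snd z))"
      by (cases "z \<in> cbox (-R,-R) (R,R)") auto
  qed
  also have "\<dots> = integral (cbox (-R,-R) (R,R)) (\<lambda>z. F (vec2 (fst z) (snd z)))"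
    by (rule set_borel_integral_eq_integral)
       (unfold set_integrable_def, rule borel_integrable_compact[OF compact_cbox c])
  also have "\<dots> = integral {-R..R} (\<lambda>x. integral {-R..R} (\<lambda>y. F (vec2 x y)))"
    using integral_prod_continuous[OF c] by simp
  finally show ?thesis .
qed

lemma vec2_has_real_derivative:
  fixes \<phi> :: "real ^ 2 \<Rightarrow> real"
  assumes "\<phi> differentiable (at (vec2 x y))"
  shows "((\<lambda>x. \<phi> (vec2 x y)) has_real_derivative partial 1 \<phi> (vec2 x y)) (at x)"
    "((\<lambda>y. \<phi> (vec2 x y)) has_real_derivative partial 2 \<phi> (vec2 x y)) (at y)"
proof -
  note d = partial_has_derivative(1)[OF assms]
  have l: "frechet_derivative \<phi> (at (vec2 x y)) (h *\<^sub>R v) = partial_dir * h"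
    if "partial_dir = frechet_derivative \<phi> (at (vec2 x y)) v" for h v partial_dir
    using linear_frechet_derivative[OF assms] that by (simp add: linear_cmul)
  show "((\<lambda>x. \<phi> (vec2 x y)) has_real_derivative partial 1 \<phi> (vec2 x y)) (at x)"
    using has_derivative_compose[OF vec2_has_derivative(1) d] l[OF refl]
    by (simp add: has_field_derivative_def partial_def ext[of _ "(*) _"])
  show "((\<lambda>y. \<phi> (vec2 x y)) has_real_derivative partial 2 \<phi> (vec2 x y)) (at y)"
    using has_derivative_compose[OF vec2_has_derivative(2) d] l[OF refl]
    by (simp add: has_field_derivative_def partial_def)
qed

lemma integral_partial_test:
  fixes \<phi> :: "real ^ 2 \<Rightarrow> real"
  assumes \<phi>: "\<phi> \<in> test_functions (ball 0 R)" and R: "R > 0"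
  shows "(LINT x:ball 0 R|lebesgue. partial i \<phi> x) = 0"
proof -
  have n: "\<bar>x\<bar> \<ge> R \<or> \<bar>y\<bar> \<ge> R \<Longrightarrow> \<phi> (vec2 x y) = 0" for x y
    using component_le_norm_cart[of "vec2 x y" 1] component_le_norm_cart[of "vec2 x y" 2]
    by (intro test_functionsD(5)[OF \<phi>]) auto
  have c: "continuous_on UNIV (\<lambda>z. partial i \<phi> (vec2 (fst z) (snd z)))" for i
    by (intro continuous_on_compose2[OF test_functionsD(4)[OF \<phi>, of UNIV]] continuous_intros) auto
  have "(LINT x:ball 0 R|lebesgue. partial i \<phi> x) = integral {-R..R} (\<lambda>x. integral {-R..R} (\<lambda>y. partial i \<phi> (vec2 x y)))"
    by (intro integral_ball_iterated test_functionsD(4,6)[OF \<phi>])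
  also have "\<dots> = 0"
  proof (cases "i = 1")
    case True
    have "integral {-R..R} (\<lambda>x. integral {-R..R} (\<lambda>y. partial 1 \<phi> (vec2 x y))) = integral {-R..R} (\<lambda>y. \<phi> (vec2 R y) - \<phi> (vec2 (-R) y))"
      using R by (intro integral_partial_fst vec2_has_real_derivative test_functionsD[OF \<phi>] c) auto
    then show ?thesis using R by (simp add: True n)
  next
    case False
    then have i: "i = 2" using exhaust_2 by blast
    have "integral {-R..R} (\<lambda>x. integral {-R..R} (\<lambda>y. partial 2 \<phi> (vec2 x y))) = integral {-R..R} (\<lambda>x. \<phi> (vec2 x R) - \<phi> (vec2 x (-R)))"
      using R by (intro integral_partial_snd vec2_has_real_derivative test_functionsD[OF \<phi>]) auto
    then show ?thesis using R by (simp add: i n)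
  qed
  finally show ?thesis .
qed

text \<open>The product of two test functions is a test function, so its partial derivatives
  integrate to zero; the product rule turns this into the defining identity.\<close>

lemma test_functions_weak_gradient:
  fixes \<phi> :: "real ^ 2 \<Rightarrow> real"
  assumes \<phi>: "\<phi> \<in> test_functions (ball 0 R)" and R: "R > 0"
  shows "has_weak_gradient (ball 0 R) \<phi> (\<lambda>x. \<chi> i. partial i \<phi> x)"
  unfolding has_weak_gradient_def
proof (intro conjI allI ballI)
  have loc: "locally_integrable_on (ball 0 R) f" if "continuous_on UNIV f" for f :: "real ^ 2 \<Rightarrow> real"
    unfolding locally_integrable_on_def
    by (intro allI impI set_integrable_continuous that) (auto intro: borel_compact compact_imp_bounded)
  show "locally_integrable_on (ball 0 R) \<phi>" by (rule loc[OF test_functionsD(2)[OF \<phi>]])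
  show "locally_integrable_on (ball 0 R) (\<lambda>x. (\<chi> i. partial i \<phi> x) $ i)" for i
    using loc[OF test_functionsD(4)[OF \<phi>]] by simp
  fix i and \<psi> :: "real ^ 2 \<Rightarrow> real" assume \<psi>: "\<psi> \<in> test_functions (ball 0 R)"
  have "(\<lambda>x. \<phi> x * \<psi> x) \<in> test_functions (ball 0 R)"
    by (intro test_functions_mult \<phi> test_functionsD(1)[OF \<psi>])
  then have "(LINT x:ball 0 R|lebesgue. partial i (\<lambda>x. \<phi> x * \<psi> x) x) = 0"
    by (rule integral_partial_test[OF _ R])
  moreover have "partial i (\<lambda>x. \<phi> x * \<psi> x) x = \<phi> x * partial i \<psi> x + partial i \<phi> x * \<psi> x" for x
    by (intro partial_mult test_functionsD(3)[OF \<phi>] test_functionsD(3)[OF \<psi>])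
  moreover have "(LINT x:ball 0 R|lebesgue. \<phi> x * partial i \<psi> x + partial i \<phi> x * \<psi> x) =
    (LINT x:ball 0 R|lebesgue. \<phi> x * partial i \<psi> x) + (LINT x:ball 0 R|lebesgue. partial i \<phi> x * \<psi> x)"
    by (rule set_integral_add; rule set_integrable_continuous)
      (auto intro!: continuous_on_mult test_functionsD[OF \<phi>] test_functionsD[OF \<psi>])
  ultimately show "(LINT x:ball 0 R|lebesgue. \<phi> x * partial i \<psi> x) = - (LINT x:ball 0 R|lebesgue. (\<chi> i. partial i \<phi> x) $ i * \<psi> x)"
    by simp
qed

section \<open>The measure \<open>\<mu>\<^sub>2\<close> and the functional \<open>J\<close>\<close>

lemma one_plus_power2_norm: "0 < 1 + (norm y)\<^sup>2"
  by (rule add_pos_nonneg) auto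

lemma mu2_pos: "mu2 y > 0"
  using one_plus_power2_norm[of y] by (simp add: mu2_def)

lemma mu2_continuous: "continuous_on A mu2"
  unfolding mu2_def[abs_def]
  by (intro continuous_intros) (auto simp: add_nonneg_eq_0_iff)

lemma mu2_measurable [measurable]: "mu2 \<in> borel_measurable lebesgue" "mu2 \<in> borel_measurable borel"
proof -
  show "mu2 \<in> borel_measurable borel" by (intro borel_measurable_continuous_onI mu2_continuous)
  then show "mu2 \<in> borel_measurable lebesgue" by (simp add: measurable_completion)
qed

lemma mu2_le_1: "mu2 y \<le> 1"
proof -
  have "1 \<le> 1 + (norm y)\<^sup>2" by simp
  then have "1 * 1 \<le> pi * (1 + (norm y)\<^sup>2)\<^sup>2"
    using pi_gt3 by (intro mult_mono) (auto intro: one_le_power)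
  then show ?thesis by (simp add: mu2_def divide_le_eq)
qed

text \<open>With the squared radius as parameter the annulus has area \<open>pi * (t - s)\<close>.
  The density decreases with the radius, so its values on the two bounding circles enclose the
  mass.\<close>

lemma mu2_integral_annulus:
  assumes "0 \<le> s" "s \<le> t"
  defines "G \<equiv> \<lambda>s. LINT y:ball 0 (sqrt s)|lebesgue. mu2 y"
  shows "(t - s) / (1 + t)\<^sup>2 \<le> G t - G s" "G t - G s \<le> (t - s) / (1 + s)\<^sup>2"
proof -
  define A :: "(real ^ 2) set" where "A = ball 0 (sqrt t) - ball 0 (sqrt s)"
  have sub: "ball 0 (sqrt s) \<subseteq> (ball 0 (sqrt t) :: (real ^ 2) set)" using assms by (intro subset_ball) auto
  have i: "set_integrable lebesgue S mu2" if "S \<in> sets borel" "bounded S" for S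
    using that by (intro set_integrable_continuous mu2_continuous)
  have A: "A \<in> sets borel" "bounded A" unfolding A_def by (auto intro: bounded_subset[OF bounded_ball])
  have "G t = (LINT y:ball 0 (sqrt s) \<union> A|lebesgue. mu2 y)"
    using sub by (simp add: G_def A_def Un_absorb1)
  also have "\<dots> = G s + (LINT y:A|lebesgue. mu2 y)"
    unfolding G_def by (rule set_integral_Un) (use i A in \<open>auto simp: A_def\<close>)
  finally have G: "G t - G s = (LINT y:A|lebesgue. mu2 y)" by simp
  have vol: "measure lebesgue (ball 0 (sqrt r) :: (real ^ 2) set) = pi * r" if "r \<ge> 0" for r
    using that content_ball[of "sqrt r" "0 :: real ^ 2"] by (simp add: unit_ball_vol_2)
  have mA: "measure lebesgue A = pi * (t - s)"
    unfolding A_def using sub vol[of t] vol[of s] assms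
    by (subst measurable_measure_Diff) (auto simp: right_diff_distrib)
  have cA: "set_integrable lebesgue A (\<lambda>_. c)" "(LINT y:A|lebesgue. c) = c * (pi * (t - s))" for c :: real
  proof -
    show "set_integrable lebesgue A (\<lambda>_. c)" using A by (intro set_integrable_continuous) auto
    show "(LINT y:A|lebesgue. c) = c * (pi * (t - s))"
      using A mA by (simp add: set_lebesgue_integral_def)
  qed
  have e: "1 / (pi * X) * (pi * (t - s)) = (t - s) / X" for X by simp
  have "(LINT y:A|lebesgue. 1 / (pi * (1 + t)\<^sup>2)) \<le> (LINT y:A|lebesgue. mu2 y)"
  proof (rule set_integral_mono[OF cA(1) i[OF A]])
    fix y assume "y \<in> A"
    then have "norm y \<le> sqrt t" by (simp add: A_def)
    then have "(norm y)\<^sup>2 \<le> t" using assms power_mono[of "norm y" "sqrt t" 2] by simp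
    then show "1 / (pi * (1 + t)\<^sup>2) \<le> mu2 y"
      unfolding mu2_def using assms one_plus_power2_norm[of y]
      by (intro divide_left_mono mult_left_mono power_mono mult_pos_pos zero_less_power) auto
  qed
  then show "(t - s) / (1 + t)\<^sup>2 \<le> G t - G s" unfolding G cA(2) e .
  have "(LINT y:A|lebesgue. mu2 y) \<le> (LINT y:A|lebesgue. 1 / (pi * (1 + s)\<^sup>2))"
  proof (rule set_integral_mono[OF i[OF A] cA(1)])
    fix y assume "y \<in> A"
    then have "sqrt s \<le> norm y" by (simp add: A_def)
    then have "s \<le> (norm y)\<^sup>2" using assms power_mono[of "sqrt s" "norm y" 2] by simp
    then show "mu2 y \<le> 1 / (pi * (1 + s)\<^sup>2)"
      unfolding mu2_def using assms one_plus_power2_norm[of y]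
      by (intro divide_left_mono mult_left_mono power_mono mult_pos_pos zero_less_power) auto
  qed
  then show "G t - G s \<le> (t - s) / (1 + s)\<^sup>2" unfolding G cA(2) e .
qed

text \<open>Both sides, as functions of \<open>R\<^sup>2\<close>, have increments trapped in the same interval of
  quadratically small length, so their difference has derivative zero.\<close>

lemma theta_eq:
  assumes "R \<ge> 0"
  shows "theta R = R\<^sup>2 / (1 + R\<^sup>2)"
proof -
  define G where "G s = (LINT y:ball 0 (sqrt s)|lebesgue. mu2 y)" for s
  define D where "D s = G s - (1 - 1 / (1 + s))" for s
  have D: "\<bar>D t - D s\<bar> \<le> 2 * (t - s)\<^sup>2" if st: "0 \<le> s" "s \<le> t" for s t
  proof -
    define a b where "a = 1 / (1 + s)" and "b = 1 / (1 + t)"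
    have ab: "0 \<le> b" "b \<le> a" "a \<le> 1" using st by (auto simp: a_def b_def field_simps)
    \<comment> \<open>The increment of \<open>1 - 1 / (1 + s)\<close> is exactly
      \<open>(t - s) * (a * b)\<close>, the geometric mean of the two annulus bounds.\<close>
    have amb: "a - b = (t - s) * (a * b)" using st by (simp add: a_def b_def field_simps)
    have e: "D t - D s = (G t - G s) - (t - s) * (a * b)" using amb by (simp add: D_def a_def b_def)
    have "(t - s) * (b * b) \<le> G t - G s" "G t - G s \<le> (t - s) * (a * a)"
      using mu2_integral_annulus[OF st] by (auto simp: G_def a_def b_def power2_eq_square)
    moreover have "(t - s) * (b * b) \<le> (t - s) * (a * b)" "(t - s) * (a * b) \<le> (t - s) * (a * a)"
      using st ab by (auto intro!: mult_left_mono mult_right_mono)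
    ultimately have "\<bar>D t - D s\<bar> \<le> (t - s) * (a * a) - (t - s) * (b * b)" unfolding e by linarith
    also have "\<dots> = (t - s) * ((a - b) * (a + b))" by (simp add: algebra_simps)
    also have "\<dots> \<le> (t - s) * ((t - s) * 2)"
    proof (intro mult_left_mono mult_mono)
      have "a * b \<le> 1 * 1" using ab by (intro mult_mono) auto
      then show "a - b \<le> t - s" unfolding amb using st mult_left_mono[of "a * b" 1 "t - s"] by simp
    qed (use ab st in auto)
    also have "\<dots> = 2 * (t - s)\<^sup>2" by (simp add: power2_eq_square)
    finally show ?thesis .
  qed
  have D': "\<bar>D t - D s\<bar> \<le> 2 * (t - s)\<^sup>2" if "0 \<le> s" "0 \<le> t" for s t
    using D[of s t] D[of t s] that by (cases "s \<le> t") (auto simp: abs_minus_commute power2_commute)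
  have "(D has_field_derivative 0) (at s within {0..})" if s: "s \<in> {0..}" for s
    unfolding has_field_derivative_iff
  proof (rule Lim_null_comparison)
    show "\<forall>\<^sub>F t in at s within {0..}. norm ((D t - D s) / (t - s)) \<le> 2 * \<bar>t - s\<bar>"
      unfolding eventually_at_topological
    proof (intro exI[of _ UNIV] conjI ballI impI)
      fix t assume "t \<noteq> s" "t \<in> {0..}"
      then show "norm ((D t - D s) / (t - s)) \<le> 2 * \<bar>t - s\<bar>"
        using D'[of s t] s by (simp add: abs_divide divide_le_eq power2_eq_square abs_mult_self_eq flip: abs_mult)
    qed auto
    have "((\<lambda>t. 2 * \<bar>t - s\<bar>) \<longlongrightarrow> 2 * \<bar>s - s\<bar>) (at s within {0..})"
      by (intro tendsto_intros)
    then show "((\<lambda>t. 2 * \<bar>t - s\<bar>) \<longlongrightarrow> 0) (at s within {0..})" by simp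
  qed
  then obtain c where "\<And>s. s \<in> {0..} \<Longrightarrow> D s = c"
    using has_field_derivative_zero_constant[of "{0..}" D] by (auto simp: convex_real_interval)
  then have "D (R\<^sup>2) = D 0" by simp
  also have "D 0 = 0" by (simp add: D_def G_def set_lebesgue_integral_def)
  finally have "theta R = 1 - 1 / (1 + R\<^sup>2)"
    using assms by (simp add: D_def G_def theta_def)
  also have "\<dots> = R\<^sup>2 / (1 + R\<^sup>2)"
    by (simp add: field_simps add_nonneg_eq_0_iff)
  finally show ?thesis .
qed

text \<open>The total mass is the limit of \<open>theta\<close> along integer radii, known from
  \<open>theta_eq\<close>; monotone convergence yields integrability and value together.\<close>

lemma mu2_prob_density: "mu2 \<in> prob_densities"
proof -
  let ?F = "\<lambda>n x. indicator (ball 0 (real n)) x * mu2 x"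
  have int: "integrable lebesgue (?F n)" for n
    using set_integrable_continuous[OF mu2_continuous, of "ball 0 (real n)"] by (simp add: set_integrable_def)
  have mono: "mono (\<lambda>n. ?F n x)" for x :: "real ^ 2"
    using mu2_pos[of x] by (intro monoI mult_right_mono) (auto simp: indicator_def)
  have conv: "(\<lambda>n. ?F n x) \<longlonglongrightarrow> mu2 x" for x :: "real ^ 2"
  proof (rule tendsto_eventually)
    obtain N where "norm x < real N" using reals_Archimedean2 by blast
    then show "\<forall>\<^sub>F n in sequentially. ?F n x = mu2 x"
      by (auto simp: eventually_sequentially intro!: exI[of _ N])
  qed
  have "(LINT x|lebesgue. ?F n x) = theta (real n)" for n
    by (simp add: theta_def set_lebesgue_integral_def)
  then have "(LINT x|lebesgue. ?F n x) = (real n)\<^sup>2 / (1 + (real n)\<^sup>2)" for n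
    using theta_eq[of "real n"] by simp
  moreover have "(\<lambda>n. (real n)\<^sup>2 / (1 + (real n)\<^sup>2)) \<longlonglongrightarrow> 1"
    by real_asymp
  ultimately have lim: "(\<lambda>n. LINT x|lebesgue. ?F n x) \<longlonglongrightarrow> 1" by simp
  have "has_bochner_integral lebesgue mu2 1"
    by (intro has_bochner_integral_monotone_convergence[where f="?F"] AE_I2 int mono conv lim)
      (auto intro: mu2_measurable)
  then show ?thesis
    using mu2_pos mu2_measurable(1) by (auto simp: prob_densities_def has_bochner_integral_iff less_imp_le)
qed

lemma mu2_J_admissible: "mu2 \<in> J_admissible R"
  using mu2_prob_density by (simp add: J_admissible_def theta_def)

lemma sqrt_mu2: "sqrt (mu2 y) = 1 / (sqrt pi * (1 + (norm y)\<^sup>2))"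
  by (simp add: mu2_def real_sqrt_divide real_sqrt_mult add_nonneg_nonneg)

text \<open>Concavity of the square root, evaluated along the tangent at \<open>\<mu>\<^sub>2\<close>.\<close>

lemma J_le:
  assumes "\<rho> \<in> J_admissible R"
  shows "J_fun R \<rho> \<le> J_fun R mu2"
proof -
  let ?B = "ball (0 :: real ^ 2) R"
  have \<rho>: "\<rho> \<in> borel_measurable lebesgue" "\<And>x. 0 \<le> \<rho> x" "integrable lebesgue \<rho>"
    "(LINT y:?B|lebesgue. \<rho> y) = theta R"
    using assms by (auto simp: J_admissible_def prob_densities_def)
  have B: "?B \<in> sets lebesgue" "?B \<in> sets borel" by auto
  have i\<rho>: "set_integrable lebesgue ?B \<rho>"
    unfolding set_integrable_def by (rule integrable_mult_indicator[OF B(1) \<rho>(3)])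
  have ic: "set_integrable lebesgue ?B F" if "continuous_on UNIV F" for F :: "real ^ 2 \<Rightarrow> real"
    using that by (intro set_integrable_continuous) auto
  have i1: "set_integrable lebesgue ?B (\<lambda>y. sqrt (\<rho> y))"
    unfolding set_integrable_def
  proof (rule Bochner_Integration.integrable_bound)
    show "integrable lebesgue (\<lambda>y. indicator ?B y *\<^sub>R (1 + \<rho> y))"
      using set_integral_add(1)[OF ic[of "\<lambda>_. 1"] i\<rho>] by (simp add: set_integrable_def)
    show "(\<lambda>y. indicator ?B y *\<^sub>R sqrt (\<rho> y)) \<in> borel_measurable lebesgue"
      using \<rho>(1) B by measurable
    have "sqrt t \<le> 1 + t" if "t \<ge> 0" for t :: real
      using that by (intro real_le_lsqrt) (auto simp: power2_eq_square algebra_simps)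
    then show "AE y in lebesgue. norm (indicator ?B y *\<^sub>R sqrt (\<rho> y)) \<le> norm (indicator ?B y *\<^sub>R (1 + \<rho> y))"
      using \<rho>(2) by (intro AE_I2) (auto simp: indicator_def)
  qed
  have i2: "set_integrable lebesgue ?B (\<lambda>y. (norm y)\<^sup>2 * \<rho> y)"
    unfolding set_integrable_def
  proof (rule Bochner_Integration.integrable_bound)
    show "integrable lebesgue (\<lambda>y. R\<^sup>2 * (indicator ?B y *\<^sub>R \<rho> y))"
      using i\<rho> by (simp add: set_integrable_def)
    have "(\<lambda>y::real ^ 2. (norm y)\<^sup>2) \<in> borel_measurable lebesgue"
      by (intro measurable_completion) simp
    then show "(\<lambda>y. indicator ?B y *\<^sub>R ((norm y)\<^sup>2 * \<rho> y)) \<in> borel_measurable lebesgue"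
      using \<rho>(1) B by measurable
    show "AE y in lebesgue. norm (indicator ?B y *\<^sub>R ((norm y)\<^sup>2 * \<rho> y)) \<le> norm (R\<^sup>2 * (indicator ?B y *\<^sub>R \<rho> y))"
      using \<rho>(2) by (intro AE_I2) (auto simp: indicator_def abs_mult intro!: mult_right_mono power_mono)
  qed
  have i3: "set_integrable lebesgue ?B (\<lambda>y. sqrt (mu2 y))" "set_integrable lebesgue ?B (\<lambda>y. (norm y)\<^sup>2 * mu2 y)" "set_integrable lebesgue ?B mu2"
    by (intro ic continuous_intros mu2_continuous)+
  have J: "J_fun R f = (LINT y:?B|lebesgue. 2 / sqrt pi * sqrt (f y) - (norm y)\<^sup>2 * f y)"
    if "set_integrable lebesgue ?B (\<lambda>y. sqrt (f y))" "set_integrable lebesgue ?B (\<lambda>y. (norm y)\<^sup>2 * f y)" for f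
    unfolding J_fun_def using that by (subst set_integral_diff) auto
  have "J_fun R \<rho> - J_fun R mu2 = (LINT y:?B|lebesgue. (2 / sqrt pi * sqrt (\<rho> y) - (norm y)\<^sup>2 * \<rho> y) - (2 / sqrt pi * sqrt (mu2 y) - (norm y)\<^sup>2 * mu2 y))"
    unfolding J[OF i1 i2] J[OF i3(1,2)]
    by (intro set_integral_diff(2)[symmetric] set_integral_diff(1) set_integrable_mult_right i1 i2 i3)
  \<comment> \<open>At \<open>mu2\<close> the slope of the integrand of \<open>J_fun\<close> is
    \<open>(1 + (norm y)\<^sup>2) - (norm y)\<^sup>2 = 1\<close>. Being constant, it acts as a
    Lagrange multiplier for the mass constraint, and the right side integrates to zero. The
    pointwise gap is exactly \<open>q * (a - b)\<^sup>2\<close> in the notation below.\<close>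
  also have "\<dots> \<le> (LINT y:?B|lebesgue. \<rho> y - mu2 y)"
  proof (rule set_integral_mono)
    show "set_integrable lebesgue ?B (\<lambda>y. (2 / sqrt pi * sqrt (\<rho> y) - (norm y)\<^sup>2 * \<rho> y) - (2 / sqrt pi * sqrt (mu2 y) - (norm y)\<^sup>2 * mu2 y))"
      by (intro set_integral_diff(1) set_integrable_mult_right i1 i2 i3)
    show "set_integrable lebesgue ?B (\<lambda>y. \<rho> y - mu2 y)" by (intro set_integral_diff(1) i\<rho> i3)
    fix y
    define a b q where "a = sqrt (\<rho> y)" and "b = sqrt (mu2 y)" and "q = 1 + (norm y)\<^sup>2"
    have q: "q > 0" by (simp add: q_def add_pos_nonneg)
    have sq: "\<rho> y = a\<^sup>2" "mu2 y = b\<^sup>2" using \<rho>(2)[of y] mu2_pos[of y] by (auto simp: a_def b_def)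
    have "1 / sqrt pi = q * b" using q by (simp add: b_def sqrt_mu2 q_def[symmetric])
    then have p: "2 / sqrt pi = 2 * q * b" by simp
    have "0 \<le> q * (a - b)\<^sup>2" using q by simp
    then show "(2 / sqrt pi * sqrt (\<rho> y) - (norm y)\<^sup>2 * \<rho> y) - (2 / sqrt pi * sqrt (mu2 y) - (norm y)\<^sup>2 * mu2 y) \<le> \<rho> y - mu2 y"
      unfolding p a_def[symmetric] b_def[symmetric] unfolding sq by (simp add: q_def power2_eq_square algebra_simps)
  qed
  also have "\<dots> = 0"
    using \<rho>(4) by (subst set_integral_diff(2)[OF i\<rho> i3(3)]) (simp add: theta_def)
  finally show ?thesis by simp
qed

section \<open>The Onofri inequality on the disc\<close>

text \<open>The truncation \<open>t \<mapsto> t - ln ((1 + \<delta> e\<^sup>t) / (1 + \<delta>))\<close> is a contraction fixing \<open>0\<close> whose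
  exponential is bounded and Lipschitz, and it tends to the identity as \<open>\<delta> \<rightarrow> 0\<close>.\<close>

definition trunc :: "real \<Rightarrow> real \<Rightarrow> real"
  where "trunc \<delta> t = t + ln (1 + \<delta>) - ln (1 + \<delta> * exp t)"

lemma trunc_0 [simp]: "trunc \<delta> 0 = 0"
  by (simp add: trunc_def)

lemma trunc_deriv:
  assumes "\<delta> > 0"
  shows "(trunc \<delta> has_real_derivative 1 / (1 + \<delta> * exp t)) (at t)"
proof -
  have p: "1 + \<delta> * exp t > 0" using assms by (simp add: add_pos_pos)
  have "(trunc \<delta> has_real_derivative 1 - \<delta> * exp t / (1 + \<delta> * exp t)) (at t)"
    unfolding trunc_def[abs_def] using p by (auto intro!: derivative_eq_intros)
  moreover have "1 - \<delta> * exp t / (1 + \<delta> * exp t) = 1 / (1 + \<delta> * exp t)"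
    using p by (simp add: field_simps)
  ultimately show ?thesis by simp
qed

lemma trunc_deriv_bounds:
  fixes \<delta> t :: real
  assumes "\<delta> > 0"
  shows "0 \<le> 1 / (1 + \<delta> * exp t)" "1 / (1 + \<delta> * exp t) \<le> 1"
proof -
  have "\<delta> * exp t > 0" using assms by simp
  then show "0 \<le> 1 / (1 + \<delta> * exp t)" "1 / (1 + \<delta> * exp t) \<le> 1"
    by (simp_all add: divide_le_eq)
qed

lemma trunc_lipschitz:
  assumes "\<delta> > 0"
  shows "\<bar>trunc \<delta> s - trunc \<delta> t\<bar> \<le> \<bar>s - t\<bar>"
  using field_differentiable_bound[of UNIV "trunc \<delta>" "\<lambda>t. 1 / (1 + \<delta> * exp t)" 1 s t]
    trunc_deriv[OF assms] trunc_deriv_bounds[OF assms] by simp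

lemma exp_trunc:
  assumes "\<delta> > 0"
  shows "exp (trunc \<delta> t) = (1 + \<delta>) * exp t / (1 + \<delta> * exp t)"
  using assms by (simp add: trunc_def exp_add exp_diff add_pos_pos)

text \<open>For \<delta> at most 1 this gives the majorant \<open>2 * exp t\<close> under which
  \<delta> tends to 0; its integrability is part of the admissibility of \<open>u\<close>.\<close>

lemma exp_trunc_le:
  assumes "\<delta> > 0"
  shows "exp (trunc \<delta> t) \<le> (1 + \<delta>) * exp t"
proof -
  have "(1 + \<delta>) * exp t \<le> (1 + \<delta>) * exp t * (1 + \<delta> * exp t)"
    using assms by simp
  moreover have "1 + \<delta> * exp t > 0" using assms by (simp add: add_pos_pos)
  ultimately show ?thesis unfolding exp_trunc[OF assms] by (simp add: divide_le_eq)
qed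

text \<open>With \<open>x = \<delta> * exp t\<close> the derivative is
  \<open>(1 + \<delta>) / \<delta>\<close> times the bounded factor
  \<open>x / (1 + x)\<^sup>2\<close>. The constant blows up as \<delta> tends to 0, so the
  approximating sequence has to reach its limit before \<delta> does.\<close>

lemma exp_trunc_lipschitz:
  assumes "\<delta> > 0"
  shows "\<bar>exp (trunc \<delta> s) - exp (trunc \<delta> t)\<bar> \<le> (1 + \<delta>) / \<delta> * \<bar>s - t\<bar>"
proof -
  have b: "\<bar>exp (trunc \<delta> t) * (1 / (1 + \<delta> * exp t))\<bar> \<le> (1 + \<delta>) / \<delta>" for t
  proof -
    define x where "x = \<delta> * exp t"
    have x: "x > 0" using assms by (simp add: x_def)
    have "exp (trunc \<delta> t) * (1 / (1 + \<delta> * exp t)) = (1 + \<delta>) / \<delta> * (x / (1 + x)\<^sup>2)"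
      using assms unfolding exp_trunc[OF assms] x_def by (simp add: power2_eq_square)
    moreover have "x / (1 + x)\<^sup>2 \<le> 1" using x by (simp add: power2_eq_square divide_le_eq algebra_simps)
    moreover have "0 \<le> (1 + \<delta>) / \<delta> * (x / (1 + x)\<^sup>2)" using x assms by simp
    ultimately show ?thesis
      using assms mult_left_mono[of "x / (1 + x)\<^sup>2" 1 "(1 + \<delta>) / \<delta>"] by simp
  qed
  have "((\<lambda>t. exp (trunc \<delta> t)) has_real_derivative exp (trunc \<delta> t) * (1 / (1 + \<delta> * exp t))) (at t)" for t
    by (rule DERIV_fun_exp[OF trunc_deriv[OF assms]])
  then show ?thesis
    using field_differentiable_bound[of UNIV "\<lambda>t. exp (trunc \<delta> t)" "\<lambda>t. exp (trunc \<delta> t) * (1 / (1 + \<delta> * exp t))" "(1 + \<delta>) / \<delta>" s t] b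
    by simp
qed

lemma trunc_tendsto: "((\<lambda>\<delta>. trunc \<delta> t) \<longlongrightarrow> t) (at_right 0)"
proof -
  have "((\<lambda>\<delta>. trunc \<delta> t) \<longlongrightarrow> t + ln (1 + 0) - ln (1 + 0 * exp t)) (at_right 0)"
    unfolding trunc_def by (intro tendsto_intros) auto
  then show ?thesis by simp
qed

lemma set_integrable_mu2_mult:
  fixes F :: "real ^ 2 \<Rightarrow> real"
  assumes "continuous_on UNIV F"
  shows "set_integrable lebesgue (ball 0 R) (\<lambda>x. F x * mu2 x)"
  by (rule set_integrable_continuous) (auto intro!: continuous_on_mult assms mu2_continuous)

text \<open>The constants are chosen before \<phi> and \<delta>, so they survive both limits.
  \<open>W\<close> is the mass of the square rather than \<open>theta R\<close>: the truncated
  function vanishes off the disc, and the excess of its exponential over 1, integrated over the disc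
  alone, determines the mass ratio \<open>c\<close>.\<close>

lemma onofri_test:
  assumes R: "R > 0"
  obtains A M W :: real where "W > 0"
    "\<And>\<phi> \<delta> c. \<phi> \<in> test_functions (ball 0 R) \<Longrightarrow> \<delta> > 0 \<Longrightarrow>
      c = 1 + (LINT x:ball 0 R|lebesgue. (exp (trunc \<delta> (\<phi> x)) - 1) * mu2 x) / W \<Longrightarrow>
      A * (sqrt c - 1) - M * (c - 1) \<le>
        1 / (16 * pi) * (LINT x:ball 0 R|lebesgue. (norm (\<chi> i. partial i \<phi> x))\<^sup>2) +
        (LINT x:ball 0 R|lebesgue. trunc \<delta> (\<phi> x) * mu2 x)"
proof -
  define q where "q x y = 1 + x\<^sup>2 + y\<^sup>2" for x y :: real
  define I where "I F = integral {-R..R} (\<lambda>x. integral {-R..R} (F x))" for F :: "real \<Rightarrow> real \<Rightarrow> real"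
  define s2 where "s2 x y = (1 / (sqrt pi * q x y))\<^sup>2" for x y
  define A where "A = I (\<lambda>x y. 1 / (sqrt pi * q x y))"
  define M where "M = I (\<lambda>x y. (x\<^sup>2 + y\<^sup>2) * s2 x y)"
  define W where "W = I s2"
  have s2_mu2: "s2 x y = mu2 (vec2 x y)" for x y
    by (simp add: s2_def q_def mu2_def norm_vec2 power_mult_distrib power_divide add.assoc)
  have s2_pos: "s2 x y > 0" for x y unfolding s2_mu2 by (rule mu2_pos)
  have vc: "continuous_on UNIV (\<lambda>z. F (vec2 (fst z) (snd z)))" if "continuous_on UNIV F" for F :: "real ^ 2 \<Rightarrow> real"
    by (intro continuous_on_compose2[OF that] continuous_intros) auto
  have s2c: "continuous_on UNIV (\<lambda>z. s2 (fst z) (snd z))"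
    unfolding s2_mu2 by (rule vc[OF mu2_continuous])
  have W: "W > 0"
  proof -
    show ?thesis unfolding W_def I_def using R
      by (intro integral_pos continuous_marginal[OF s2c] continuous_fibre[OF s2c] s2_pos) auto
  qed
  show ?thesis
  \<comment> \<open>Dividing \<open>onofri_square\<close> by \<open>sqrt pi / 2\<close> normalises
    its right side to the form of \<open>I_fun\<close>; this rescales \<open>A\<close> and cancels
    the factor in front of \<open>M\<close>.\<close>
  proof (rule that[OF W, of "2 / sqrt pi * A" M])
    fix \<phi> \<delta> c
    assume \<phi>: "\<phi> \<in> test_functions (ball 0 R)" and \<delta>: "\<delta> > (0::real)"
      and c: "c = 1 + (LINT x:ball 0 R|lebesgue. (exp (trunc \<delta> (\<phi> x)) - 1) * mu2 x) / W"
    define h where "h x = trunc \<delta> (\<phi> x)" for x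
    define g' where "g' x = 1 / (1 + \<delta> * exp (\<phi> x))" for x
    define H where "H x y = h (vec2 x y)" for x y
    define H1 where "H1 x y = g' (vec2 x y) * partial 1 \<phi> (vec2 x y)" for x y
    define H2 where "H2 x y = g' (vec2 x y) * partial 2 \<phi> (vec2 x y)" for x y
    note \<phi>c = test_functionsD(2)[OF \<phi>, of UNIV]
    have tc: "continuous_on UNIV (trunc \<delta>)"
      by (meson DERIV_isCont trunc_deriv[OF \<delta>] continuous_at_imp_continuous_on)
    have hc: "continuous_on UNIV h" unfolding h_def[abs_def]
      by (rule continuous_on_compose2[OF tc \<phi>c]) auto
    have g'c: "continuous_on UNIV g'" unfolding g'_def[abs_def]
      using \<delta> by (intro continuous_intros \<phi>c) (auto simp: add_pos_pos less_imp_neq[symmetric] add_nonneg_eq_0_iff)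
    have h0: "h x = 0" if "x \<notin> ball 0 R" for x
      using test_functionsD(5)[OF \<phi> that] by (simp add: h_def)
    have d: "((\<lambda>x. H x y) has_real_derivative H1 x y) (at x)" "(H x has_real_derivative H2 x y) (at y)" for x y
      unfolding H_def[abs_def] h_def H1_def H2_def g'_def
      by (intro DERIV_chain2[OF trunc_deriv[OF \<delta>]] vec2_has_real_derivative test_functionsD(3)[OF \<phi>])+
    have Hc: "continuous_on UNIV (\<lambda>z. H (fst z) (snd z))" unfolding H_def by (rule vc[OF hc])
    have H1c: "continuous_on UNIV (\<lambda>z. H1 (fst z) (snd z))" "continuous_on UNIV (\<lambda>z. H2 (fst z) (snd z))"
      unfolding H1_def H2_def by (intro continuous_on_mult vc g'c test_functionsD(4)[OF \<phi>])+
    have bdry: "H R y = 0" "H (-R) y = 0" "H x R = 0" "H x (-R) = 0" for x y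
      unfolding H_def
      using R component_le_norm_cart[of "vec2 R y" 1] component_le_norm_cart[of "vec2 (-R) y" 1]
       component_le_norm_cart[of "vec2 x R" 2] component_le_norm_cart[of "vec2 x (-R)" 2]
      by (auto intro!: h0)
    have ball: "(LINT x:ball 0 R|lebesgue. F x) = I (\<lambda>x y. F (vec2 x y))"
      if "continuous_on UNIV F" "\<And>x. x \<notin> ball 0 R \<Longrightarrow> F x = 0" for F
      unfolding I_def by (rule integral_ball_iterated[OF that])
    have eq1: "(LINT x:ball 0 R|lebesgue. (exp (h x) - 1) * mu2 x) = I (\<lambda>x y. (exp (H x y) - 1) * s2 x y)"
      unfolding H_def s2_mu2 by (rule ball) (auto intro!: continuous_intros hc mu2_continuous simp: h0)
    have Ec: "continuous_on UNIV (\<lambda>z. (exp (H (fst z) (snd z)) - 1) * s2 (fst z) (snd z))"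
      by (intro continuous_intros Hc s2c)
    have "I (\<lambda>x y. 1 * ((exp (H x y) - 1) * s2 x y) + 1 * s2 x y) = 1 * I (\<lambda>x y. (exp (H x y) - 1) * s2 x y) + 1 * W"
      unfolding I_def W_def by (rule integral_lin2[OF Ec s2c])
    also have "\<dots> = c * W"
      unfolding eq1[symmetric] using W by (simp add: c h_def distrib_right)
    finally have "I (\<lambda>x y. 1 * ((exp (H x y) - 1) * s2 x y) + 1 * s2 x y) = c * W" .
    moreover have "1 * ((exp (H x y) - 1) * s2 x y) + 1 * s2 x y = exp (H x y) * s2 x y" for x y
      by (simp add: algebra_simps)
    ultimately have mass: "I (\<lambda>x y. exp (H x y) * s2 x y) = c * W" by (simp only:)
    have Xc: "continuous_on UNIV (\<lambda>z. exp (H (fst z) (snd z)) * s2 (fst z) (snd z))"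
      by (intro continuous_intros Hc s2c)
    \<comment> \<open>\<open>c\<close> is given by a formula, so its sign is read off the mass
      identity: the integral of a positive function equals \<open>c * W\<close>.\<close>
    have cpos: "c > 0"
    proof (rule ccontr)
      assume "\<not> c > 0"
      have "I (\<lambda>x y. exp (H x y) * s2 x y) > 0" unfolding I_def using R
        by (intro integral_pos continuous_marginal[OF Xc] continuous_fibre[OF Xc] mult_pos_pos s2_pos exp_gt_zero) auto
      then show False using mass W \<open>\<not> c > 0\<close> by (simp add: zero_less_mult_iff)
    qed
    have main: "(sqrt c - 1) * A - (c - 1) * (sqrt pi / 2) * M \<le>
      sqrt pi / 2 * (1 / (16 * pi) * I (\<lambda>x y. (H1 x y)\<^sup>2 + (H2 x y)\<^sup>2) + I (\<lambda>x y. H x y * s2 x y))"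
      unfolding A_def M_def I_def s2_def q_def
      by (rule onofri_square[OF R d Hc H1c bdry cpos])
        (use mass in \<open>simp add: I_def s2_def[abs_def] q_def W_def\<close>)
    have eq2: "I (\<lambda>x y. H x y * s2 x y) = (LINT x:ball 0 R|lebesgue. h x * mu2 x)"
      unfolding H_def s2_mu2 by (rule ball[symmetric]) (auto intro!: continuous_intros hc mu2_continuous simp: h0)
    have norm_grad: "(norm (\<chi> i. partial i \<phi> x))\<^sup>2 = (partial 1 \<phi> x)\<^sup>2 + (partial 2 \<phi> x)\<^sup>2" for x
      by (simp add: norm2_power2)
    have Dc: "continuous_on UNIV (\<lambda>x. (partial 1 \<phi> x)\<^sup>2 + (partial 2 \<phi> x)\<^sup>2)"
      by (intro continuous_intros test_functionsD(4)[OF \<phi>])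
    have "I (\<lambda>x y. (H1 x y)\<^sup>2 + (H2 x y)\<^sup>2) = (LINT x:ball 0 R|lebesgue. (g' x * partial 1 \<phi> x)\<^sup>2 + (g' x * partial 2 \<phi> x)\<^sup>2)"
      unfolding H1_def H2_def
      by (rule ball[symmetric]) (auto intro!: continuous_intros g'c test_functionsD(4)[OF \<phi>] simp: test_functionsD(6)[OF \<phi>])
    \<comment> \<open>The derivative of the truncation lies between 0 and 1, so the Dirichlet
      integral of \<phi> itself is an upper bound and \<delta> disappears from the gradient
      term.\<close>
    also have "\<dots> \<le> (LINT x:ball 0 R|lebesgue. (partial 1 \<phi> x)\<^sup>2 + (partial 2 \<phi> x)\<^sup>2)"
    proof (rule set_integral_mono)
      show "set_integrable lebesgue (ball 0 R) (\<lambda>x. (g' x * partial 1 \<phi> x)\<^sup>2 + (g' x * partial 2 \<phi> x)\<^sup>2)"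
        by (rule set_integrable_continuous) (auto intro!: continuous_intros g'c test_functionsD(4)[OF \<phi>])
      show "set_integrable lebesgue (ball 0 R) (\<lambda>x. (partial 1 \<phi> x)\<^sup>2 + (partial 2 \<phi> x)\<^sup>2)"
        by (rule set_integrable_continuous[OF Dc]) auto
      fix x
      have "(g' x)\<^sup>2 \<le> 1" using trunc_deriv_bounds[OF \<delta>, of "\<phi> x"] by (simp add: g'_def power_le_one)
      then show "(g' x * partial 1 \<phi> x)\<^sup>2 + (g' x * partial 2 \<phi> x)\<^sup>2 \<le> (partial 1 \<phi> x)\<^sup>2 + (partial 2 \<phi> x)\<^sup>2"
        unfolding power_mult_distrib by (intro add_mono mult_left_le_one_le) auto
    qed
    finally have le: "I (\<lambda>x y. (H1 x y)\<^sup>2 + (H2 x y)\<^sup>2) \<le> (LINT x:ball 0 R|lebesgue. (norm (\<chi> i. partial i \<phi> x))\<^sup>2)"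
      unfolding norm_grad .
    have "2 / sqrt pi * A * (sqrt c - 1) - M * (c - 1) = 2 / sqrt pi * ((sqrt c - 1) * A - (c - 1) * (sqrt pi / 2) * M)"
      by (simp add: field_simps)
    also have "\<dots> \<le> 2 / sqrt pi * (sqrt pi / 2 * (1 / (16 * pi) * I (\<lambda>x y. (H1 x y)\<^sup>2 + (H2 x y)\<^sup>2) + I (\<lambda>x y. H x y * s2 x y)))"
      by (intro mult_left_mono main) auto
    also have "\<dots> = 1 / (16 * pi) * I (\<lambda>x y. (H1 x y)\<^sup>2 + (H2 x y)\<^sup>2) + I (\<lambda>x y. H x y * s2 x y)" by simp
    also have "\<dots> \<le> 1 / (16 * pi) * (LINT x:ball 0 R|lebesgue. (norm (\<chi> i. partial i \<phi> x))\<^sup>2) + (LINT x:ball 0 R|lebesgue. h x * mu2 x)"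
      unfolding eq2 by (intro add_right_mono mult_left_mono le) auto
    finally show "2 / sqrt pi * A * (sqrt c - 1) - M * (c - 1) \<le> 1 / (16 * pi) * (LINT x:ball 0 R|lebesgue. (norm (\<chi> i. partial i \<phi> x))\<^sup>2) +
        (LINT x:ball 0 R|lebesgue. trunc \<delta> (\<phi> x) * mu2 x)" by (simp add: h_def)
  qed
qed

lemma borel_measurable_lebesgue_AE:
  fixes f g :: "'a :: euclidean_space \<Rightarrow> real"
  assumes "AE x in lebesgue. f x = g x" "g \<in> borel_measurable lebesgue"
  shows "f \<in> borel_measurable lebesgue"
proof (rule measurableI)
  fix A :: "real set" assume "A \<in> sets borel"
  then have "g -` A \<inter> space lebesgue \<in> sets lebesgue" using assms(2) by (rule measurable_sets[rotated])
  then show "f -` A \<inter> space lebesgue \<in> sets lebesgue"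
    by (rule completion.in_sets_AE[rotated]) (use assms(1) in \<open>auto elim: eventually_mono\<close>)
qed simp

text \<open>Completeness of Lebesgue measure makes the left integrand measurable because the right
  one is. The intended \<open>f\<close> comes from \<open>weak_gradient\<close>, an arbitrary choice
  about which nothing is known pointwise.\<close>

lemma set_integral_lebesgue_cong_AE:
  fixes f g :: "'a :: euclidean_space \<Rightarrow> real"
  assumes "AE x in lebesgue. x \<in> S \<longrightarrow> f x = g x" "set_borel_measurable lebesgue S g"
  shows "(LINT x:S|lebesgue. f x) = (LINT x:S|lebesgue. g x)"
proof -
  have ae: "AE x in lebesgue. indicator S x *\<^sub>R f x = indicator S x *\<^sub>R g x"
    using assms(1) by eventually_elim (auto simp: indicator_def)
  have g: "(\<lambda>x. indicator S x *\<^sub>R g x) \<in> borel_measurable lebesgue"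
    using assms(2) by (simp add: set_borel_measurable_def)
  show ?thesis
    unfolding set_lebesgue_integral_def
    by (rule integral_cong_AE[OF borel_measurable_lebesgue_AE[OF ae g] g ae])
qed

section \<open>Comparison of integrals and square-integrable functions\<close>

lemma set_integral_abs_le:
  fixes f g :: "'a \<Rightarrow> real"
  assumes "set_integrable M S f" "set_integrable M S g" "\<And>x. x \<in> S \<Longrightarrow> \<bar>f x\<bar> \<le> g x"
  shows "\<bar>LINT x:S|M. f x\<bar> \<le> (LINT x:S|M. g x)"
proof -
  have "(LINT x:S|M. f x) \<le> (LINT x:S|M. g x)"
    using assms by (intro set_integral_mono) force+
  moreover have "(LINT x:S|M. - f x) \<le> (LINT x:S|M. g x)"
  proof (rule set_integral_mono[OF _ assms(2)])
    show "set_integrable M S (\<lambda>x. - f x)" using assms(1) by (simp add: set_integrable_def)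
  qed (use assms(3) in force)
  moreover have "(LINT x:S|M. - f x) = - (LINT x:S|M. f x)"
    by (simp add: set_lebesgue_integral_def)
  ultimately show ?thesis by linarith
qed

lemma set_integrable_bounded_by:
  fixes f g :: "real ^ 'n \<Rightarrow> real"
  assumes "set_integrable lebesgue S g" "set_borel_measurable lebesgue S f" "\<And>x. x \<in> S \<Longrightarrow> \<bar>f x\<bar> \<le> g x"
  shows "set_integrable lebesgue S f"
  unfolding set_integrable_def
proof (rule Bochner_Integration.integrable_bound)
  show "integrable lebesgue (\<lambda>x. indicator S x *\<^sub>R g x)" using assms(1) by (simp add: set_integrable_def)
  show "(\<lambda>x. indicator S x *\<^sub>R f x) \<in> borel_measurable lebesgue" using assms(2) by (simp add: set_borel_measurable_def)
  show "AE x in lebesgue. norm (indicator S x *\<^sub>R f x) \<le> norm (indicator S x *\<^sub>R g x)"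
    using assms(3) by (intro AE_I2) (force simp: indicator_def)
qed

lemma L2_space_diff:
  assumes "f \<in> L2_space S" "g \<in> L2_space S"
  shows "(\<lambda>x. f x - g x) \<in> L2_space S"
proof -
  have m: "set_borel_measurable lebesgue S f" "set_borel_measurable lebesgue S g"
    and i: "set_integrable lebesgue S (\<lambda>x. (f x)\<^sup>2)" "set_integrable lebesgue S (\<lambda>x. (g x)\<^sup>2)"
    using assms by (auto simp: L2_space_def)
  have m1: "set_borel_measurable lebesgue S (\<lambda>x. f x - g x)"
    using m borel_measurable_diff unfolding set_borel_measurable_def scaleR_diff_right by blast
  then have "(\<lambda>x. (indicator S x *\<^sub>R (f x - g x))\<^sup>2) \<in> borel_measurable lebesgue"
    unfolding set_borel_measurable_def by (intro borel_measurable_power)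
  also have "(\<lambda>x. (indicator S x *\<^sub>R (f x - g x))\<^sup>2) = (\<lambda>x. indicator S x *\<^sub>R (f x - g x)\<^sup>2)"
    by (auto simp: indicator_def)
  finally have m2: "set_borel_measurable lebesgue S (\<lambda>x. (f x - g x)\<^sup>2)" by (simp add: set_borel_measurable_def)
  have "set_integrable lebesgue S (\<lambda>x. 2 * (f x)\<^sup>2 + 2 * (g x)\<^sup>2)"
    using i by (intro set_integral_add(1) set_integrable_mult_right) auto
  moreover have "\<bar>(f x - g x)\<^sup>2\<bar> \<le> 2 * (f x)\<^sup>2 + 2 * (g x)\<^sup>2" for x
    using zero_le_power2[of "f x + g x"] by (simp only: abs_power2) (simp add: power2_diff power2_sum)
  ultimately have "set_integrable lebesgue S (\<lambda>x. (f x - g x)\<^sup>2)"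
    by (rule set_integrable_bounded_by[OF _ m2])
  with m1 show ?thesis by (simp add: L2_space_def)
qed

lemma continuous_L2_space:
  fixes f :: "real ^ 'n \<Rightarrow> real"
  assumes "continuous_on UNIV f" "S \<in> sets borel" "bounded S"
  shows "f \<in> L2_space S"
proof -
  have "set_integrable lebesgue S f" "set_integrable lebesgue S (\<lambda>x. (f x)\<^sup>2)"
    using assms by (auto intro!: set_integrable_continuous continuous_intros)
  then show ?thesis
    by (auto simp: L2_space_def set_borel_measurable_def set_integrable_def)
qed

text \<open>A weighted Young inequality,
  \<open>\<bar>t\<bar> \<le> \<epsilon> + 1 / \<epsilon> * t\<^sup>2\<close>, on a set of finite
  measure: a small \<epsilon> controls the constant term, after which the square integrals tend to
  0.\<close>

lemma L2_tendsto_imp_L1_tendsto: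
  fixes d :: "nat \<Rightarrow> real ^ 'n \<Rightarrow> real"
  assumes S: "S \<in> sets borel" "bounded S" and d: "\<And>k. d k \<in> L2_space S"
    and lim: "(\<lambda>k. LINT x:S|lebesgue. (d k x)\<^sup>2) \<longlonglongrightarrow> 0"
  shows "(\<lambda>k. LINT x:S|lebesgue. \<bar>d k x\<bar>) \<longlonglongrightarrow> 0" "set_integrable lebesgue S (\<lambda>x. \<bar>d k x\<bar>)"
proof -
  have m: "set_borel_measurable lebesgue S (\<lambda>x. \<bar>d k x\<bar>)" for k
  proof -
    have "(\<lambda>x. \<bar>indicator S x *\<^sub>R d k x\<bar>) \<in> borel_measurable lebesgue"
      using d[of k] by (intro borel_measurable_abs) (simp add: L2_space_def set_borel_measurable_def)
    also have "(\<lambda>x. \<bar>indicator S x *\<^sub>R d k x\<bar>) = (\<lambda>x. indicator S x *\<^sub>R \<bar>d k x\<bar>)" by (auto simp: indicator_def)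
    finally show ?thesis by (simp add: set_borel_measurable_def)
  qed
  have i2: "set_integrable lebesgue S (\<lambda>x. (d k x)\<^sup>2)" for k using d[of k] by (simp add: L2_space_def)
  have ic: "set_integrable lebesgue S (\<lambda>_. c)" for c :: real
    using S by (intro set_integrable_continuous) auto
  have young: "\<bar>t\<bar> \<le> \<epsilon> + 1 / \<epsilon> * t\<^sup>2" if "\<epsilon> > 0" for t \<epsilon> :: real
  proof -
    have "0 \<le> (\<bar>t\<bar> - \<epsilon>)\<^sup>2" by simp
    then have "2 * (\<epsilon> * \<bar>t\<bar>) \<le> \<epsilon>\<^sup>2 + t\<^sup>2" by (simp add: power2_diff algebra_simps)
    moreover have "0 \<le> \<epsilon> * \<bar>t\<bar>" using that by simp
    moreover have "\<epsilon> * (\<epsilon> + 1 / \<epsilon> * t\<^sup>2) = \<epsilon>\<^sup>2 + t\<^sup>2" using that by (simp add: distrib_left power2_eq_square)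
    ultimately have "\<epsilon> * \<bar>t\<bar> \<le> \<epsilon> * (\<epsilon> + 1 / \<epsilon> * t\<^sup>2)" by linarith
    then show ?thesis using that by (simp only: mult_le_cancel_left_pos)
  qed
  have ib: "set_integrable lebesgue S (\<lambda>x. \<epsilon> + 1 / \<epsilon> * (d k x)\<^sup>2)" for \<epsilon> k
    by (intro set_integral_add(1) set_integrable_mult_right ic i2)
  have i1: "set_integrable lebesgue S (\<lambda>x. \<bar>d k x\<bar>)" for k
    by (rule set_integrable_bounded_by[OF ib[of 1] m]) (use young[of 1] in auto)
  then show "set_integrable lebesgue S (\<lambda>x. \<bar>d k x\<bar>)" .
  have le: "(LINT x:S|lebesgue. \<bar>d k x\<bar>) \<le> \<epsilon> * measure lebesgue S + 1 / \<epsilon> * (LINT x:S|lebesgue. (d k x)\<^sup>2)" if "\<epsilon> > 0" for \<epsilon> k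
  proof -
    have "(LINT x:S|lebesgue. \<bar>d k x\<bar>) \<le> (LINT x:S|lebesgue. \<epsilon> + 1 / \<epsilon> * (d k x)\<^sup>2)"
      using young[OF that] by (intro set_integral_mono i1 ib) auto
    also have "\<dots> = (LINT x:S|lebesgue. \<epsilon>) + (LINT x:S|lebesgue. 1 / \<epsilon> * (d k x)\<^sup>2)"
      by (intro set_integral_add(2) set_integrable_mult_right ic i2)
    also have "(LINT x:S|lebesgue. \<epsilon>) = \<epsilon> * measure lebesgue S"
      using S by (simp add: set_lebesgue_integral_def)
    finally show ?thesis by simp
  qed
  show "(\<lambda>k. LINT x:S|lebesgue. \<bar>d k x\<bar>) \<longlonglongrightarrow> 0"
  proof (rule tendstoI)
    fix e :: real assume e: "e > 0"
    define \<epsilon> where "\<epsilon> = e / 2 / (measure lebesgue S + 1)"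
    have mp: "measure lebesgue S + 1 > 0" by (simp add: add_nonneg_pos)
    have ep: "\<epsilon> > 0" using e mp by (simp add: \<epsilon>_def)
    have "\<epsilon> * measure lebesgue S \<le> \<epsilon> * (measure lebesgue S + 1)" using ep by simp
    also have "\<dots> = e / 2" unfolding \<epsilon>_def using mp by (metis less_irrefl nonzero_eq_divide_eq)
    finally have 1: "\<epsilon> * measure lebesgue S \<le> e / 2" .
    have "(\<lambda>k. 1 / \<epsilon> * (LINT x:S|lebesgue. (d k x)\<^sup>2)) \<longlonglongrightarrow> 1 / \<epsilon> * 0" by (intro tendsto_intros lim)
    then have "\<forall>\<^sub>F k in sequentially. 1 / \<epsilon> * (LINT x:S|lebesgue. (d k x)\<^sup>2) < e / 2"
      using e by (intro order_tendstoD(2)) auto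
    then show "\<forall>\<^sub>F k in sequentially. dist (LINT x:S|lebesgue. \<bar>d k x\<bar>) 0 < e"
    proof eventually_elim
      case (elim k)
      have "0 \<le> (LINT x:S|lebesgue. \<bar>d k x\<bar>)"
        by (simp add: set_lebesgue_integral_def integral_nonneg_AE)
      then show ?case using le[OF ep, of k] 1 elim unfolding dist_real_def by linarith
    qed
  qed
qed

text \<open>As \<open>mu2\<close> is at most 1, the two integrals differ by at most \<open>C\<close>
  times the L1 distance. The exponential itself is not Lipschitz; its composition with
  \<open>trunc \<delta>\<close> is.\<close>

lemma lipschitz_integral_tendsto:
  fixes \<phi> :: "nat \<Rightarrow> real ^ 2 \<Rightarrow> real"
  assumes f: "\<And>s t. \<bar>f s - f t\<bar> \<le> C * \<bar>s - t\<bar>" "continuous_on UNIV f"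
    and \<phi>: "\<And>k. continuous_on UNIV (\<phi> k)"
    and v: "v \<in> borel_measurable lebesgue" "set_integrable lebesgue (ball 0 R) v"
    and lim: "(\<lambda>k. LINT x:ball 0 R|lebesgue. \<bar>\<phi> k x - v x\<bar>) \<longlonglongrightarrow> 0"
    and int: "\<And>k. set_integrable lebesgue (ball 0 R) (\<lambda>x. \<bar>\<phi> k x - v x\<bar>)"
  shows "(\<lambda>k. LINT x:ball 0 R|lebesgue. f (\<phi> k x) * mu2 x) \<longlonglongrightarrow> (LINT x:ball 0 R|lebesgue. f (v x) * mu2 x)"
proof -
  have fb: "f \<in> borel_measurable borel" by (rule borel_measurable_continuous_onI[OF f(2)])
  have "(\<lambda>x. f (v x) * mu2 x) \<in> borel_measurable lebesgue"
    using v(1) fb by measurable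
  then have m: "set_borel_measurable lebesgue (ball 0 R) (\<lambda>x. f (v x) * mu2 x)"
    unfolding set_borel_measurable_def by (intro borel_measurable_scaleR borel_measurable_indicator) auto
  have C: "C \<ge> 0" using f(1)[of 1 0] by simp
  have bound: "\<bar>t * mu2 x\<bar> \<le> s" if "\<bar>t\<bar> \<le> s" for t s x
    using that mult_mono[of "\<bar>t\<bar>" s "mu2 x" 1] mu2_le_1[of x] mu2_pos[of x] by (simp add: abs_mult)
  have iv: "set_integrable lebesgue (ball 0 R) (\<lambda>x. f (v x) * mu2 x)"
  proof (rule set_integrable_bounded_by[OF _ m])
    show "set_integrable lebesgue (ball 0 R) (\<lambda>x. \<bar>f 0\<bar> + C * \<bar>v x\<bar>)"
      by (intro set_integral_add(1) set_integrable_mult_right set_integrable_abs v set_integrable_continuous) auto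
    fix x
    show "\<bar>f (v x) * mu2 x\<bar> \<le> \<bar>f 0\<bar> + C * \<bar>v x\<bar>"
      using f(1)[of "v x" 0] by (intro bound) auto
  qed
  have i\<phi>: "set_integrable lebesgue (ball 0 R) (\<lambda>x. f (\<phi> k x) * mu2 x)" for k
    by (rule set_integrable_mu2_mult) (rule continuous_on_compose2[OF f(2) \<phi>], auto)
  have "(\<lambda>k. (LINT x:ball 0 R|lebesgue. f (\<phi> k x) * mu2 x) - (LINT x:ball 0 R|lebesgue. f (v x) * mu2 x)) \<longlonglongrightarrow> 0"
  proof (rule Lim_null_comparison)
    show "(\<lambda>k. C * (LINT x:ball 0 R|lebesgue. \<bar>\<phi> k x - v x\<bar>)) \<longlonglongrightarrow> 0"
      using tendsto_mult_right_zero[OF lim] .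
    show "\<forall>\<^sub>F k in sequentially. norm ((LINT x:ball 0 R|lebesgue. f (\<phi> k x) * mu2 x) - (LINT x:ball 0 R|lebesgue. f (v x) * mu2 x)) \<le> C * (LINT x:ball 0 R|lebesgue. \<bar>\<phi> k x - v x\<bar>)"
    proof (rule always_eventually, rule allI)
      fix k
      have "\<bar>LINT x:ball 0 R|lebesgue. f (\<phi> k x) * mu2 x - f (v x) * mu2 x\<bar> \<le> (LINT x:ball 0 R|lebesgue. C * \<bar>\<phi> k x - v x\<bar>)"
      proof (rule set_integral_abs_le)
        show "set_integrable lebesgue (ball 0 R) (\<lambda>x. f (\<phi> k x) * mu2 x - f (v x) * mu2 x)"
          by (intro set_integral_diff(1) i\<phi> iv)
        show "set_integrable lebesgue (ball 0 R) (\<lambda>x. C * \<bar>\<phi> k x - v x\<bar>)"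
          by (intro set_integrable_mult_right int)
        show "\<bar>f (\<phi> k x) * mu2 x - f (v x) * mu2 x\<bar> \<le> C * \<bar>\<phi> k x - v x\<bar>" for x
          unfolding left_diff_distrib[symmetric] by (intro bound f(1))
      qed
      then show "norm ((LINT x:ball 0 R|lebesgue. f (\<phi> k x) * mu2 x) - (LINT x:ball 0 R|lebesgue. f (v x) * mu2 x)) \<le> C * (LINT x:ball 0 R|lebesgue. \<bar>\<phi> k x - v x\<bar>)"
        by (simp add: set_integral_diff(2)[OF i\<phi> iv])
    qed
  qed
  then show ?thesis by (simp add: LIM_zero_iff)
qed

text \<open>Triangle inequality with a free weight: the error \<open>p - w\<close> may carry a large
  factor because it vanishes in the limit, while the factor on \<open>w\<close> tends to 1 with
  \<eta>.\<close>

lemma norm_power2_le: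
  fixes p w :: "real ^ 'n"
  assumes "\<eta> > 0"
  shows "(norm p)\<^sup>2 \<le> (1 + \<eta>) * (norm w)\<^sup>2 + (1 + 1 / \<eta>) * (norm (p - w))\<^sup>2"
proof -
  define a b where "a = norm w" and "b = norm (p - w)"
  have "norm p \<le> a + b" using norm_triangle_ineq[of w "p - w"] by (simp add: a_def b_def)
  then have "(norm p)\<^sup>2 \<le> (a + b)\<^sup>2" by (intro power_mono) auto
  also have "\<dots> = a\<^sup>2 + b\<^sup>2 + 2 * a * b" by (simp add: power2_sum)
  also have "2 * a * b \<le> \<eta> * a\<^sup>2 + 1 / \<eta> * b\<^sup>2"
  proof -
    have "0 \<le> (\<eta> * a - b)\<^sup>2 / \<eta>" using assms by simp
    also have "\<dots> = \<eta> * a\<^sup>2 + 1 / \<eta> * b\<^sup>2 - 2 * a * b" using assms by (simp add: field_simps power2_eq_square)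
    finally show ?thesis by simp
  qed
  finally show ?thesis unfolding a_def[symmetric] b_def[symmetric] by (simp add: algebra_simps)
qed

section \<open>Evaluation of \<open>I_fun\<close> and its lower bound\<close>

lemma mu2_measure_integral:
  assumes "set_borel_measurable lebesgue S f"
  shows "(LINT x:S|mu2_measure. f x) = (LINT x:S|lebesgue. f x * mu2 x)"
    "set_integrable mu2_measure S f \<longleftrightarrow> set_integrable lebesgue S (\<lambda>x. f x * mu2 x)"
proof -
  have *: "mu2 x *\<^sub>R (indicator S x *\<^sub>R f x) = indicator S x *\<^sub>R (f x * mu2 x)" for x by simp
  have m: "(\<lambda>x. indicator S x *\<^sub>R f x) \<in> borel_measurable lebesgue"
    using assms by (simp add: set_borel_measurable_def)
  have nn: "AE x in lebesgue. 0 \<le> mu2 x" using mu2_pos by (auto intro: less_imp_le)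
  show "(LINT x:S|mu2_measure. f x) = (LINT x:S|lebesgue. f x * mu2 x)"
    unfolding set_lebesgue_integral_def mu2_measure_def
    using integral_density[OF m mu2_measurable(1) nn] by (simp only: *)
  show "set_integrable mu2_measure S f \<longleftrightarrow> set_integrable lebesgue S (\<lambda>x. f x * mu2 x)"
    unfolding set_integrable_def mu2_measure_def
    using integrable_density[OF m mu2_measurable(1) nn] by (simp only: *)
qed

lemma I_fun_eq:
  assumes "has_weak_gradient (ball 0 R) u w" "set_borel_measurable lebesgue (ball 0 R) (\<lambda>x. (norm (w x))\<^sup>2)"
    "set_borel_measurable lebesgue (ball 0 R) u"
  shows "I_fun R u = 1 / (16 * pi) * (LINT x:ball 0 R|lebesgue. (norm (w x))\<^sup>2) + (LINT x:ball 0 R|lebesgue. u x * mu2 x)"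
proof -
  have "(LINT x:ball 0 R|lebesgue. (norm (weak_gradient (ball 0 R) u x))\<^sup>2) = (LINT x:ball 0 R|lebesgue. (norm (w x))\<^sup>2)"
    using weak_gradient_AE[OF open_ball assms(1)]
    by (intro set_integral_lebesgue_cong_AE assms(2)) (auto elim: eventually_mono)
  then show ?thesis by (simp add: I_fun_def mu2_measure_integral(1)[OF assms(3)])
qed

lemma L2_norm_power2:
  fixes w :: "real ^ 2 \<Rightarrow> real ^ 2"
  assumes "\<And>i. (\<lambda>x. w x $ i) \<in> L2_space S"
  shows "set_integrable lebesgue S (\<lambda>x. (norm (w x))\<^sup>2)"
  unfolding norm2_power2 using assms by (intro set_integral_add(1)) (auto simp: L2_space_def)

lemma set_integrable_imp_set_borel_measurable:
  "set_integrable M S f \<Longrightarrow> set_borel_measurable M S f"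
  by (auto simp: set_integrable_def set_borel_measurable_def)

lemma zero_I_admissible:
  assumes "R > 0"
  shows "(\<lambda>x. 0) \<in> I_admissible R" "I_fun R (\<lambda>x. 0) = 0"
proof -
  have t: "(\<lambda>x::real ^ 2. 0::real) \<in> test_functions (ball 0 R)"
    by (simp add: test_functions_def C_k_const)
  have g: "has_weak_gradient (ball 0 R) (\<lambda>x::real ^ 2. 0::real) (\<lambda>x. 0)"
    using test_functions_weak_gradient[OF t assms] by (simp add: partial_const zero_vec_def)
  have z: "set_borel_measurable lebesgue S (\<lambda>x::real ^ 2. 0::real)" for S
    by (simp add: set_borel_measurable_def)
  have "(LINT x:ball 0 R|lebesgue. (norm (weak_gradient (ball 0 R) (\<lambda>x::real ^ 2. 0::real) x))\<^sup>2) = (LINT x:ball (0 :: real ^ 2) R|lebesgue. 0)"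
    using weak_gradient_AE[OF open_ball g]
    by (intro set_integral_lebesgue_cong_AE z) (auto elim: eventually_mono)
  then have "H1_norm (ball 0 R) (\<lambda>x::real ^ 2. 0 - 0 :: real) = 0" by (simp add: H1_norm_def)
  moreover have "(\<lambda>x. 0) \<in> H1 (ball (0 :: real ^ 2) R)"
    unfolding H1_def L2_space_def using g z by (auto simp: set_integrable_def intro!: exI[of _ "\<lambda>x. 0"])
  ultimately have h: "(\<lambda>x. 0) \<in> H1_0 (ball (0 :: real ^ 2) R)"
    unfolding H1_0_def using t by (auto intro!: exI[of _ "\<lambda>k x. 0"])
  have one: "set_borel_measurable lebesgue (ball 0 R) (\<lambda>x::real ^ 2. 1::real)"
    by (intro set_integrable_imp_set_borel_measurable set_integrable_continuous) auto
  have "set_integrable lebesgue (ball 0 R) mu2" by (intro set_integrable_continuous mu2_continuous) auto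
  then show "(\<lambda>x. 0) \<in> I_admissible R"
    using h mu2_measure_integral[OF one] by (simp add: I_admissible_def theta_def)
  show "I_fun R (\<lambda>x. 0) = 0"
    using I_fun_eq[OF g] z by simp
qed

text \<open>Three limits in a fixed order: the approximating sequence at fixed \<delta> and \<eta>,
  then \<eta> to 0 to recover the exact Dirichlet integral, and last \<delta> to 0 to recover
  \<open>u\<close> and its constraint.\<close>

lemma I_nonneg:
  assumes R: "R > 0" and u: "u \<in> I_admissible R"
  shows "I_fun R u \<ge> 0"
proof -
  define B where "B = ball (0 :: real ^ 2) R"
  have B: "B \<in> sets borel" "bounded B" "open B" "B \<in> sets lebesgue" by (auto simp: B_def)
  obtain \<phi> where \<phi>: "\<And>k. \<phi> k \<in> test_functions B" and lim: "(\<lambda>k. H1_norm B (\<lambda>x. \<phi> k x - u x)) \<longlonglongrightarrow> 0"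
    and uH: "u \<in> H1 B" and ue: "set_integrable mu2_measure B (\<lambda>x. exp (u x))"
      "(LINT x:B|mu2_measure. exp (u x)) = theta R"
    using u by (auto simp: I_admissible_def H1_0_def B_def)
  obtain w where uL: "u \<in> L2_space B" and w: "has_weak_gradient B u w" "\<And>i. (\<lambda>x. w x $ i) \<in> L2_space B"
    using uH by (auto simp: H1_def)
  \<comment> \<open>The values of \<open>u\<close> off the disc are arbitrary, so \<open>u\<close>
    need not be measurable on the plane. \<open>v\<close> is, and it has the same integrals over
    \<open>B\<close>.\<close>
  define v where "v x = indicator B x * u x" for x
  have vu: "v x = u x" if "x \<in> B" for x using that by (simp add: v_def)
  have um: "set_borel_measurable lebesgue B u" using uL by (simp add: L2_space_def)
  have vm: "v \<in> borel_measurable lebesgue" using um by (simp add: v_def[abs_def] set_borel_measurable_def)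
  have cong: "(LINT x:B|lebesgue. F (u x) x) = (LINT x:B|lebesgue. F (v x) x)" for F :: "real \<Rightarrow> real ^ 2 \<Rightarrow> real"
    by (rule set_lebesgue_integral_cong) (use B vu in auto)
  have icong: "set_integrable lebesgue B (\<lambda>x. F (u x) x) \<longleftrightarrow> set_integrable lebesgue B (\<lambda>x. F (v x) x)" for F :: "real \<Rightarrow> real ^ 2 \<Rightarrow> real"
    by (rule set_integrable_cong) (use vu in auto)
  have cont: "continuous_on UNIV (\<phi> k)" "continuous_on UNIV (partial i (\<phi> k))" for k i
    by (rule test_functionsD[OF \<phi>])+
  define d where "d k x = \<phi> k x - u x" for k x
  define G where "G k x = (\<chi> i. partial i (\<phi> k) x)" for k x
  define D where "D = (LINT x:B|lebesgue. (norm (w x))\<^sup>2)"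
  define b where "b k = (LINT x:B|lebesgue. (norm (G k x - w x))\<^sup>2)" for k
  have dL: "d k \<in> L2_space B" for k
    unfolding d_def[abs_def] by (intro L2_space_diff continuous_L2_space cont B uL)
  have GL: "(\<lambda>x. G k x $ i) \<in> L2_space B" for k i
    unfolding G_def by (simp add: continuous_L2_space cont B)
  have GwL: "(\<lambda>x. (G k x - w x) $ i) \<in> L2_space B" for k i
    using L2_space_diff[OF GL w(2)] by simp
  have iD: "set_integrable lebesgue B (\<lambda>x. (norm (w x))\<^sup>2)" by (rule L2_norm_power2[OF w(2)])
  have iG: "set_integrable lebesgue B (\<lambda>x. (norm (G k x))\<^sup>2)" for k by (rule L2_norm_power2[OF GL])
  have ib: "set_integrable lebesgue B (\<lambda>x. (norm (G k x - w x))\<^sup>2)" for k by (rule L2_norm_power2[OF GwL])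
  have wd: "has_weak_gradient B (d k) (\<lambda>x. G k x - w x)" for k
    unfolding d_def[abs_def] G_def
    by (rule has_weak_gradient_diff[OF _ w(1)]) (use test_functions_weak_gradient[OF _ R] \<phi> in \<open>auto simp: B_def\<close>)
  have "H1_norm B (d k) = sqrt ((LINT x:B|lebesgue. (d k x)\<^sup>2) + b k)" for k
  proof -
    have "(LINT x:B|lebesgue. (norm (weak_gradient B (d k) x))\<^sup>2) = b k"
      unfolding b_def using weak_gradient_AE[OF B(3) wd[of k]]
      by (intro set_integral_lebesgue_cong_AE set_integrable_imp_set_borel_measurable ib) (auto elim: eventually_mono)
    then show ?thesis by (simp add: H1_norm_def)
  qed
  moreover have a0: "0 \<le> (LINT x:B|lebesgue. (d k x)\<^sup>2)" and b0: "0 \<le> b k" for k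
    unfolding b_def set_lebesgue_integral_def by (rule integral_nonneg_AE; simp)+
  ultimately have "(\<lambda>k. (sqrt ((LINT x:B|lebesgue. (d k x)\<^sup>2) + b k))\<^sup>2) \<longlonglongrightarrow> 0\<^sup>2"
    using lim unfolding d_def[symmetric] by (intro tendsto_power) simp
  then have ab: "(\<lambda>k. (LINT x:B|lebesgue. (d k x)\<^sup>2) + b k) \<longlonglongrightarrow> 0"
    using a0 b0 by simp
  have alim: "(\<lambda>k. LINT x:B|lebesgue. (d k x)\<^sup>2) \<longlonglongrightarrow> 0" and blim: "b \<longlonglongrightarrow> 0"
    by (rule tendsto_sandwich[OF _ _ tendsto_const ab]; use a0 b0 in simp)+
  have e: "(\<lambda>k. LINT x:B|lebesgue. \<bar>\<phi> k x - v x\<bar>) \<longlonglongrightarrow> 0" "set_integrable lebesgue B (\<lambda>x. \<bar>\<phi> k x - v x\<bar>)" for k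
  proof -
    have "(LINT x:B|lebesgue. \<bar>\<phi> k x - v x\<bar>) = (LINT x:B|lebesgue. \<bar>d k x\<bar>)" for k
      unfolding d_def by (rule cong[symmetric])
    then show "(\<lambda>k. LINT x:B|lebesgue. \<bar>\<phi> k x - v x\<bar>) \<longlonglongrightarrow> 0"
      using L2_tendsto_imp_L1_tendsto(1)[OF B(1,2) dL alim] by simp
    show "set_integrable lebesgue B (\<lambda>x. \<bar>\<phi> k x - v x\<bar>)"
      using L2_tendsto_imp_L1_tendsto(2)[OF B(1,2) dL alim, of k] unfolding d_def by (rule icong[THEN iffD1])
  qed
  have iv: "set_integrable lebesgue B v"
  proof -
    have "set_integrable lebesgue B (\<lambda>x. \<bar>\<phi> 0 x - v x\<bar> + \<bar>\<phi> 0 x\<bar>)"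
      by (intro set_integral_add(1) e set_integrable_abs set_integrable_continuous cont B)
    moreover have "set_borel_measurable lebesgue B v"
      unfolding set_borel_measurable_def using vm B by (intro borel_measurable_scaleR borel_measurable_indicator) auto
    ultimately show ?thesis by (rule set_integrable_bounded_by) auto
  qed
  note lip = lipschitz_integral_tendsto[OF _ _ cont(1) vm iv[unfolded B_def] e[unfolded B_def], folded B_def]
  obtain A M W where W: "W > 0" and onofri: "\<And>\<phi> \<delta> c. \<phi> \<in> test_functions B \<Longrightarrow> \<delta> > 0 \<Longrightarrow>
      c = 1 + (LINT x:B|lebesgue. (exp (trunc \<delta> (\<phi> x)) - 1) * mu2 x) / W \<Longrightarrow>
      A * (sqrt c - 1) - M * (c - 1) \<le>
        1 / (16 * pi) * (LINT x:B|lebesgue. (norm (\<chi> i. partial i \<phi> x))\<^sup>2) +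
        (LINT x:B|lebesgue. trunc \<delta> (\<phi> x) * mu2 x)"
    by (rule onofri_test[OF R, folded B_def]) (rule that)
  \<comment> \<open>The rest of the argument uses only that \<open>L\<close> is continuous and that
    \<open>L 1 = 0\<close>.\<close>
  define L where "L c = A * (sqrt c - 1) - M * (c - 1)" for c
  have Lcont: "(\<lambda>k. L (c k)) \<longlonglongrightarrow> L c0" if "c \<longlonglongrightarrow> c0" for c c0
    unfolding L_def by (intro tendsto_intros that)
  define c where "c \<delta> = 1 + (LINT x:B|lebesgue. (exp (trunc \<delta> (v x)) - 1) * mu2 x) / W" for \<delta>
  have step: "L (c \<delta>) \<le> 1 / (16 * pi) * D + (LINT x:B|lebesgue. trunc \<delta> (v x) * mu2 x)" if \<delta>: "\<delta> > 0" for \<delta>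
  proof -
    have tc: "continuous_on UNIV (trunc \<delta>)"
      by (meson DERIV_isCont trunc_deriv[OF \<delta>] continuous_at_imp_continuous_on)
    have l1: "(\<lambda>k. LINT x:B|lebesgue. trunc \<delta> (\<phi> k x) * mu2 x) \<longlonglongrightarrow> (LINT x:B|lebesgue. trunc \<delta> (v x) * mu2 x)"
      using trunc_lipschitz[OF \<delta>] tc by (intro lip[where C=1]) auto
    have "(\<lambda>k. LINT x:B|lebesgue. (exp (trunc \<delta> (\<phi> k x)) - 1) * mu2 x) \<longlonglongrightarrow> (LINT x:B|lebesgue. (exp (trunc \<delta> (v x)) - 1) * mu2 x)"
      using exp_trunc_lipschitz[OF \<delta>] by (intro lip[where C="(1 + \<delta>) / \<delta>"]) (auto intro!: continuous_intros tc)
    then have "(\<lambda>k. 1 + (LINT x:B|lebesgue. (exp (trunc \<delta> (\<phi> k x)) - 1) * mu2 x) / W) \<longlonglongrightarrow> c \<delta>"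
      unfolding c_def using W by (intro tendsto_intros) auto
    note l2 = Lcont[OF this]
    have eta: "L (c \<delta>) \<le> 1 / (16 * pi) * ((1 + \<eta>) * D) + (LINT x:B|lebesgue. trunc \<delta> (v x) * mu2 x)" if \<eta>: "\<eta> > 0" for \<eta>
    proof (rule LIMSEQ_le[OF l2])
      show "(\<lambda>k. 1 / (16 * pi) * ((1 + \<eta>) * D + (1 + 1 / \<eta>) * b k) + (LINT x:B|lebesgue. trunc \<delta> (\<phi> k x) * mu2 x)) \<longlonglongrightarrow>
         1 / (16 * pi) * ((1 + \<eta>) * D) + (LINT x:B|lebesgue. trunc \<delta> (v x) * mu2 x)"
        by (rule tendsto_eq_intros blim l1 refl | simp)+
      show "\<exists>N. \<forall>k\<ge>N. L (1 + (LINT x:B|lebesgue. (exp (trunc \<delta> (\<phi> k x)) - 1) * mu2 x) / W) \<le>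
        1 / (16 * pi) * ((1 + \<eta>) * D + (1 + 1 / \<eta>) * b k) + (LINT x:B|lebesgue. trunc \<delta> (\<phi> k x) * mu2 x)"
      proof (intro exI allI impI)
        fix k
        have "(LINT x:B|lebesgue. (norm (G k x))\<^sup>2) \<le> (LINT x:B|lebesgue. (1 + \<eta>) * (norm (w x))\<^sup>2 + (1 + 1 / \<eta>) * (norm (G k x - w x))\<^sup>2)"
          by (intro set_integral_mono iG set_integral_add(1) set_integrable_mult_right iD ib norm_power2_le \<eta>)
        also have "\<dots> = (1 + \<eta>) * D + (1 + 1 / \<eta>) * b k"
          unfolding D_def b_def
          by (subst set_integral_add(2)) (auto intro!: set_integrable_mult_right iD ib)
        finally have "1 / (16 * pi) * (LINT x:B|lebesgue. (norm (G k x))\<^sup>2) \<le> 1 / (16 * pi) * ((1 + \<eta>) * D + (1 + 1 / \<eta>) * b k)"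
          by (intro mult_left_mono) auto
        then show "L (1 + (LINT x:B|lebesgue. (exp (trunc \<delta> (\<phi> k x)) - 1) * mu2 x) / W) \<le>
          1 / (16 * pi) * ((1 + \<eta>) * D + (1 + 1 / \<eta>) * b k) + (LINT x:B|lebesgue. trunc \<delta> (\<phi> k x) * mu2 x)"
          using onofri[OF \<phi> \<delta> refl, of k] unfolding L_def G_def by linarith
      qed
    qed
    have "((\<lambda>\<eta>. 1 / (16 * pi) * ((1 + \<eta>) * D) + (LINT x:B|lebesgue. trunc \<delta> (v x) * mu2 x)) \<longlongrightarrow>
        1 / (16 * pi) * ((1 + 0) * D) + (LINT x:B|lebesgue. trunc \<delta> (v x) * mu2 x)) (at_right 0)"
      by (intro tendsto_intros)
    then have "L (c \<delta>) \<le> 1 / (16 * pi) * ((1 + 0) * D) + (LINT x:B|lebesgue. trunc \<delta> (v x) * mu2 x)"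
    proof (rule tendsto_lowerbound)
      show "\<forall>\<^sub>F \<eta> in at_right 0. L (c \<delta>) \<le> 1 / (16 * pi) * ((1 + \<eta>) * D) + (LINT x:B|lebesgue. trunc \<delta> (v x) * mu2 x)"
        using eventually_at_right_less[of 0] by eventually_elim (rule eta)
    qed simp
    then show ?thesis by simp
  qed
  define \<delta> where "\<delta> n = inverse (real (Suc n))" for n
  have \<delta>pos: "\<delta> n > 0" "\<delta> n \<le> 1" for n by (auto simp: \<delta>_def inverse_le_1_iff)
  have "filterlim \<delta> (at_right 0) sequentially"
    using LIMSEQ_inverse_real_of_nat \<delta>pos by (auto simp: filterlim_at \<delta>_def[abs_def])
  from filterlim_compose[OF trunc_tendsto this] have tl: "(\<lambda>n. trunc (\<delta> n) t) \<longlonglongrightarrow> t" for t .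
  have tm: "(\<lambda>x. trunc (\<delta> n) (v x)) \<in> borel_measurable lebesgue" for n
    unfolding trunc_def using vm by measurable
  have im: "(\<lambda>x. indicator B x * F x) \<in> borel_measurable lebesgue" if "F \<in> borel_measurable lebesgue" for F :: "real ^ 2 \<Rightarrow> real"
    using that B(4) by measurable
  have expm: "set_borel_measurable lebesgue B (\<lambda>x. exp (u x))"
  proof -
    have "(\<lambda>x. indicator B x * exp (v x)) \<in> borel_measurable lebesgue" using vm by (intro im) measurable
    also have "(\<lambda>x. indicator B x * exp (v x)) = (\<lambda>x. indicator B x *\<^sub>R exp (u x))"
      using vu by (auto simp: indicator_def)
    finally show ?thesis by (simp add: set_borel_measurable_def)
  qed
  have iexp: "set_integrable lebesgue B (\<lambda>x. exp (v x) * mu2 x)" "(LINT x:B|lebesgue. exp (v x) * mu2 x) = theta R"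
    using ue mu2_measure_integral[OF expm] icong[of "\<lambda>t x. exp t * mu2 x"] cong[of "\<lambda>t x. exp t * mu2 x"] by auto
  have imu: "set_integrable lebesgue B mu2" by (intro set_integrable_continuous mu2_continuous B)
  have lin: "(\<lambda>n. LINT x:B|lebesgue. trunc (\<delta> n) (v x) * mu2 x) \<longlonglongrightarrow> (LINT x:B|lebesgue. v x * mu2 x)"
    unfolding set_lebesgue_integral_def real_scaleR_def
  proof (rule integral_dominated_convergence)
    show "integrable lebesgue (\<lambda>x. \<bar>indicator B x * v x\<bar>)"
      using iv by (intro integrable_abs) (simp add: set_integrable_def)
    show "(\<lambda>x. indicator B x * (v x * mu2 x)) \<in> borel_measurable lebesgue" "(\<lambda>x. indicator B x * (trunc (\<delta> n) (v x) * mu2 x)) \<in> borel_measurable lebesgue" for n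
      using vm tm by (intro im borel_measurable_times mu2_measurable; simp)+
    show "AE x in lebesgue. (\<lambda>n. indicator B x * (trunc (\<delta> n) (v x) * mu2 x)) \<longlonglongrightarrow> indicator B x * (v x * mu2 x)"
      by (intro AE_I2 tendsto_intros tl)
    show "AE x in lebesgue. norm (indicator B x * (trunc (\<delta> n) (v x) * mu2 x)) \<le> \<bar>indicator B x * v x\<bar>" for n
    proof (rule AE_I2)
      fix x
      have "\<bar>trunc (\<delta> n) (v x)\<bar> \<le> \<bar>v x\<bar>" using trunc_lipschitz[OF \<delta>pos(1), of n "v x" 0] by simp
      then have "\<bar>trunc (\<delta> n) (v x)\<bar> * mu2 x \<le> \<bar>v x\<bar> * 1"
        using mu2_le_1 mu2_pos[of x] by (intro mult_mono) auto
      then show "norm (indicator B x * (trunc (\<delta> n) (v x) * mu2 x)) \<le> \<bar>indicator B x * v x\<bar>"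
        using mu2_pos[of x] by (auto simp: indicator_def abs_mult)
    qed
  qed
  have "(\<lambda>n. LINT x:B|lebesgue. (exp (trunc (\<delta> n) (v x)) - 1) * mu2 x) \<longlonglongrightarrow> (LINT x:B|lebesgue. (exp (v x) - 1) * mu2 x)"
    unfolding set_lebesgue_integral_def real_scaleR_def
  proof (rule integral_dominated_convergence)
    have "set_integrable lebesgue B (\<lambda>x. 2 * (exp (v x) * mu2 x) + mu2 x)"
      by (intro set_integral_add(1) set_integrable_mult_right iexp imu)
    then show "integrable lebesgue (\<lambda>x. indicator B x * (2 * (exp (v x) * mu2 x) + mu2 x))"
      by (simp add: set_integrable_def)
    show "(\<lambda>x. indicator B x * ((exp (v x) - 1) * mu2 x)) \<in> borel_measurable lebesgue" "(\<lambda>x. indicator B x * ((exp (trunc (\<delta> n) (v x)) - 1) * mu2 x)) \<in> borel_measurable lebesgue" for n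
      using vm tm by (intro im borel_measurable_times mu2_measurable; simp)+
    show "AE x in lebesgue. (\<lambda>n. indicator B x * ((exp (trunc (\<delta> n) (v x)) - 1) * mu2 x)) \<longlonglongrightarrow> indicator B x * ((exp (v x) - 1) * mu2 x)"
      by (intro AE_I2 tendsto_intros tl)
    show "AE x in lebesgue. norm (indicator B x * ((exp (trunc (\<delta> n) (v x)) - 1) * mu2 x)) \<le> indicator B x * (2 * (exp (v x) * mu2 x) + mu2 x)" for n
    proof (rule AE_I2)
      fix x
      have "(1 + \<delta> n) * exp (v x) \<le> 2 * exp (v x)" using \<delta>pos[of n] by (intro mult_right_mono) auto
      then have "exp (trunc (\<delta> n) (v x)) \<le> 2 * exp (v x)"
        using exp_trunc_le[OF \<delta>pos(1), of n "v x"] by linarith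
      then have "\<bar>exp (trunc (\<delta> n) (v x)) - 1\<bar> \<le> 2 * exp (v x) + 1"
        using exp_gt_zero[of "trunc (\<delta> n) (v x)"] by linarith
      then have "\<bar>exp (trunc (\<delta> n) (v x)) - 1\<bar> * mu2 x \<le> (2 * exp (v x) + 1) * mu2 x"
        using mu2_pos[of x] by (intro mult_right_mono) auto
      also have "\<dots> = 2 * (exp (v x) * mu2 x) + mu2 x" by (simp add: distrib_right)
      finally have "\<bar>exp (trunc (\<delta> n) (v x)) - 1\<bar> * mu2 x \<le> 2 * (exp (v x) * mu2 x) + mu2 x" .
      then show "norm (indicator B x * ((exp (trunc (\<delta> n) (v x)) - 1) * mu2 x)) \<le> indicator B x * (2 * (exp (v x) * mu2 x) + mu2 x)"
        using mu2_pos[of x] by (simp add: indicator_def abs_mult)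
    qed
  qed
  \<comment> \<open>Here the value of the constraint enters: \<open>theta R\<close> is also the mass
    of \<open>B\<close> under \<open>mu2\<close>, so the mass ratios \<open>c (\<delta> n)\<close>
    tend to 1 and the defect disappears.\<close>
  moreover have "(LINT x:B|lebesgue. (exp (v x) - 1) * mu2 x) = 0"
    using set_integral_diff(2)[OF iexp(1) imu] iexp(2) by (simp add: left_diff_distrib theta_def B_def)
  ultimately have "(\<lambda>n. c (\<delta> n)) \<longlonglongrightarrow> 1 + 0 / W"
    unfolding c_def using W by (intro tendsto_intros) auto
  from Lcont[OF this] have "(\<lambda>n. L (c (\<delta> n))) \<longlonglongrightarrow> 0" by (simp add: L_def)
  then have "0 \<le> 1 / (16 * pi) * D + (LINT x:B|lebesgue. v x * mu2 x)"
    by (rule LIMSEQ_le[OF _ tendsto_add[OF tendsto_const lin]]) (use step \<delta>pos in auto)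
  also have "\<dots> = I_fun R u"
    using I_fun_eq[OF w(1)[unfolded B_def]] set_integrable_imp_set_borel_measurable[OF iD] um cong[of "\<lambda>t x. t * mu2 x"]
    by (simp add: D_def B_def)
  finally show ?thesis .
qed

theorem theorem3p1:
  fixes R :: real
  assumes "R > 0"
  shows "theta R = R\<^sup>2 / (1 + R\<^sup>2) \<and>
    (SUP \<rho>\<in>J_admissible R. ereal (J_fun R \<rho> - J_fun R mu2))
      = (INF u\<in>I_admissible R. ereal (I_fun R u)) \<and>
    mu2 \<in> J_admissible R \<and>
    ereal (J_fun R mu2 - J_fun R mu2) = (SUP \<rho>\<in>J_admissible R. ereal (J_fun R \<rho> - J_fun R mu2)) \<and>
    (\<lambda>x. 0) \<in> I_admissible R \<and>
    ereal (I_fun R (\<lambda>x. 0)) = (INF u\<in>I_admissible R. ereal (I_fun R u)) \<and>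
    (SUP \<rho>\<in>J_admissible R. ereal (J_fun R \<rho> - J_fun R mu2)) = 0 \<and>
    (INF u\<in>I_admissible R. ereal (I_fun R u)) = 0"
proof -
  \<comment> \<open>No duality between the two problems is invoked: each extremum is shown to be 0
    separately, with the stated optimiser giving one of the two bounds.\<close>
  have S: "(SUP \<rho>\<in>J_admissible R. ereal (J_fun R \<rho> - J_fun R mu2)) = 0"
  proof (rule antisym)
    show "(SUP \<rho>\<in>J_admissible R. ereal (J_fun R \<rho> - J_fun R mu2)) \<le> 0"
      using J_le by (intro SUP_least) auto
    show "0 \<le> (SUP \<rho>\<in>J_admissible R. ereal (J_fun R \<rho> - J_fun R mu2))"
      by (rule SUP_upper2[OF mu2_J_admissible]) simp
  qed
  have I: "(INF u\<in>I_admissible R. ereal (I_fun R u)) = 0"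
  proof (rule antisym)
    show "(INF u\<in>I_admissible R. ereal (I_fun R u)) \<le> 0"
      by (rule INF_lower2[OF zero_I_admissible(1)[OF assms]]) (simp add: zero_I_admissible(2)[OF assms])
    show "0 \<le> (INF u\<in>I_admissible R. ereal (I_fun R u))"
      using I_nonneg[OF assms] by (intro INF_greatest) auto
  qed
  show ?thesis
    using assms theta_eq[of R] mu2_J_admissible zero_I_admissible[OF assms] S I
    by (simp add: zero_ereal_def)
qed

end
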